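(* Let $G$ be a topological space with Borel $\sigma$-field, $\{P_u:u\in[0,1]\}$ a family of Markov kernels on $G$, $k\ge 1$ an integer, and $V_0\le V_1\le\cdots\le V_k$ measurable functions $G\to[1,\infty)$. With $F_\ell$, $F_{0,\ell}$, $\|\cdot\|_\ell$, $\|\cdot\|_{j,i}$, $\|\cdot\|_{0,j,i}$ and $T_u\mu=\mu P_u$ as defined in the context, assume: (A1) $T_uF_\ell\subset F_\ell$ for all $0\le \ell\le k$ and $u\in[0,1]$. For each $\ell=0,\ldots,k$ there exist an integer $m_\ell\ge1$ and $\kappa_\ell\in(0,1)$ such that $\sup_{u\in[0,1]}\|T_u^{m_\ell}\|_{0,\ell,\ell}\le\kappa_\ell$ and $\sup_{u\in[0,1]}\|T_u\|_{\ell,\ell}<\infty$; and for each $\mu\in F_\ell$ the map $u\mapsto T_u\mu$ is continuous from $[0,1]$ to $(F_\ell,\|\cdot\|_\ell)$. (A2) For every $1\le\ell\le k$ and $u\in[0,1]$ there is a continuous linear operator $T_u^{(\ell)}:(F_\ell,\|\cdot\|_\ell)\to(F_0,\|\cdot\|_0)$ such that, whenever $0\le s\le s+\ell\le k$: $T_u^{(\ell)}F_{s+\ell}\subset F_s$ for all $u$, $\sup_{u\in[0,1]}\|T_u^{(\ell)}\|_{s+\ell,s}<\infty$, and for every $\mu\in F_{s+\ell}$ the function $u\mapsto T_u^{(\ell-1)}\mu$ is differentiable as a function from $[0,1]$ to $F_s$ with continuous derivative $u\mapsto T_u^{(\ell)}\mu$ (with the convention $T_u^{(0)}=T_u$). Then: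 1. (a) For each $u\in[0,1]$ and $0\le\ell\le k$, $I-T_u$ defines an isomorphism of $(F_{0,\ell},\|\cdot\|_\ell)$, with inverse $(I-T_u)^{-1}=\sum_{i\ge0}T_u^i$. (b) $\max_{0\le\ell\le k}\sup_{u\in[0,1]}\|(I-T_u)^{-1}\|_{0,\ell,\ell}<\infty$. (c) For $0\le\ell\le k$ and $\mu\in F_{0,\ell}$, the map $u\mapsto(I-T_u)^{-1}\mu$ is continuous from $[0,1]$ to $F_\ell$. (d) For each $u\in[0,1]$, $0\le\ell\le k-1$ and $\mu\in F_{0,\ell+1}$, $$\lim_{h\to0}\left\|\frac{(I-T_{u+h})^{-1}\mu-(I-T_u)^{-1}\mu}{h}-(I-T_u)^{-1}T_u^{(1)}(I-T_u)^{-1}\mu\right\|_\ell=0.$$ 2. For each $u\in[0,1]$ there exists a unique probability measure $\mu_u$ on $G$ with $T_u\mu_u=\mu_u$; moreover $\mu_u\in F_k$. 3. The map $f:[0,1]\to F_k$, $f(u)=\mu_u$, is continuous, and there exist functions $f^{(0)},\ldots,f^{(k)}$ with $f^{(0)}=f$ such that for $1\le\ell\le k$: $f^{(\ell)}:[0,1]\to F_{0,k-\ell}$ is continuous; for every $u\in[0,1]$, $\lim_{h\to0}\left\|\frac{f^{(\ell-1)}(u+h)-f^{(\ell-1)}(u)}{h}-f^{(\ell)}(u)\right\|_{k-\ell}=0$; and $$f^{(\ell)}(u)=\sum_{s=1}^{\ell}\binom{\ell}{s}(I-T_u)^{-1}T_u^{(s)}f^{(\ell-s)}(u).$$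
   Context: For a measurable $V:G\to[1,\infty)$, $\mathcal{M}_V(G)$ is the Banach space of signed measures $\mu$ on $G$ with $\|\mu\|_V:=\int V\,d|\mu|<\infty$. For $0\le\ell\le k$, put $F_\ell=\mathcal{M}_{V_\ell}(G)$, $\|\cdot\|_\ell=\|\cdot\|_{V_\ell}$, and $F_{0,\ell}=\{\mu\in F_\ell:\mu(G)=0\}$. Thus $F_k\subset\cdots\subset F_0$. For $0\le i\le j\le k$ and a linear operator $T$ from $F_j$ to $F_i$ (or, for the second norm, defined at least on $F_{0,j}$), $\|T\|_{j,i}=\sup\{\|T\mu\|_i:\mu\in F_j,\|\mu\|_j\le1\}$ and $\|T\|_{0,j,i}=\sup\{\|T\mu\|_i:\mu\in F_{0,j},\|\mu\|_j\le1\}$. $T_u$ is the operator $T_u\mu=\mu P_u$, where $\mu P_u(A)=\int\mu(dx)P_u(x,A)$, and $T_u^m$ is its $m$-th iterate. All limits as $h\to0$ are over $h\neq 0$ with $u+h\in[0,1]$ (one-sided at the endpoints). *)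

theory Defs
  imports "HOL-Probability.Probability"
begin

section \<open>Finite signed Borel measures\<close>

text \<open>Set functions are set to 0 off the Borel sigma-algebra, so that equality in the type is
  equality of signed measures.\<close>

typedef (overloaded) ('a::topological_space) signed_measure =
  "{m :: 'a set \<Rightarrow> real. (\<forall>A. A \<notin> sets borel \<longrightarrow> m A = 0) \<and>
     (\<forall>A :: nat \<Rightarrow> 'a set. range A \<subseteq> sets borel \<longrightarrow> disjoint_family A \<longrightarrow>
        (\<lambda>i. m (A i)) sums m (\<Union>i. A i))}"
  morphisms smeasure Abs_signed_measure
  by (rule exI[of _ "\<lambda>_. 0"]) auto

setup_lifting type_definition_signed_measure

instantiation signed_measure :: (topological_space) real_vector
begin

lift_definition zero_signed_measure :: "'a signed_measure" is "\<lambda>_. 0"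
  by auto

lift_definition plus_signed_measure ::
  "'a signed_measure \<Rightarrow> 'a signed_measure \<Rightarrow> 'a signed_measure" is "\<lambda>m n A. m A + n A"
  by (auto intro!: sums_add)

lift_definition minus_signed_measure ::
  "'a signed_measure \<Rightarrow> 'a signed_measure \<Rightarrow> 'a signed_measure" is "\<lambda>m n A. m A - n A"
  by (auto intro!: sums_diff)

lift_definition uminus_signed_measure :: "'a signed_measure \<Rightarrow> 'a signed_measure" is "\<lambda>m A. - m A"
  by (auto intro!: sums_minus)

lift_definition scaleR_signed_measure :: "real \<Rightarrow> 'a signed_measure \<Rightarrow> 'a signed_measure"
  is "\<lambda>c m A. c * m A"
  by (auto intro!: sums_mult)

instance
  by standard (transfer; simp add: fun_eq_iff algebra_simps)+

end

text \<open>Hahn--Jordan decomposition, with the positive part given by the supremum over measurable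
  subsets. That \<open>measure_of\<close> does not degenerate to the null measure here is shown in
  \<open>emeasure_pos_part\<close> and \<open>emeasure_variation\<close>; see also
  \<open>Jordan_decomposition\<close>.\<close>

definition pos_part :: "('a::topological_space) signed_measure \<Rightarrow> 'a measure" where
  "pos_part \<mu> = measure_of UNIV (sets borel)
     (\<lambda>A. SUP B\<in>{B \<in> sets borel. B \<subseteq> A}. ennreal (smeasure \<mu> B))"

definition neg_part :: "('a::topological_space) signed_measure \<Rightarrow> 'a measure" where
  "neg_part \<mu> = pos_part (- \<mu>)"

definition variation :: "('a::topological_space) signed_measure \<Rightarrow> 'a measure" where
  "variation \<mu> = measure_of UNIV (sets borel)
     (\<lambda>A. emeasure (pos_part \<mu>) A + emeasure (neg_part \<mu>) A)"

definition sintegral :: "('a::topological_space) signed_measure \<Rightarrow> ('a \<Rightarrow> real) \<Rightarrow> real" where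
  "sintegral \<mu> f = (\<integral>x. f x \<partial>pos_part \<mu>) - (\<integral>x. f x \<partial>neg_part \<mu>)"

definition prob_smeasure :: "('a::topological_space) signed_measure \<Rightarrow> bool" where
  "prob_smeasure \<mu> \<longleftrightarrow> (\<forall>A\<in>sets borel. 0 \<le> smeasure \<mu> A) \<and> smeasure \<mu> UNIV = 1"


section \<open>Weighted norms and operator norms\<close>

text \<open>All norms take values in \<^typ>\<open>ennreal\<close>, so that finiteness is never implicit.\<close>

definition V_norm :: "('a::topological_space \<Rightarrow> real) \<Rightarrow> 'a signed_measure \<Rightarrow> ennreal" where
  "V_norm W \<mu> = (\<integral>\<^sup>+x. ennreal (W x) \<partial>variation \<mu>)"

definition MV :: "('a::topological_space \<Rightarrow> real) \<Rightarrow> 'a signed_measure set" where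
  "MV W = {\<mu>. V_norm W \<mu> < \<infinity>}"

definition MV0 :: "('a::topological_space \<Rightarrow> real) \<Rightarrow> 'a signed_measure set" where
  "MV0 W = {\<mu> \<in> MV W. smeasure \<mu> UNIV = 0}"

text \<open>The metric used here is one for measurable weights bounded below by 1, see
  \<open>Metric_space_MV\<close>.\<close>

definition V_topology :: "('a::topological_space \<Rightarrow> real) \<Rightarrow> 'a signed_measure topology" where
  "V_topology W = Metric_space.mtopology (MV W) (\<lambda>\<mu> \<nu>. enn2real (V_norm W (\<mu> - \<nu>)))"

definition op_norm :: "('a::topological_space \<Rightarrow> real) \<Rightarrow> ('a \<Rightarrow> real) \<Rightarrow>
    ('a signed_measure \<Rightarrow> 'a signed_measure) \<Rightarrow> ennreal" where
  "op_norm W W' S = (SUP \<mu>\<in>{\<mu> \<in> MV W. V_norm W \<mu> \<le> 1}. V_norm W' (S \<mu>))"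

definition op_norm0 :: "('a::topological_space \<Rightarrow> real) \<Rightarrow> ('a \<Rightarrow> real) \<Rightarrow>
    ('a signed_measure \<Rightarrow> 'a signed_measure) \<Rightarrow> ennreal" where
  "op_norm0 W W' S = (SUP \<mu>\<in>{\<mu> \<in> MV0 W. V_norm W \<mu> \<le> 1}. V_norm W' (S \<mu>))"

definition lin_on :: "'b::real_vector set \<Rightarrow> ('b \<Rightarrow> 'b) \<Rightarrow> bool" where
  "lin_on S f \<longleftrightarrow> (\<forall>x\<in>S. \<forall>y\<in>S. f (x + y) = f x + f y) \<and> (\<forall>c. \<forall>x\<in>S. f (c *\<^sub>R x) = c *\<^sub>R f x)"

text \<open>Derivative at \<^term>\<open>u\<close> of a curve on the unit interval, one-sided at the endpoints;
  \<^term>\<open>at 0 within S\<close> excludes the increment 0.\<close>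

definition has_V_derivative :: "('a::topological_space \<Rightarrow> real) \<Rightarrow> (real \<Rightarrow> 'a signed_measure) \<Rightarrow>
    'a signed_measure \<Rightarrow> real \<Rightarrow> bool" where
  "has_V_derivative W g D u \<longleftrightarrow>
     ((\<lambda>h. V_norm W ((g (u + h) - g u) /\<^sub>R h - D)) \<longlongrightarrow> 0) (at 0 within {h. u + h \<in> {0..1}})"


section \<open>Markov kernels acting on signed measures\<close>

text \<open>For a Markov kernel the set function below is a signed measure, see
  \<open>smeasure_kernel_op\<close>.\<close>

definition kernel_op :: "('a::topological_space \<Rightarrow> 'a measure) \<Rightarrow>
    'a signed_measure \<Rightarrow> 'a signed_measure" where
  "kernel_op P \<mu> = Abs_signed_measure
     (\<lambda>A. if A \<in> sets borel then sintegral \<mu> (\<lambda>x. measure (P x) A) else 0)"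

text \<open>Inverse of the restriction of \<open>I - S\<close> to \<open>X\<close>.\<close>

definition inv_id_minus :: "'b::real_vector set \<Rightarrow> ('b \<Rightarrow> 'b) \<Rightarrow> 'b \<Rightarrow> 'b" where
  "inv_id_minus X S = inv_into X (\<lambda>x. x - S x)"

definition invariant_prob :: "('a::topological_space signed_measure \<Rightarrow> 'a signed_measure) \<Rightarrow>
    'a signed_measure" where
  "invariant_prob S = (THE \<mu>. prob_smeasure \<mu> \<and> S \<mu> = \<mu>)"


section \<open>Well-definedness\<close>

lemma smeasure_outside: "A \<notin> sets borel \<Longrightarrow> smeasure \<mu> A = 0"
  using smeasure[of \<mu>] by auto

lemma smeasure_sums:
  assumes "range A \<subseteq> sets borel" "disjoint_family A"
  shows "(\<lambda>i. smeasure \<mu> (A i)) sums smeasure \<mu> (\<Union>i. A i)"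
  using smeasure[of \<mu>] assms by auto

lemma smeasure_empty [simp]: "smeasure \<mu> {} = 0"
proof -
  have "(\<lambda>i::nat. smeasure \<mu> {}) sums smeasure \<mu> (\<Union>i::nat. {})"
    by (rule smeasure_sums) (auto simp: disjoint_family_on_def)
  then have "summable (\<lambda>i::nat. smeasure \<mu> {})" by (simp add: sums_iff)
  then show ?thesis by (simp only: summable_const_iff)
qed

lemma smeasure_Un:
  assumes "A \<in> sets borel" "B \<in> sets borel" "A \<inter> B = {}"
  shows "smeasure \<mu> (A \<union> B) = smeasure \<mu> A + smeasure \<mu> B"
proof -
  have "(\<lambda>i. smeasure \<mu> (binaryset A B i)) sums smeasure \<mu> (\<Union>i. binaryset A B i)"
    using assms by (intro smeasure_sums)
      (auto simp: range_binaryset_eq disjoint_family_on_def binaryset_def)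
  moreover have "(\<lambda>i. smeasure \<mu> (binaryset A B i)) sums (smeasure \<mu> A + smeasure \<mu> B)"
    by (rule binaryset_sums) simp
  ultimately show ?thesis by (simp add: UN_binaryset_eq sums_unique2)
qed

lemma smeasure_Diff:
  assumes "A \<in> sets borel" "B \<in> sets borel" "B \<subseteq> A"
  shows "smeasure \<mu> (A - B) = smeasure \<mu> A - smeasure \<mu> B"
  using smeasure_Un[of B "A - B" \<mu>] assms by (auto simp: Un_absorb1)

lemma smeasure_add [simp]: "smeasure (\<mu> + \<nu>) A = smeasure \<mu> A + smeasure \<nu> A"
  by transfer simp
lemma smeasure_minus [simp]: "smeasure (- \<mu>) A = - smeasure \<mu> A"
  by transfer simp
lemma smeasure_diff [simp]: "smeasure (\<mu> - \<nu>) A = smeasure \<mu> A - smeasure \<nu> A"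
  by transfer simp
lemma smeasure_scaleR [simp]: "smeasure (c *\<^sub>R \<mu>) A = c * smeasure \<mu> A"
  by transfer simp
lemma smeasure_zero [simp]: "smeasure 0 A = 0"
  by transfer simp

lemma signed_measure_eqI:
  "(\<And>A. A \<in> sets borel \<Longrightarrow> smeasure \<mu> A = smeasure \<nu> A) \<Longrightarrow> \<mu> = \<nu>"
  by (metis smeasure_inject smeasure_outside ext)

lemma sets_pos_part [simp, measurable_cong]: "sets (pos_part \<mu>) = sets borel"
  unfolding pos_part_def using sets.sigma_sets_eq[of borel] by (subst sets_measure_of) auto
lemma space_pos_part [simp]: "space (pos_part \<mu>) = UNIV"
  unfolding pos_part_def by (subst space_measure_of) auto
lemma sets_neg_part [simp, measurable_cong]: "sets (neg_part \<mu>) = sets borel"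
  unfolding neg_part_def by simp
lemma space_neg_part [simp]: "space (neg_part \<mu>) = UNIV"
  unfolding neg_part_def by simp

lemma SUP_zero: "(SUP B\<in>I. (0::ennreal)) = 0"
  by (cases "I = {}") (auto simp: bot_ennreal)

lemma emeasure_pos_part:
  assumes "A \<in> sets borel"
  shows "emeasure (pos_part \<mu>) A = (SUP B\<in>{B \<in> sets borel. B \<subseteq> A}. ennreal (smeasure \<mu> B))"
proof -
  let ?p = "\<lambda>A. SUP B\<in>{B \<in> sets borel. B \<subseteq> A}. ennreal (smeasure \<mu> B)"
  have mono: "?p A \<le> ?p B" if "A \<subseteq> B" for A B
    by (rule SUP_subset_mono) (use that in auto)
  have superadd: "?p A + ?p B \<le> ?p (A \<union> B)" if "A \<inter> B = {}" for A B
  proof -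
    have "ennreal (smeasure \<mu> C) + ennreal (smeasure \<mu> D) \<le> ?p (A \<union> B)"
      if CD: "C \<in> sets borel" "C \<subseteq> A" "D \<in> sets borel" "D \<subseteq> B" for C D
    proof -
      have up: "ennreal (smeasure \<mu> E) \<le> ?p (A \<union> B)" if "E \<in> sets borel" "E \<subseteq> A \<union> B" for E
        by (rule SUP_upper) (use that in auto)
      have eq: "smeasure \<mu> (C \<union> D) = smeasure \<mu> C + smeasure \<mu> D"
        by (rule smeasure_Un) (use CD \<open>A \<inter> B = {}\<close> in auto)
      show ?thesis
      proof (cases "smeasure \<mu> C \<ge> 0 \<and> smeasure \<mu> D \<ge> 0")
        case True
        then have "ennreal (smeasure \<mu> C) + ennreal (smeasure \<mu> D) = ennreal (smeasure \<mu> (C \<union> D))"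
          by (simp add: eq)
        also have "\<dots> \<le> ?p (A \<union> B)" by (rule up) (use CD in auto)
        finally show ?thesis .
      next
        case False
        then have "ennreal (smeasure \<mu> C) = 0 \<or> ennreal (smeasure \<mu> D) = 0" by (auto simp: ennreal_neg)
        moreover have "C \<subseteq> A \<union> B" "D \<subseteq> A \<union> B" using CD by auto
        ultimately show ?thesis using up[of C] up[of D] CD by auto
      qed
    qed
    note le = this
    have ne: "{B \<in> sets borel. B \<subseteq> E} \<noteq> {}" for E :: "'a set"
      using sets.empty_sets[of borel] by blast
    have "?p A + ennreal (smeasure \<mu> D) \<le> ?p (A \<union> B)" if "D \<in> sets borel" "D \<subseteq> B" for D
      unfolding ennreal_SUP_add_left[OF ne, symmetric]
      by (rule SUP_least) (use le that in blast)
    then show ?thesis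
      unfolding ennreal_SUP_add_right[OF ne] by (intro SUP_least) blast
  qed
  have "countably_additive (sets borel) ?p"
  proof (rule countably_additiveI)
    fix A :: "nat \<Rightarrow> 'a set"
    assume A: "range A \<subseteq> sets borel" "disjoint_family A" "(\<Union>i. A i) \<in> sets borel"
    show "(\<Sum>i. ?p (A i)) = ?p (\<Union>i. A i)"
    proof (rule antisym)
      have "(\<Sum>i<n. ?p (A i)) \<le> ?p (\<Union>i<n. A i)" for n
      proof (induction n)
        case (Suc n)
        have "(\<Sum>i<Suc n. ?p (A i)) \<le> ?p (\<Union>i<n. A i) + ?p (A n)"
          using Suc by (simp add: add_mono)
        also have "\<dots> \<le> ?p ((\<Union>i<n. A i) \<union> A n)"
        proof (rule superadd)
          have "A i \<inter> A n = {}" if "i < n" for i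
            using A(2) that by (auto simp: disjoint_family_on_def)
          then show "(\<Union>i<n. A i) \<inter> A n = {}" by auto
        qed
        also have "(\<Union>i<n. A i) \<union> A n = (\<Union>i<Suc n. A i)"
          by (auto simp: lessThan_Suc)
        finally show ?case .
      qed simp
      also have "?p (\<Union>i<n. A i) \<le> ?p (\<Union>i. A i)" for n
        by (rule mono) auto
      finally show "(\<Sum>i. ?p (A i)) \<le> ?p (\<Union>i. A i)"
        by (intro suminf_le_const) auto
      show "?p (\<Union>i. A i) \<le> (\<Sum>i. ?p (A i))"
      proof (rule SUP_least, clarsimp)
        fix B :: "'a set" assume B: "B \<in> sets borel" "B \<subseteq> (\<Union>i. A i)"
        have "(\<lambda>i. smeasure \<mu> (B \<inter> A i)) sums smeasure \<mu> (\<Union>i. B \<inter> A i)"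
          by (rule smeasure_sums) (use A B in \<open>auto simp: disjoint_family_on_def\<close>)
        also have "(\<Union>i. B \<inter> A i) = B" using B by auto
        finally have s: "(\<lambda>i. smeasure \<mu> (B \<inter> A i)) sums smeasure \<mu> B" .
        then have lim: "(\<lambda>n. ennreal (\<Sum>i<n. smeasure \<mu> (B \<inter> A i))) \<longlonglongrightarrow> ennreal (smeasure \<mu> B)"
          by (simp add: sums_def tendsto_ennrealI)
        have "ennreal (\<Sum>i<n. smeasure \<mu> (B \<inter> A i)) \<le> (\<Sum>i. ?p (A i))" for n
        proof -
          have "ennreal (\<Sum>i<n. smeasure \<mu> (B \<inter> A i)) \<le> ennreal (\<Sum>i<n. max 0 (smeasure \<mu> (B \<inter> A i)))"
            by (intro ennreal_leI sum_mono) auto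
          also have "\<dots> = (\<Sum>i<n. ennreal (smeasure \<mu> (B \<inter> A i)))"
            by (subst sum_ennreal[symmetric]) (auto simp del: sum_ennreal simp: max_def ennreal_neg intro!: sum.cong)
          also have "\<dots> \<le> (\<Sum>i<n. ?p (A i))"
            using A B by (intro sum_mono SUP_upper) auto
          also have "\<dots> \<le> (\<Sum>i. ?p (A i))" by (rule sum_le_suminf) auto
          finally show ?thesis .
        qed
        then show "ennreal (smeasure \<mu> B) \<le> (\<Sum>i. ?p (A i))"
          by (intro LIMSEQ_le_const2[OF lim]) auto
      qed
    qed
  qed
  moreover have "positive (sets borel) ?p" by (auto simp: positive_def)
  ultimately show ?thesis
    using assms sets.sigma_algebra_axioms[of "borel :: 'a measure"]
    by (intro emeasure_measure_of_sigma[OF _ _ _ assms, of UNIV ?p, folded pos_part_def]) auto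
qed

lemma smeasure_le_pos_part:
  "B \<in> sets borel \<Longrightarrow> B \<subseteq> A \<Longrightarrow> A \<in> sets borel \<Longrightarrow> ennreal (smeasure \<mu> B) \<le> emeasure (pos_part \<mu>) A"
  by (auto simp: emeasure_pos_part intro!: SUP_upper)

lemma emeasure_pos_part_finite: "emeasure (pos_part \<mu>) UNIV < \<infinity>"
proof (rule ccontr)
  define bad where "bad A \<longleftrightarrow> A \<in> sets borel \<and> emeasure (pos_part \<mu>) A = \<infinity>" for A
  assume "\<not> emeasure (pos_part \<mu>) UNIV < \<infinity>"
  then have badU: "bad UNIV" by (simp add: bad_def flip: less_top)
  have step: "\<exists>B. bad B \<and> B \<subseteq> A \<and> 1 \<le> \<bar>smeasure \<mu> (A - B)\<bar>" if "bad A" for A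
  proof -
    have A: "A \<in> sets borel" and top: "(SUP B\<in>{B \<in> sets borel. B \<subseteq> A}. ennreal (smeasure \<mu> B)) = top"
      using that by (auto simp: bad_def emeasure_pos_part)
    have "ennreal (\<bar>smeasure \<mu> A\<bar> + 1) < (SUP B\<in>{B \<in> sets borel. B \<subseteq> A}. ennreal (smeasure \<mu> B))"
      unfolding top by simp
    then obtain C where C: "C \<in> sets borel" "C \<subseteq> A" "ennreal (\<bar>smeasure \<mu> A\<bar> + 1) < ennreal (smeasure \<mu> C)"
      unfolding less_SUP_iff by auto
    have c: "\<bar>smeasure \<mu> A\<bar> + 1 < smeasure \<mu> C"
      using C(3) by (subst (asm) ennreal_less_iff) auto
    have d: "smeasure \<mu> (A - C) = smeasure \<mu> A - smeasure \<mu> C"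
      using A C by (rule_tac smeasure_Diff) auto
    have "emeasure (pos_part \<mu>) A = emeasure (pos_part \<mu>) C + emeasure (pos_part \<mu>) (A - C)"
      using A C by (subst plus_emeasure) (auto intro!: arg_cong[where f="emeasure _"])
    then have "bad C \<or> bad (A - C)" using that A C by (auto simp: bad_def ennreal_add_eq_top)
    then show ?thesis
    proof
      assume "bad C" then show ?thesis using C c d by (intro exI[of _ C]) auto
    next
      assume "bad (A - C)"
      moreover have "A - (A - C) = C" using C by auto
      ultimately show ?thesis using C c d by (intro exI[of _ "A - C"]) auto
    qed
  qed
  have "\<exists>A :: nat \<Rightarrow> 'a set. \<forall>n. bad (A n) \<and> (A (Suc n) \<subseteq> A n \<and> 1 \<le> \<bar>smeasure \<mu> (A n - A (Suc n))\<bar>)"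
    by (rule dependent_nat_choice[where P="\<lambda>_. bad"]) (use badU step in auto)
  then obtain A :: "nat \<Rightarrow> 'a set" where A: "\<And>n. bad (A n)" "\<And>n. A (Suc n) \<subseteq> A n"
    "\<And>n. 1 \<le> \<bar>smeasure \<mu> (A n - A (Suc n))\<bar>" by blast
  have dec: "A n \<subseteq> A m" if "m \<le> n" for m n
    using that A(2) by (rule lift_Suc_antimono_le[of A, rotated])
  have "(\<lambda>n. smeasure \<mu> (A n - A (Suc n))) sums smeasure \<mu> (\<Union>n. A n - A (Suc n))"
  proof (rule smeasure_sums)
    show "range (\<lambda>n. A n - A (Suc n)) \<subseteq> sets borel" using A(1) by (auto simp: bad_def)
    have "(A m - A (Suc m)) \<inter> (A n - A (Suc n)) = {}" if "m < n" for m n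
      using dec[of "Suc m" n] that by auto
    then show "disjoint_family (\<lambda>n. A n - A (Suc n))"
      unfolding disjoint_family_on_def by (metis Int_commute linorder_neqE_nat)
  qed
  then have "(\<lambda>n. smeasure \<mu> (A n - A (Suc n))) \<longlonglongrightarrow> 0"
    by (intro summable_LIMSEQ_zero) (simp add: sums_iff)
  then have "eventually (\<lambda>n. \<bar>smeasure \<mu> (A n - A (Suc n))\<bar> < 1) sequentially"
    by (auto simp: tendsto_iff dest!: spec[of _ 1])
  then show False using A(3) by (auto simp: eventually_sequentially not_less)
      (meson A(3) le_refl not_less)
qed

lemma finite_measure_pos_part: "finite_measure (pos_part \<mu>)"
  using emeasure_pos_part_finite[of \<mu>] by (intro finite_measureI) auto
lemma finite_measure_neg_part: "finite_measure (neg_part \<mu>)"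
  unfolding neg_part_def by (rule finite_measure_pos_part)

lemma Jordan_decomposition:
  assumes A: "A \<in> sets borel"
  shows "smeasure \<mu> A = measure (pos_part \<mu>) A - measure (neg_part \<mu>) A"
proof -
  interpret p: finite_measure "pos_part \<mu>" by (rule finite_measure_pos_part)
  interpret n: finite_measure "neg_part \<mu>" by (rule finite_measure_neg_part)
  have le: "measure (pos_part \<nu>) A \<le> smeasure \<nu> A + measure (pos_part (- \<nu>)) A" for \<nu> :: "'a signed_measure"
  proof -
    interpret p: finite_measure "pos_part \<nu>" by (rule finite_measure_pos_part)
    interpret n: finite_measure "pos_part (-\<nu>)" by (rule finite_measure_pos_part)
    have *: "smeasure \<nu> B \<le> smeasure \<nu> A + measure (pos_part (- \<nu>)) A" if B: "B \<in> sets borel" "B \<subseteq> A" for B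
    proof -
      have "ennreal (smeasure (- \<nu>) (A - B)) \<le> emeasure (pos_part (- \<nu>)) A"
        using A B by (intro smeasure_le_pos_part) auto
      then have "smeasure (- \<nu>) (A - B) \<le> measure (pos_part (- \<nu>)) A"
        unfolding n.emeasure_eq_measure by (metis ennreal_le_iff measure_nonneg)
      then show ?thesis using A B by (simp add: smeasure_Diff)
    qed
    have nn: "0 \<le> smeasure \<nu> A + measure (pos_part (- \<nu>)) A" using *[of "{}"] by simp
    have "emeasure (pos_part \<nu>) A \<le> ennreal (smeasure \<nu> A + measure (pos_part (- \<nu>)) A)"
      unfolding emeasure_pos_part[OF A] by (intro SUP_least ennreal_leI) (use * in auto)
    then show ?thesis unfolding p.emeasure_eq_measure using nn by (subst (asm) ennreal_le_iff) auto
  qed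
  show ?thesis using le[of \<mu>] le[of "- \<mu>"] by (simp add: neg_part_def)
qed

lemma sets_variation [simp, measurable_cong]: "sets (variation \<mu>) = sets borel"
  unfolding variation_def using sets.sigma_sets_eq[of borel] by (subst sets_measure_of) auto
lemma space_variation [simp]: "space (variation \<mu>) = UNIV"
  unfolding variation_def by (subst space_measure_of) auto

lemma emeasure_variation:
  assumes A: "A \<in> sets borel"
  shows "emeasure (variation \<mu>) A = emeasure (pos_part \<mu>) A + emeasure (neg_part \<mu>) A"
proof -
  let ?f = "\<lambda>A. emeasure (pos_part \<mu>) A + emeasure (neg_part \<mu>) A"
  have "countably_additive (sets borel) ?f"
  proof (rule countably_additiveI)
    fix A :: "nat \<Rightarrow> 'a set"
    assume A: "range A \<subseteq> sets borel" "disjoint_family A" "(\<Union>i. A i) \<in> sets borel"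
    show "(\<Sum>i. ?f (A i)) = ?f (\<Union>i. A i)"
      using A by (subst suminf_add[symmetric]) (auto simp: suminf_emeasure)
  qed
  moreover have "positive (sets borel) ?f" by (auto simp: positive_def)
  ultimately show ?thesis
    using sets.sigma_algebra_axioms[of "borel :: 'a measure"]
    by (intro emeasure_measure_of_sigma[OF _ _ _ A, of UNIV ?f, folded variation_def]) auto
qed

lemma smeasure_kernel_op:
  fixes P :: "'a::topological_space \<Rightarrow> 'a measure"
  assumes P: "P \<in> borel \<rightarrow>\<^sub>M prob_algebra borel" and A: "A \<in> sets borel"
  shows "smeasure (kernel_op P \<mu>) A = sintegral \<mu> (\<lambda>x. measure (P x) A)"
proof -
  note [measurable] = P
  have Px: "prob_space (P x)" "sets (P x) = sets borel" for x
    using measurable_space[OF P, of x] by (auto simp: space_prob_algebra)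
  have sums: "(\<lambda>i. \<integral>x. measure (P x) (A i) \<partial>M) sums (\<integral>x. measure (P x) (\<Union>i. A i) \<partial>M)"
    if M: "finite_measure M" "sets M = sets borel" and A: "range A \<subseteq> sets borel" "disjoint_family A"
    for M and A :: "nat \<Rightarrow> 'a set"
  proof -
    interpret finite_measure M by fact
    note [measurable_cong] = M(2)
    have [measurable]: "A i \<in> sets borel" for i using A by auto
    have s: "(\<lambda>i. measure (P x) (A i)) sums measure (P x) (\<Union>i. A i)" for x
    proof -
      interpret prob_space "P x" by (rule Px)
      show ?thesis by (rule finite_measure_UNION) (use A Px in auto)
    qed
    have int: "integrable M (\<lambda>x. measure (P x) B)" if [measurable]: "B \<in> sets borel" for B
      by (rule integrable_const_bound[of _ 1]) (auto simp: prob_space.prob_le_1[OF Px(1)])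
    have "(\<lambda>i. \<integral>x. measure (P x) (A i) \<partial>M) sums (\<integral>x. (\<Sum>i. measure (P x) (A i)) \<partial>M)"
    proof (rule sums_integral)
      show "integrable M (\<lambda>x. measure (P x) (A i))" for i by (rule int) measurable
      show "AE x in M. summable (\<lambda>i. norm (measure (P x) (A i)))" using s by (auto simp: sums_iff)
      show "summable (\<lambda>i. \<integral>x. norm (measure (P x) (A i)) \<partial>M)"
      proof (rule summableI_nonneg_bounded[where x="measure M (space M)"])
        fix n
        have "(\<Sum>i<n. \<integral>x. norm (measure (P x) (A i)) \<partial>M) = (\<integral>x. (\<Sum>i<n. measure (P x) (A i)) \<partial>M)"
          by (subst Bochner_Integration.integral_sum) (auto intro!: int)
        also have "\<dots> \<le> (\<integral>x. 1 \<partial>M)"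
        proof (rule integral_mono)
          show "integrable M (\<lambda>x. \<Sum>i<n. measure (P x) (A i))" by (auto intro!: int)
          fix x
          have "(\<Sum>i<n. measure (P x) (A i)) \<le> (\<Sum>i. measure (P x) (A i))"
            by (rule sum_le_suminf) (use s in \<open>auto simp: sums_iff\<close>)
          also have "\<dots> \<le> 1" using s[of x] prob_space.prob_le_1[OF Px(1)] by (simp add: sums_iff)
          finally show "(\<Sum>i<n. measure (P x) (A i)) \<le> 1" .
        qed auto
        finally show "(\<Sum>i<n. \<integral>x. norm (measure (P x) (A i)) \<partial>M) \<le> measure M (space M)" by simp
      qed auto
    qed
    then show ?thesis using s by (simp add: sums_iff)
  qed
  have "(\<lambda>A. if A \<in> sets borel then sintegral \<mu> (\<lambda>x. measure (P x) A) else 0) \<in>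
    {m :: 'a set \<Rightarrow> real. (\<forall>A. A \<notin> sets borel \<longrightarrow> m A = 0) \<and>
     (\<forall>A :: nat \<Rightarrow> 'a set. range A \<subseteq> sets borel \<longrightarrow> disjoint_family A \<longrightarrow>
        (\<lambda>i. m (A i)) sums m (\<Union>i. A i))}"
  proof (safe)
    fix A :: "nat \<Rightarrow> 'a set" assume A: "range A \<subseteq> sets borel" "disjoint_family A"
    then have "\<And>i. A i \<in> sets borel" "(\<Union>i. A i) \<in> sets borel" by auto
    then show "(\<lambda>i. if A i \<in> sets borel then sintegral \<mu> (\<lambda>x. measure (P x) (A i)) else 0) sums
      (if (\<Union>i. A i) \<in> sets borel then sintegral \<mu> (\<lambda>x. measure (P x) (\<Union>i. A i)) else 0)"
      unfolding sintegral_def using A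
      by (simp, intro sums_diff sums finite_measure_pos_part finite_measure_neg_part) auto
  qed auto
  then show ?thesis
    unfolding kernel_op_def using A by (simp add: Abs_signed_measure_inverse)
qed


lemma nn_integral_le_add:
  assumes f: "f \<in> borel_measurable borel"
    and sets: "sets L = sets borel" "sets M = sets borel" "sets N = sets borel"
    and le: "\<And>A. A \<in> sets borel \<Longrightarrow> emeasure L A \<le> emeasure M A + emeasure N A"
  shows "(\<integral>\<^sup>+x. f x \<partial>L) \<le> (\<integral>\<^sup>+x. f x \<partial>M) + (\<integral>\<^sup>+x. f x \<partial>N)"
  using f
proof (induction rule: borel_measurable_induct)
  case (cong f g)
  then have "f = g" by (auto simp: fun_eq_iff)
  then show ?case using cong by simp
next
  case (set A)
  then show ?case using le[of A] sets by simp
next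
  case (mult u c)
  then show ?case using sets mult_left_mono[OF mult.IH, of c]
    by (simp add: nn_integral_cmult distrib_left cong: measurable_cong_sets)
next
  case (add u v)
  then show ?case using sets add_mono[OF add.IH]
    by (simp add: nn_integral_add ac_simps cong: measurable_cong_sets)
next
  case (seq U)
  have "(\<integral>\<^sup>+x. (SUP i. U i) x \<partial>K) = (SUP i. \<integral>\<^sup>+x. U i x \<partial>K)" if "sets K = sets borel" for K
    unfolding SUP_apply using seq that
    by (intro nn_integral_monotone_convergence_SUP) (auto cong: measurable_cong_sets)
  moreover have "(SUP i. \<integral>\<^sup>+x. U i x \<partial>L) \<le> (SUP i. \<integral>\<^sup>+x. U i x \<partial>M) + (SUP i. \<integral>\<^sup>+x. U i x \<partial>N)"
    by (intro SUP_least order_trans[OF seq.IH] add_mono SUP_upper) auto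
  ultimately show ?case using sets by (simp add: image_comp)
qed

lemma emeasure_pos_part_add:
  assumes A: "A \<in> sets borel"
  shows "emeasure (pos_part (\<mu> + \<nu>)) A \<le> emeasure (pos_part \<mu>) A + emeasure (pos_part \<nu>) A"
  unfolding emeasure_pos_part[OF A, of "\<mu> + \<nu>"]
proof (rule SUP_least, clarsimp)
  fix B :: "'a set" assume B: "B \<in> sets borel" "B \<subseteq> A"
  have "ennreal (smeasure \<mu> B + smeasure \<nu> B) \<le> ennreal (smeasure \<mu> B) + ennreal (smeasure \<nu> B)"
  proof (cases "0 \<le> smeasure \<mu> B"; cases "0 \<le> smeasure \<nu> B")
  qed (auto simp: ennreal_neg intro!: ennreal_leI)
  also have "\<dots> \<le> emeasure (pos_part \<mu>) A + emeasure (pos_part \<nu>) A"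
    using A B by (intro add_mono smeasure_le_pos_part)
  finally show "ennreal (smeasure \<mu> B + smeasure \<nu> B)
    \<le> emeasure (pos_part \<mu>) A + emeasure (pos_part \<nu>) A" .
qed

lemma V_norm_triangle:
  assumes W: "W \<in> borel_measurable borel"
  shows "V_norm W (\<mu> + \<nu>) \<le> V_norm W \<mu> + V_norm W \<nu>"
  unfolding V_norm_def
proof (rule nn_integral_le_add)
  fix A :: "'a set" assume A: "A \<in> sets borel"
  show "emeasure (variation (\<mu> + \<nu>)) A \<le> emeasure (variation \<mu>) A + emeasure (variation \<nu>) A"
    using add_mono[OF emeasure_pos_part_add[OF A, of \<mu> \<nu>] emeasure_pos_part_add[OF A, of "- \<mu>" "- \<nu>"]] A
    by (simp add: emeasure_variation neg_part_def ac_simps)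
qed (use W in auto)

lemma variation_minus [simp]: "variation (- \<mu>) = variation \<mu>"
  by (simp add: variation_def neg_part_def add.commute)

lemma V_norm_minus [simp]: "V_norm W (- \<mu>) = V_norm W \<mu>"
  by (simp add: V_norm_def)

lemma V_norm_eq_0_iff:
  assumes W: "W \<in> borel_measurable borel" "\<And>x. 1 \<le> W x"
  shows "V_norm W \<mu> = 0 \<longleftrightarrow> \<mu> = 0"
proof
  assume "V_norm W \<mu> = 0"
  moreover have "emeasure (variation \<mu>) UNIV \<le> V_norm W \<mu>"
  proof -
    have "emeasure (variation \<mu>) UNIV = (\<integral>\<^sup>+x. 1 \<partial>variation \<mu>)" by simp
    also have "\<dots> \<le> V_norm W \<mu>"
      unfolding V_norm_def by (intro nn_integral_mono) (use W in auto)
    finally show ?thesis .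
  qed
  ultimately have "emeasure (pos_part \<mu>) UNIV = 0" "emeasure (neg_part \<mu>) UNIV = 0"
    by (auto simp: emeasure_variation)
  then have "emeasure (pos_part \<mu>) A = 0" "emeasure (neg_part \<mu>) A = 0" if "A \<in> sets borel" for A
    using that emeasure_mono[of A UNIV "pos_part \<mu>"] emeasure_mono[of A UNIV "neg_part \<mu>"] by auto
  then show "\<mu> = 0"
    by (intro signed_measure_eqI) (simp add: Jordan_decomposition[of _ \<mu>] measure_def)
next
  assume "\<mu> = 0"
  then have "emeasure (variation \<mu>) A = 0" if "A \<in> sets borel" for A
    using that by (simp add: emeasure_variation neg_part_def emeasure_pos_part SUP_zero)
  then have "variation \<mu> = null_measure borel"
    by (intro measure_eqI) auto
  then show "V_norm W \<mu> = 0" by (simp add: V_norm_def)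
qed

lemma Metric_space_MV:
  assumes W: "W \<in> borel_measurable borel" "\<And>x. 1 \<le> W x"
  shows "Metric_space (MV W) (\<lambda>\<mu> \<nu>. enn2real (V_norm W (\<mu> - \<nu>)))"
proof
  have fin: "V_norm W (\<mu> - \<nu>) < top" if "\<mu> \<in> MV W" "\<nu> \<in> MV W" for \<mu> \<nu>
    using V_norm_triangle[OF W(1), of \<mu> "- \<nu>"] that
    by (auto simp: MV_def intro: le_less_trans)
  fix \<mu> \<nu> \<rho> :: "'a signed_measure"
  show "0 \<le> enn2real (V_norm W (\<mu> - \<nu>))" by simp
  show "enn2real (V_norm W (\<mu> - \<nu>)) = enn2real (V_norm W (\<nu> - \<mu>))"
    using V_norm_minus[of W "\<mu> - \<nu>"] by simp
  assume m: "\<mu> \<in> MV W" "\<nu> \<in> MV W"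
  show "enn2real (V_norm W (\<mu> - \<nu>)) = 0 \<longleftrightarrow> \<mu> = \<nu>"
    using fin[OF m] V_norm_eq_0_iff[OF W, of "\<mu> - \<nu>"] by (auto simp: enn2real_eq_0_iff)
  assume r: "\<rho> \<in> MV W"
  have "V_norm W (\<mu> - \<rho>) \<le> V_norm W (\<mu> - \<nu>) + V_norm W (\<nu> - \<rho>)"
    using V_norm_triangle[OF W(1), of "\<mu> - \<nu>" "\<nu> - \<rho>"] by simp
  then have "enn2real (V_norm W (\<mu> - \<rho>)) \<le> enn2real (V_norm W (\<mu> - \<nu>) + V_norm W (\<nu> - \<rho>))"
    by (intro enn2real_mono) (use fin m r in \<open>auto simp: less_top[symmetric]\<close>)
  then show "enn2real (V_norm W (\<mu> - \<rho>)) \<le> enn2real (V_norm W (\<mu> - \<nu>)) + enn2real (V_norm W (\<nu> - \<rho>))"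
    using fin m r by (simp add: enn2real_plus)
qed

lemma prob_smeasure_iff:
  "prob_smeasure \<mu> \<longleftrightarrow> (\<exists>M\<in>space (prob_algebra borel). \<forall>A\<in>sets borel. smeasure \<mu> A = measure M A)"
proof
  assume \<mu>: "prob_smeasure \<mu>"
  have "neg_part \<mu> = null_measure borel"
  proof (rule measure_eqI)
    fix A assume A: "A \<in> sets (neg_part \<mu>)"
    have "emeasure (pos_part (- \<mu>)) A \<le> 0"
      using A
    proof (subst emeasure_pos_part)
      show "(SUP B\<in>{B \<in> sets borel. B \<subseteq> A}. ennreal (smeasure (- \<mu>) B)) \<le> 0"
        by (rule SUP_least) (use \<mu> in \<open>auto simp: prob_smeasure_def ennreal_neg\<close>)
    qed simp
    then show "emeasure (neg_part \<mu>) A = emeasure (null_measure borel) A" by (simp add: neg_part_def)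
  qed simp
  then have *: "smeasure \<mu> A = measure (pos_part \<mu>) A" if "A \<in> sets borel" for A
    using Jordan_decomposition[OF that, of \<mu>] by (simp add: measure_def)
  have "prob_space (pos_part \<mu>)"
    using *[of UNIV] \<mu> finite_measure.emeasure_eq_measure[OF finite_measure_pos_part, of \<mu> UNIV]
    by (intro prob_spaceI) (simp add: prob_smeasure_def)
  then show "\<exists>M\<in>space (prob_algebra borel). \<forall>A\<in>sets borel. smeasure \<mu> A = measure M A"
    using * by (intro bexI[of _ "pos_part \<mu>"] ballI) (simp_all add: space_prob_algebra)
next
  assume "\<exists>M\<in>space (prob_algebra borel). \<forall>A\<in>sets borel. smeasure \<mu> A = measure M A"
  then obtain M where M: "sets M = sets borel" "prob_space M"
    "\<And>A. A \<in> sets borel \<Longrightarrow> smeasure \<mu> A = measure M A" unfolding space_prob_algebra by blast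
  have "space M = UNIV" using sets_eq_imp_space_eq[OF M(1)] by simp
  then show "prob_smeasure \<mu>"
    using M(3) prob_space.prob_space[OF M(2)] by (simp add: prob_smeasure_def)
qed

end

theory Submission
  imports Defs
begin

text \<open>On the mean-zero subspaces the powers of \<open>T\<^sub>u\<close> decay geometrically, uniformly in \<open>u\<close>, so
  \<open>R\<^sub>u = (I - T\<^sub>u)\<^sup>-\<^sup>1\<close> is a Neumann series with a uniform bound. The resolvent identity
  \<open>R\<^sub>v - R\<^sub>u = R\<^sub>v (T\<^sub>v - T\<^sub>u) R\<^sub>u\<close> turns strong continuity and differentiability of \<open>T\<close> into those
  of \<open>R\<close>, at the cost of one weight per derivative. The invariant measure is
  \<open>\<delta> + R\<^sub>u (T\<^sub>u \<delta> - \<delta>)\<close> for a Dirac measure \<open>\<delta>\<close>. Iterates of every Dirac measure converge to it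
  setwise, and dominated convergence against an arbitrary invariant probability measure, which
  need not integrate the weights, gives uniqueness. The higher derivatives come from the Leibniz
  rule applied to \<open>f - T f = 0\<close>.\<close>

section \<open>Kernels acting on signed measures\<close>

text \<open>The obstacle is that u \<mapsto> T_u and its derivatives converge only at each fixed
  measure, not in operator norm, and that the derivatives act between different spaces. A composite
  limit is therefore split as A_v g_v - A_u x = A_v (g_v - x) + (A_v - A_u) x: uniform bounds
  control the first term, strong convergence at the fixed vector x the second. Since I - T_u is
  inverted on mean-zero vectors only, the derivatives of T have to annihilate mass; this comes from
  differentiating mass (T_u x) = mass x. None of this involves measure theory, so it is carried out
  in a locale for an abstract scale of normed spaces with a mass functional. For the higher
  derivatives the explicit formula for f^(l) is not differentiated. Instead f^(l) - T_u f^(l) is a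
  combination g_l of lower derivatives, g_l is differentiable by induction, and f^(l) inherits this
  through \<open>deriv_resolvent\<close>, with derivative (I - T_u)^-1 (g_l' + T_u' f^(l)). Pascal's
  rule identifies the argument as g_(l+1).\<close>

text \<open>Identities between Jordan parts, e.g. of \<open>\<mu> + \<nu>\<close>, \<open>\<mu>\<close> and \<open>\<nu>\<close>, only hold for signed
  combinations of their values; the lists carry such an identity over to integrals.\<close>

lemma sum_list_integral_eq_0:
  fixes g :: "'a::topological_space \<Rightarrow> real"
  assumes xs: "\<And>c M. (c, M) \<in> set xs \<Longrightarrow> finite_measure M \<and> sets M = sets borel"
    and eq: "\<And>A. A \<in> sets borel \<Longrightarrow> (\<Sum>(c, M)\<leftarrow>xs. c * measure M A) = 0"
    and g: "g \<in> borel_measurable borel" "\<And>x. 0 \<le> g x" "\<And>x. g x \<le> B"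
  shows "(\<Sum>(c, M)\<leftarrow>xs. c * (\<integral>x. g x \<partial>M)) = 0"
proof -
  have int: "integrable M f"
    if "(c, M) \<in> set xs" "f \<in> borel_measurable borel" "\<And>x. 0 \<le> f x" "\<And>x. f x \<le> B"
    for c M B and f :: "'a \<Rightarrow> real"
  proof -
    have M: "finite_measure M" "sets M = sets borel" using xs[OF that(1)] by auto
    interpret finite_measure M by fact
    note [measurable_cong] = M(2)
    note [measurable] = that(2)
    show ?thesis by (rule integrable_const_bound[where B=B]) (use that in auto)
  qed
  have map_cong0: "(\<Sum>(c, M)\<leftarrow>xs. F c M) = (\<Sum>(c, M)\<leftarrow>xs. G c M)"
    if "\<And>c M. (c, M) \<in> set xs \<Longrightarrow> F c M = G c M" for F G :: "real \<Rightarrow> 'a measure \<Rightarrow> real"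
    by (intro arg_cong[where f=sum_list] map_cong) (use that in auto)
  \<comment> \<open>The bound is quantified inside the induction formula because it changes: a bound
    \<open>B\<close> for \<open>c * u\<close> becomes \<open>B / c\<close> for \<open>u\<close>. For
    \<open>c = 0\<close> it says nothing about \<open>u\<close>, but then every integral
    vanishes.\<close>
  have "\<forall>B. (\<forall>x. g x \<le> B) \<longrightarrow> (\<Sum>(c, M)\<leftarrow>xs. c * (\<integral>x. g x \<partial>M)) = 0"
    using g(1,2)
  proof (induction rule: borel_measurable_induct_real)
    case (set A)
    have "(\<Sum>(c, M)\<leftarrow>xs. c * (\<integral>x. indicator A x \<partial>M)) = (\<Sum>(c, M)\<leftarrow>xs. c * measure M A)"
      using xs set by (intro map_cong0) (auto simp: sets_eq_imp_space_eq[of _ borel])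
    then show ?case using eq[of A] set by simp
  next
    case (mult u c)
    show ?case
    proof (intro allI impI)
      fix B assume B: "\<forall>x. c * u x \<le> B"
      show "(\<Sum>(d, M)\<leftarrow>xs. d * (\<integral>x. c * u x \<partial>M)) = 0"
      proof (cases "c = 0")
        case False
        then have "\<forall>x. u x \<le> B / c" using B mult(1) by (auto simp: field_simps)
        then have "(\<Sum>(d, M)\<leftarrow>xs. d * (\<integral>x. u x \<partial>M)) = 0" using mult by blast
        then have "c * (\<Sum>(d, M)\<leftarrow>xs. d * (\<integral>x. u x \<partial>M)) = 0" by simp
        also have "c * (\<Sum>(d, M)\<leftarrow>xs. d * (\<integral>x. u x \<partial>M)) = (\<Sum>(d, M)\<leftarrow>xs. d * (\<integral>x. c * u x \<partial>M))"
          by (simp add: sum_list_const_mult[symmetric] case_prod_unfold mult.left_commute)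
        finally show ?thesis .
      qed (simp add: case_prod_unfold sum_list_0)
    qed
  next
    case (add u v)
    show ?case
    proof (intro allI impI)
      fix B assume B: "\<forall>x. v x + u x \<le> B"
      have ub: "u x \<le> B" "v x \<le> B" for x
        using spec[OF B, of x] add.hyps(2)[of x] add.hyps(4)[of x] by auto
      have "(\<Sum>(c, M)\<leftarrow>xs. c * (\<integral>x. v x + u x \<partial>M))
          = (\<Sum>(c, M)\<leftarrow>xs. c * (\<integral>x. v x \<partial>M) + c * (\<integral>x. u x \<partial>M))"
        using add.hyps(1-4) ub
        by (intro map_cong0) (subst Bochner_Integration.integral_add, auto intro!: int simp: algebra_simps)
      also have "\<dots> = (\<Sum>(c, M)\<leftarrow>xs. c * (\<integral>x. v x \<partial>M)) + (\<Sum>(c, M)\<leftarrow>xs. c * (\<integral>x. u x \<partial>M))"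
        by (simp add: sum_list_addf case_prod_unfold)
      also have "\<dots> = 0" using add.IH ub by (metis add_0)
      finally show "(\<Sum>(c, M)\<leftarrow>xs. c * (\<integral>x. v x + u x \<partial>M)) = 0" .
    qed
  next
    case (seq U)
    show ?case
    proof (intro allI impI)
      fix B assume B: "\<forall>x. g x \<le> B"
      have Ux: "U i x \<le> g x" for i x
        using seq.hyps(3,4) by (intro incseq_le[of "\<lambda>i. U i x"]) (auto simp: incseq_def le_fun_def)
      have UB: "U i x \<le> B" for i x using Ux[of i x] B by (meson order_trans)
      have g_meas: "g \<in> borel_measurable borel"
        by (rule borel_measurable_LIMSEQ_real[OF _ seq.hyps(1)]) (use seq in auto)
      have lim: "(\<lambda>i. \<integral>x. U i x \<partial>M) \<longlonglongrightarrow> (\<integral>x. g x \<partial>M)" if M: "(c, M) \<in> set xs" for c M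
      proof (rule integral_dominated_convergence[where w="\<lambda>_. B"])
        have s: "sets M = sets borel" "finite_measure M" using xs[OF M] by auto
        show "g \<in> borel_measurable M" "\<And>i. U i \<in> borel_measurable M"
          using g_meas seq.hyps(1) s by (auto cong: measurable_cong_sets)
        show "integrable M (\<lambda>x. B)" using s(2) finite_measure.integrable_const by blast
      qed (use seq UB in \<open>auto\<close>)
      \<comment> \<open>The list induction runs over lists with entries from \<open>xs\<close>,
        since \<open>lim\<close> is available for these entries only.\<close>
      have "(\<lambda>i. \<Sum>(c, M)\<leftarrow>xs'. c * (\<integral>x. U i x \<partial>M)) \<longlonglongrightarrow> (\<Sum>(c, M)\<leftarrow>xs'. c * (\<integral>x. g x \<partial>M))"
        if "set xs' \<subseteq> set xs" for xs'
        using that by (induction xs') (auto intro!: tendsto_add tendsto_mult lim)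
      moreover have "(\<Sum>(c, M)\<leftarrow>xs. c * (\<integral>x. U i x \<partial>M)) = 0" for i
        using seq.IH UB by blast
      ultimately show "(\<Sum>(c, M)\<leftarrow>xs. c * (\<integral>x. g x \<partial>M)) = 0"
        by (metis (no_types, lifting) LIMSEQ_unique order_refl tendsto_const
            tendsto_cong[OF always_eventually])
    qed
  qed
  then show ?thesis using g(3) by blast
qed

text \<open>Pushing the Jordan parts through a kernel gives a difference of measures that need not
  be mutually singular. The integral must therefore not depend on the decomposition chosen.\<close>

lemma sintegral_eq:
  assumes "finite_measure M" "finite_measure N" "sets M = sets borel" "sets N = sets borel"
    and "\<And>A. A \<in> sets borel \<Longrightarrow> smeasure \<mu> A = measure M A - measure N A"
    and "g \<in> borel_measurable borel" "\<And>x. 0 \<le> g x" "\<And>x. g x \<le> 1"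
  shows "sintegral \<mu> g = (\<integral>x. g x \<partial>M) - (\<integral>x. g x \<partial>N)"
proof -
  have "(\<Sum>(c, M)\<leftarrow>[(1, pos_part \<mu>), (-1, neg_part \<mu>), (-1, M), (1, N)]. c * (\<integral>x. g x \<partial>M)) = 0"
    by (rule sum_list_integral_eq_0[where B=1])
      (use assms finite_measure_pos_part finite_measure_neg_part Jordan_decomposition[of _ \<mu>]
        in force)+
  then show ?thesis by (simp add: sintegral_def)
qed

lemma sintegral_add:
  assumes "g \<in> borel_measurable borel" "\<And>x. 0 \<le> g x" "\<And>x. g x \<le> 1"
  shows "sintegral (\<mu> + \<nu>) g = sintegral \<mu> g + sintegral \<nu> g"
proof -
  have "measure (pos_part (\<mu> + \<nu>)) A - measure (neg_part (\<mu> + \<nu>)) A =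
    measure (pos_part \<mu>) A - measure (neg_part \<mu>) A + (measure (pos_part \<nu>) A - measure (neg_part \<nu>) A)"
    if "A \<in> sets borel" for A
    using Jordan_decomposition[OF that] by (metis smeasure_add)
  then have "(\<Sum>(c, M)\<leftarrow>[(1, pos_part (\<mu> + \<nu>)), (-1, neg_part (\<mu> + \<nu>)), (-1, pos_part \<mu>),
      (1, neg_part \<mu>), (-1, pos_part \<nu>), (1, neg_part \<nu>)]. c * (\<integral>x. g x \<partial>M)) = 0"
    by (intro sum_list_integral_eq_0[where B=1])
      (use assms finite_measure_pos_part finite_measure_neg_part in force)+
  then show ?thesis by (simp add: sintegral_def)
qed

lemma sintegral_scaleR:
  assumes "g \<in> borel_measurable borel" "\<And>x. 0 \<le> g x" "\<And>x. g x \<le> 1"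
  shows "sintegral (c *\<^sub>R \<mu>) g = c * sintegral \<mu> g"
proof -
  have "measure (pos_part (c *\<^sub>R \<mu>)) A - measure (neg_part (c *\<^sub>R \<mu>)) A =
    c * (measure (pos_part \<mu>) A - measure (neg_part \<mu>) A)"
    if "A \<in> sets borel" for A
    using Jordan_decomposition[OF that] by (metis smeasure_scaleR)
  then have "(\<Sum>(c, M)\<leftarrow>[(1, pos_part (c *\<^sub>R \<mu>)), (-1, neg_part (c *\<^sub>R \<mu>)),
      (-c, pos_part \<mu>), (c, neg_part \<mu>)]. c * (\<integral>x. g x \<partial>M)) = 0"
    by (intro sum_list_integral_eq_0[where B=1])
      (use assms finite_measure_pos_part finite_measure_neg_part in \<open>force simp: algebra_simps\<close>)+
  then show ?thesis by (simp add: sintegral_def algebra_simps)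
qed

lemma sintegral_indicator: "A \<in> sets borel \<Longrightarrow> sintegral \<mu> (indicator A) = smeasure \<mu> A"
  by (simp add: sintegral_def Jordan_decomposition)

section \<open>Markov kernels: linearity, total mass and duality with bounded functions\<close>

lemma prob_kernelD:
  assumes "P \<in> borel \<rightarrow>\<^sub>M prob_algebra borel"
  shows "prob_space (P x)" "sets (P x) = sets borel" "space (P x) = UNIV"
proof -
  show "prob_space (P x)" "sets (P x) = sets borel"
    using measurable_space[OF assms, of x] by (auto simp: space_prob_algebra)
  then show "space (P x) = UNIV" using sets_eq_imp_space_eq by fastforce
qed

lemma measurable_measure_kernel:
  assumes "P \<in> borel \<rightarrow>\<^sub>M prob_algebra borel" "A \<in> sets borel"
  shows "(\<lambda>x. measure (P x) A) \<in> borel_measurable borel"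
  using assms by measurable

lemma kernel_op_add:
  assumes P: "P \<in> borel \<rightarrow>\<^sub>M prob_algebra borel"
  shows "kernel_op P (\<mu> + \<nu>) = kernel_op P \<mu> + kernel_op P \<nu>"
  by (rule signed_measure_eqI)
    (simp add: smeasure_kernel_op[OF P] sintegral_add measurable_measure_kernel[OF P]
      prob_space.prob_le_1[OF prob_kernelD(1)[OF P]])

lemma kernel_op_scaleR:
  assumes P: "P \<in> borel \<rightarrow>\<^sub>M prob_algebra borel"
  shows "kernel_op P (c *\<^sub>R \<mu>) = c *\<^sub>R kernel_op P \<mu>"
  by (rule signed_measure_eqI)
    (simp add: smeasure_kernel_op[OF P] sintegral_scaleR measurable_measure_kernel[OF P]
      prob_space.prob_le_1[OF prob_kernelD(1)[OF P]])

lemma smeasure_kernel_op_UNIV: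
  assumes P: "P \<in> borel \<rightarrow>\<^sub>M prob_algebra borel"
  shows "smeasure (kernel_op P \<mu>) UNIV = smeasure \<mu> UNIV"
proof -
  have "measure (P x) UNIV = 1" for x
    using prob_space.prob_space[OF prob_kernelD(1)[OF P]] prob_kernelD(3)[OF P] by metis
  then show ?thesis
    using sintegral_indicator[of UNIV \<mu>] by (simp add: smeasure_kernel_op[OF P])
qed

text \<open>\<open>pos_part \<mu> \<bind> P\<close> and \<open>neg_part \<mu> \<bind> P\<close>
  represent \<open>kernel_op P \<mu>\<close> as a difference of finite measures, in general not the
  Jordan one. \<open>sintegral_eq\<close> allows integrating against them, and for each of them the
  claim is the Fubini property of \<open>bind\<close>.\<close>

lemma sintegral_kernel_op:
  assumes P: "P \<in> borel \<rightarrow>\<^sub>M prob_algebra borel"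
    and g: "g \<in> borel_measurable borel" "\<And>x. 0 \<le> g x" "\<And>x. g x \<le> 1"
  shows "sintegral (kernel_op P \<mu>) g = sintegral \<mu> (\<lambda>x. \<integral>y. g y \<partial>P x)"
proof -
  note [measurable] = g(1) P
  have gP_measurable [measurable]: "(\<lambda>x. \<integral>y. g y \<partial>P x) \<in> borel_measurable borel"
    by (rule measurable_compose[OF measurable_prob_algebraD[OF P] integral_measurable_subprob_algebra[OF g(1)]])
  have P': "P \<in> M \<rightarrow>\<^sub>M subprob_algebra borel" if "sets M = sets borel" for M
    using measurable_prob_algebraD[OF P] that by (simp cong: measurable_cong_sets)
  have sets: "sets (M \<bind> P) = sets borel" if "sets M = sets borel" for M
    using P'[OF that] sets_eq_imp_space_eq[OF that] by (intro sets_bind_measurable) auto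
  have em: "emeasure (M \<bind> P) A = ennreal (\<integral>x. measure (P x) A \<partial>M)"
    if M: "sets M = sets borel" "finite_measure M" and [measurable]: "A \<in> sets borel" for M A
  proof -
    interpret finite_measure M by fact
    note [measurable_cong] = M(1)
    have "emeasure (M \<bind> P) A = (\<integral>\<^sup>+x. emeasure (P x) A \<partial>M)"
      using P'[OF M(1)] sets_eq_imp_space_eq[OF M(1)] that by (intro emeasure_bind) auto
    also have "\<dots> = (\<integral>\<^sup>+x. ennreal (measure (P x) A) \<partial>M)"
      using finite_measure.emeasure_eq_measure[OF prob_space.finite_measure[OF prob_kernelD(1)[OF P]]]
      by simp
    also have "\<dots> = ennreal (\<integral>x. measure (P x) A \<partial>M)"
      by (intro nn_integral_eq_integral integrable_const_bound[where B=1])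
        (auto simp: prob_space.prob_le_1[OF prob_kernelD(1)[OF P]])
    finally show ?thesis .
  qed
  have fin: "finite_measure (M \<bind> P)" if M: "sets M = sets borel" "finite_measure M" for M
    using em[OF M, of UNIV] sets_eq_imp_space_eq[OF sets[OF M(1)]] by (intro finite_measureI) simp
  have int: "(\<integral>x. g x \<partial>(M \<bind> P)) = (\<integral>x. (\<integral>y. g y \<partial>P x) \<partial>M)"
    if M: "sets M = sets borel" "finite_measure M" for M
  proof -
    interpret finite_measure M by fact
    note [measurable_cong] = M(1) sets[OF M(1)]
    have gP: "(\<integral>\<^sup>+y. ennreal (g y) \<partial>P x) = ennreal (\<integral>y. g y \<partial>P x)" for x
    proof -
      interpret prob_space "P x" by (rule prob_kernelD[OF P])
      note [measurable_cong] = prob_kernelD(2)[OF P, of x]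
      show ?thesis
        by (intro nn_integral_eq_integral integrable_const_bound[where B=1]) (auto simp: g)
    qed
    have "(\<integral>x. g x \<partial>(M \<bind> P)) = enn2real (\<integral>\<^sup>+x. ennreal (g x) \<partial>(M \<bind> P))"
      by (intro integral_eq_nn_integral) (auto simp: g)
    also have "(\<integral>\<^sup>+x. ennreal (g x) \<partial>(M \<bind> P)) = (\<integral>\<^sup>+x. ennreal (\<integral>y. g y \<partial>P x) \<partial>M)"
      by (subst nn_integral_bind[OF _ P'[OF M(1)]]) (auto simp: gP)
    also have "enn2real \<dots> = (\<integral>x. (\<integral>y. g y \<partial>P x) \<partial>M)"
      by (intro integral_eq_nn_integral[symmetric]) (auto simp: g)
    finally show ?thesis .
  qed
  have meas: "measure (M \<bind> P) A = (\<integral>x. measure (P x) A \<partial>M)"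
    if M: "sets M = sets borel" "finite_measure M" and "A \<in> sets borel" for M A
    using em[OF that] by (simp add: measure_def)
  have "sintegral (kernel_op P \<mu>) g =
      (\<integral>x. g x \<partial>(pos_part \<mu> \<bind> P)) - (\<integral>x. g x \<partial>(neg_part \<mu> \<bind> P))"
    by (rule sintegral_eq)
      (simp_all add: fin sets meas finite_measure_pos_part finite_measure_neg_part g
        smeasure_kernel_op[OF P] sintegral_def)
  also have "\<dots> = sintegral \<mu> (\<lambda>x. \<integral>y. g y \<partial>P x)"
    by (simp add: int finite_measure_pos_part finite_measure_neg_part sintegral_def)
  finally show ?thesis .
qed

text \<open>The function is x \<mapsto> P^n (x, A), built by moving one kernel at a time from the
  measure to the test function. It does not depend on \<open>\<mu>\<close>, so the same function can
  be evaluated at Dirac measures and integrated against an invariant measure about which nothing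
  else is known.\<close>

lemma kernel_op_power_dual:
  assumes P: "P \<in> borel \<rightarrow>\<^sub>M prob_algebra borel" and A: "A \<in> sets borel"
  shows "\<exists>g. g \<in> borel_measurable borel \<and> (\<forall>x. 0 \<le> g x \<and> g x \<le> 1) \<and>
    (\<forall>\<mu>. smeasure ((kernel_op P ^^ n) \<mu>) A = sintegral \<mu> g)"
proof (induction n)
  case 0
  show ?case
    by (rule exI[of _ "indicator A"]) (use A in \<open>auto simp: sintegral_indicator\<close>)
next
  case (Suc n)
  then obtain g where g: "g \<in> borel_measurable borel" "\<And>x. 0 \<le> g x" "\<And>x. g x \<le> 1"
    "\<And>\<mu>. smeasure ((kernel_op P ^^ n) \<mu>) A = sintegral \<mu> g" by auto
  note [measurable] = g(1) P
  have "(\<integral>y. g y \<partial>P x) \<le> 1" for x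
  proof -
    interpret prob_space "P x" by (rule prob_kernelD[OF P])
    note [measurable_cong] = prob_kernelD(2)[OF P, of x]
    have "(\<integral>y. g y \<partial>P x) \<le> (\<integral>y. 1 \<partial>P x)"
      by (intro integral_mono integrable_const_bound[where B=1]) (auto simp: g)
    then show ?thesis by (simp add: prob_space)
  qed
  moreover have "(\<lambda>x. \<integral>y. g y \<partial>P x) \<in> borel_measurable borel"
    by (rule measurable_compose[OF measurable_prob_algebraD[OF P] integral_measurable_subprob_algebra[OF g(1)]])
  ultimately show ?case
    by (intro exI[of _ "\<lambda>x. \<integral>y. g y \<partial>P x"])
      (auto simp: g(2,4) funpow_Suc_right sintegral_kernel_op[OF P g(1-3)] simp del: funpow.simps)
qed


section \<open>Weighted norms\<close>

definition weight :: "('a::topological_space \<Rightarrow> real) \<Rightarrow> bool" where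
  "weight W \<longleftrightarrow> W \<in> borel_measurable borel \<and> (\<forall>x. 1 \<le> W x)"

text \<open>Meaningful on \<open>MV W\<close> only: elsewhere the infinite norm is turned into 0.\<close>

definition wnorm :: "('a::topological_space \<Rightarrow> real) \<Rightarrow> 'a signed_measure \<Rightarrow> real" where
  "wnorm W \<mu> = enn2real (V_norm W \<mu>)"

lemma wnorm_nonneg [simp]: "0 \<le> wnorm W \<mu>"
  by (simp add: wnorm_def)

lemma V_norm_eq_wnorm: "\<mu> \<in> MV W \<Longrightarrow> V_norm W \<mu> = ennreal (wnorm W \<mu>)"
  by (simp add: MV_def wnorm_def)

lemma emeasure_pos_part_scaleR:
  assumes A: "A \<in> sets borel" and c: "0 \<le> c"
  shows "emeasure (pos_part (c *\<^sub>R \<mu>)) A = ennreal c * emeasure (pos_part \<mu>) A"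
proof -
  have "{B \<in> sets borel. B \<subseteq> A} \<noteq> {}" using A by blast
  then show ?thesis
    using A c by (simp add: emeasure_pos_part SUP_mult_left_ennreal ennreal_mult')
qed

lemma V_norm_scaleR:
  assumes W: "weight W"
  shows "V_norm W (c *\<^sub>R \<mu>) = ennreal \<bar>c\<bar> * V_norm W \<mu>"
proof -
  have *: "V_norm W (c *\<^sub>R \<mu>) = ennreal c * V_norm W \<mu>" if c: "0 \<le> c" for c
  proof -
    have "variation (c *\<^sub>R \<mu>) = scale_measure (ennreal c) (variation \<mu>)"
      using c emeasure_pos_part_scaleR[OF _ c, of _ \<mu>] emeasure_pos_part_scaleR[OF _ c, of _ "- \<mu>"]
      by (intro measure_eqI) (simp_all add: emeasure_variation neg_part_def distrib_left)
    moreover have "(\<lambda>x. ennreal (W x)) \<in> borel_measurable (variation \<mu>)"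
      using W by (auto simp: weight_def)
    ultimately show ?thesis
      unfolding V_norm_def by (metis nn_integral_scale_measure)
  qed
  show ?thesis
  proof (cases "0 \<le> c")
    case False
    then show ?thesis using *[of "- c"] V_norm_minus[of W "c *\<^sub>R \<mu>"] by simp
  qed (use * in simp)
qed

lemma abs_smeasure_le_variation:
  assumes A: "A \<in> sets borel"
  shows "\<bar>smeasure \<mu> A\<bar> \<le> measure (variation \<mu>) A"
proof -
  interpret p: finite_measure "pos_part \<mu>" by (rule finite_measure_pos_part)
  interpret n: finite_measure "neg_part \<mu>" by (rule finite_measure_neg_part)
  have "measure (variation \<mu>) A = measure (pos_part \<mu>) A + measure (neg_part \<mu>) A"
    using A by (simp add: measure_def emeasure_variation enn2real_plus less_top[symmetric])
  then show ?thesis using Jordan_decomposition[OF A, of \<mu>] by (simp add: abs_if)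
qed

lemma finite_measure_variation: "finite_measure (variation \<mu>)"
  using finite_measure.emeasure_finite[OF finite_measure_pos_part, of \<mu> UNIV]
    finite_measure.emeasure_finite[OF finite_measure_neg_part, of \<mu> UNIV]
  by (intro finite_measureI) (simp add: emeasure_variation ennreal_add_eq_top)

lemma emeasure_variation_le_V_norm:
  assumes W: "weight W"
  shows "emeasure (variation \<mu>) A \<le> V_norm W \<mu>"
proof -
  have "emeasure (variation \<mu>) A \<le> emeasure (variation \<mu>) UNIV"
    using emeasure_space[of "variation \<mu>" A] by simp
  also have "\<dots> = (\<integral>\<^sup>+x. 1 \<partial>variation \<mu>)" by simp
  also have "\<dots> \<le> V_norm W \<mu>"
    unfolding V_norm_def by (intro nn_integral_mono) (use W in \<open>auto simp: weight_def\<close>)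
  finally show ?thesis .
qed

lemma measure_variation_le_wnorm:
  assumes W: "weight W" and "\<mu> \<in> MV W"
  shows "measure (variation \<mu>) A \<le> wnorm W \<mu>"
  unfolding measure_def wnorm_def
  using emeasure_variation_le_V_norm[OF W] assms(2) by (intro enn2real_mono) (auto simp: MV_def)

lemma abs_smeasure_le_wnorm:
  assumes "weight W" "\<mu> \<in> MV W"
  shows "\<bar>smeasure \<mu> A\<bar> \<le> wnorm W \<mu>"
  using order_trans[OF abs_smeasure_le_variation measure_variation_le_wnorm[OF assms]]
  by (cases "A \<in> sets borel") (auto simp: smeasure_outside)

lemma wnorm_scaleR: "weight W \<Longrightarrow> wnorm W (c *\<^sub>R \<mu>) = \<bar>c\<bar> * wnorm W \<mu>"
  by (simp add: wnorm_def V_norm_scaleR enn2real_mult)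

lemma wnorm_triangle:
  assumes "weight W" "\<mu> \<in> MV W" "\<nu> \<in> MV W"
  shows "wnorm W (\<mu> + \<nu>) \<le> wnorm W \<mu> + wnorm W \<nu>"
proof -
  have "enn2real (V_norm W (\<mu> + \<nu>)) \<le> enn2real (V_norm W \<mu> + V_norm W \<nu>)"
    using assms V_norm_triangle[of W \<mu> \<nu>] by (intro enn2real_mono) (auto simp: weight_def MV_def)
  then show ?thesis using assms by (simp add: wnorm_def enn2real_plus MV_def)
qed

lemma wnorm_eq_0:
  assumes "weight W" "\<mu> \<in> MV W" "wnorm W \<mu> = 0"
  shows "\<mu> = 0"
  using assms V_norm_eq_wnorm[of \<mu> W] V_norm_eq_0_iff[of W \<mu>] by (auto simp: weight_def)

lemma subspace_MV:
  assumes W: "weight W"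
  shows "subspace (MV W)"
proof (rule subspaceI)
  show "0 \<in> MV W" using V_norm_eq_0_iff[of W 0] W by (auto simp: MV_def weight_def)
  show "x + y \<in> MV W" if "x \<in> MV W" "y \<in> MV W" for x y
    using V_norm_triangle[of W x y] that W by (auto simp: MV_def weight_def intro: le_less_trans)
  show "c *\<^sub>R x \<in> MV W" if "x \<in> MV W" for c x
    using that by (auto simp: MV_def V_norm_scaleR[OF W] ennreal_mult_less_top)
qed

lemma V_norm_mono: "(\<And>x. W x \<le> W' x) \<Longrightarrow> V_norm W \<mu> \<le> V_norm W' \<mu>"
  unfolding V_norm_def by (intro nn_integral_mono) (auto intro: ennreal_leI)

section \<open>Completeness of the weighted spaces\<close>

text \<open>In the limit step monotone convergence is applied on the left only; on the right each
  \<open>U i\<close> is simply bounded by the supremum, so no supremum has to be exchanged with the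
  series.\<close>

lemma nn_integral_le_suminf:
  assumes f: "f \<in> borel_measurable borel"
    and sets: "sets L = sets borel" "\<And>i::nat. sets (M i) = sets borel"
    and le: "\<And>A. A \<in> sets borel \<Longrightarrow> emeasure L A \<le> (\<Sum>i. emeasure (M i) A)"
  shows "(\<integral>\<^sup>+x. f x \<partial>L) \<le> (\<Sum>i. \<integral>\<^sup>+x. f x \<partial>M i)"
  using f
proof (induction rule: borel_measurable_induct)
  case (cong f g)
  then have "f = g" by (auto simp: fun_eq_iff)
  then show ?case using cong by simp
next
  case (set A)
  then show ?case using le[of A] sets by simp
next
  case (mult u c)
  then show ?case using sets mult_left_mono[OF mult.IH, of c]
    by (simp add: nn_integral_cmult cong: measurable_cong_sets)
next
  case (add u v)
  then show ?case using sets add_mono[OF add.IH]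
    by (simp add: nn_integral_add suminf_add[symmetric] ac_simps cong: measurable_cong_sets)
next
  case (seq U)
  have "(\<integral>\<^sup>+x. (SUP i. U i) x \<partial>L) = (SUP i. \<integral>\<^sup>+x. U i x \<partial>L)"
    unfolding SUP_apply using seq sets
    by (intro nn_integral_monotone_convergence_SUP) (auto cong: measurable_cong_sets)
  also have "\<dots> \<le> (\<Sum>j. \<integral>\<^sup>+x. (SUP i. U i) x \<partial>M j)"
    by (intro SUP_least order_trans[OF seq.IH] suminf_le nn_integral_mono)
      (auto simp: SUP_apply intro: SUP_upper)
  finally show ?case by (simp add: image_comp)
qed

text \<open>The positive part is a supremum of values on subsets, so a series that converges setwise
  is dominated set by set by the series of positive parts. As the hypothesis is setwise, this
  applies to the tails of a series before its convergence in norm is known.\<close>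

lemma V_norm_le_suminf:
  assumes W: "weight W"
    and s: "\<And>A. A \<in> sets borel \<Longrightarrow> (\<lambda>i. smeasure (x i) A) sums smeasure s A"
  shows "V_norm W s \<le> (\<Sum>i. V_norm W (x i))"
proof -
  have pos: "emeasure (pos_part s) A \<le> (\<Sum>i. emeasure (pos_part (x i)) A)"
    if A: "A \<in> sets borel"
      and s: "\<And>A. A \<in> sets borel \<Longrightarrow> (\<lambda>i. smeasure (x i) A) sums smeasure s A"
    for A and s and x :: "nat \<Rightarrow> 'a signed_measure"
    unfolding emeasure_pos_part[OF A, of s]
  proof (rule SUP_least, clarsimp)
    fix B :: "'a set" assume B: "B \<in> sets borel" "B \<subseteq> A"
    have lim: "(\<lambda>n. ennreal (\<Sum>i<n. smeasure (x i) B)) \<longlonglongrightarrow> ennreal (smeasure s B)"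
      using s[OF B(1)] by (simp add: sums_def tendsto_ennrealI)
    have "ennreal (\<Sum>i<n. smeasure (x i) B) \<le> (\<Sum>i. emeasure (pos_part (x i)) A)" for n
    proof -
      have "ennreal (\<Sum>i<n. smeasure (x i) B) \<le> ennreal (\<Sum>i<n. max 0 (smeasure (x i) B))"
        by (intro ennreal_leI sum_mono) auto
      also have "\<dots> = (\<Sum>i<n. ennreal (smeasure (x i) B))"
        by (subst sum_ennreal[symmetric]) (auto simp del: sum_ennreal simp: max_def ennreal_neg intro!: sum.cong)
      also have "\<dots> \<le> (\<Sum>i<n. emeasure (pos_part (x i)) A)"
        using A B by (intro sum_mono smeasure_le_pos_part) auto
      also have "\<dots> \<le> (\<Sum>i. emeasure (pos_part (x i)) A)" by (rule sum_le_suminf) auto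
      finally show ?thesis .
    qed
    then show "ennreal (smeasure s B) \<le> (\<Sum>i. emeasure (pos_part (x i)) A)"
      by (intro LIMSEQ_le_const2[OF lim]) auto
  qed
  show ?thesis
    unfolding V_norm_def
  proof (rule nn_integral_le_suminf)
    fix A :: "'a set" assume A: "A \<in> sets borel"
    have "(\<lambda>i. smeasure (- x i) B) sums smeasure (- s) B" if "B \<in> sets borel" for B
      using sums_minus[OF s[OF that]] by simp
    from pos[OF A this] pos[OF A s]
    show "emeasure (variation s) A \<le> (\<Sum>i. emeasure (variation (x i)) A)"
      using A by (simp add: emeasure_variation neg_part_def suminf_add[symmetric] add_mono)
  qed (use W in \<open>auto simp: weight_def\<close>)
qed

text \<open>Countable additivity of the setwise sum is an exchange of two series, done as
  integration of a series against counting measure. Absolute convergence holds because for disjoint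
  \<open>A j\<close> the sum over j of \<open>\<bar>smeasure (x i) (A j)\<bar>\<close> is at most
  the total variation of \<open>x i\<close>, hence at most \<open>wnorm W (x i)\<close>.\<close>

lemma smeasure_series:
  fixes x :: "nat \<Rightarrow> 'a::topological_space signed_measure"
  assumes W: "weight W" and x: "\<And>i. x i \<in> MV W" and sum: "summable (\<lambda>i. wnorm W (x i))"
  obtains s where "\<And>A. A \<in> sets borel \<Longrightarrow> (\<lambda>i. smeasure (x i) A) sums smeasure s A"
proof -
  have summ: "summable (\<lambda>i. \<bar>smeasure (x i) A\<bar>)" for A
    by (rule summable_comparison_test'[OF sum, of 0]) (use abs_smeasure_le_wnorm[OF W x] in auto)
  have "(\<lambda>A. \<Sum>i. smeasure (x i) A) \<in> {m :: 'a set \<Rightarrow> real. (\<forall>A. A \<notin> sets borel \<longrightarrow> m A = 0) \<and>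
     (\<forall>A :: nat \<Rightarrow> 'a set. range A \<subseteq> sets borel \<longrightarrow> disjoint_family A \<longrightarrow>
        (\<lambda>i. m (A i)) sums m (\<Union>i. A i))}"
  proof safe
    fix A :: "nat \<Rightarrow> 'a set" assume A: "range A \<subseteq> sets borel" "disjoint_family A"
    have part: "(\<Sum>j<n. \<bar>smeasure (x i) (A j)\<bar>) \<le> wnorm W (x i)" for i n
    proof -
      interpret finite_measure "variation (x i)" by (rule finite_measure_variation)
      have "(\<Sum>j<n. \<bar>smeasure (x i) (A j)\<bar>) \<le> (\<Sum>j<n. measure (variation (x i)) (A j))"
        using A by (intro sum_mono abs_smeasure_le_variation) auto
      also have "\<dots> = measure (variation (x i)) (\<Union>j<n. A j)"
        using A by (intro finite_measure_finite_Union[symmetric])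
          (auto simp: disjoint_family_on_def)
      also have "\<dots> \<le> wnorm W (x i)" by (rule measure_variation_le_wnorm[OF W x])
      finally show ?thesis .
    qed
    have sumA: "(\<lambda>j. smeasure (x i) (A j)) sums smeasure (x i) (\<Union>j. A j)" for i
      using A by (rule smeasure_sums)
    have "(\<lambda>j. \<integral>i. smeasure (x i) (A j) \<partial>count_space UNIV) sums
        (\<integral>i. (\<Sum>j. smeasure (x i) (A j)) \<partial>count_space UNIV)"
    proof (rule sums_integral)
      show "integrable (count_space UNIV) (\<lambda>i. smeasure (x i) (A j))" for j
        using summ by (simp add: integrable_count_space_nat_iff)
      have "summable (\<lambda>j. \<bar>smeasure (x i) (A j)\<bar>)" for i
        by (rule summableI_nonneg_bounded[OF _ part]) auto
      then show "AE i in count_space UNIV. summable (\<lambda>j. norm (smeasure (x i) (A j)))"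
        by simp
      show "summable (\<lambda>j. \<integral>i. norm (smeasure (x i) (A j)) \<partial>count_space UNIV)"
      proof (rule summableI_nonneg_bounded)
        fix n
        have "(\<Sum>j<n. \<integral>i. norm (smeasure (x i) (A j)) \<partial>count_space UNIV)
            = (\<Sum>j<n. \<Sum>i. \<bar>smeasure (x i) (A j)\<bar>)"
          using summ by (intro sum.cong refl) (subst integral_count_space_nat,
            auto simp: integrable_count_space_nat_iff)
        also have "\<dots> = (\<Sum>i. \<Sum>j<n. \<bar>smeasure (x i) (A j)\<bar>)"
          by (intro suminf_sum[symmetric] summ)
        also have "\<dots> \<le> (\<Sum>i. wnorm W (x i))"
          by (intro suminf_le part summable_sum summ sum)
        finally show "(\<Sum>j<n. \<integral>i. norm (smeasure (x i) (A j)) \<partial>count_space UNIV)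
            \<le> (\<Sum>i. wnorm W (x i))" .
      qed simp
    qed
    moreover have "integrable (count_space UNIV) (\<lambda>i. smeasure (x i) B)" for B
      using summ by (simp add: integrable_count_space_nat_iff)
    moreover have "(\<Sum>j. smeasure (x i) (A j)) = smeasure (x i) (\<Union>j. A j)" for i
      using sumA by (simp add: sums_iff)
    ultimately show "(\<lambda>j. \<Sum>i. smeasure (x i) (A j)) sums (\<Sum>i. smeasure (x i) (\<Union>j. A j))"
      by (simp add: integral_count_space_nat)
  qed (simp add: smeasure_outside)
  then have "smeasure (Abs_signed_measure (\<lambda>A. \<Sum>i. smeasure (x i) A)) A = (\<Sum>i. smeasure (x i) A)" for A
    by (simp add: Abs_signed_measure_inverse)
  then have "(\<lambda>i. smeasure (x i) A) sums
      smeasure (Abs_signed_measure (\<lambda>A. \<Sum>i. smeasure (x i) A)) A" for A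
    using summable_rabs_cancel[OF summ] by (simp add: summable_sums)
  then show ?thesis by (rule that)
qed

text \<open>Completeness in the form in which a Neumann series uses it: absolutely convergent series
  instead of Cauchy sequences, with the tail as explicit error.\<close>

lemma MV_complete:
  fixes x :: "nat \<Rightarrow> 'a::topological_space signed_measure"
  assumes W: "weight W" and x: "\<And>i. x i \<in> MV W" and sum: "summable (\<lambda>i. wnorm W (x i))"
  shows "\<exists>s\<in>MV W. \<forall>n. wnorm W (s - (\<Sum>i<n. x i)) \<le> (\<Sum>i. wnorm W (x (i + n)))"
proof -
  obtain s where s: "\<And>A. A \<in> sets borel \<Longrightarrow> (\<lambda>i. smeasure (x i) A) sums smeasure s A"
    using smeasure_series[OF assms] by blast
  have part: "smeasure (\<Sum>i<n. x i) A = (\<Sum>i<n. smeasure (x i) A)" for n A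
    by (induction n) auto
  have V: "V_norm W (s - (\<Sum>i<n. x i)) \<le> ennreal (\<Sum>i. wnorm W (x (i + n)))" for n
  proof -
    have "V_norm W (s - (\<Sum>i<n. x i)) \<le> (\<Sum>i. V_norm W (x (i + n)))"
      using sums_split_initial_segment[OF s, of _ n]
      by (intro V_norm_le_suminf[OF W]) (simp add: part)
    also have "\<dots> = ennreal (\<Sum>i. wnorm W (x (i + n)))"
      using summable_ignore_initial_segment[OF sum] x
      by (simp add: V_norm_eq_wnorm suminf_ennreal2)
    finally show ?thesis .
  qed
  \<comment> \<open>For \<open>n = 0\<close> the partial sum is empty, and the tail bound says that
    \<open>s\<close> has finite norm.\<close>
  have "s \<in> MV W" using V[of 0] by (auto simp: MV_def intro: le_less_trans)
  moreover have "wnorm W (s - (\<Sum>i<n. x i)) \<le> (\<Sum>i. wnorm W (x (i + n)))" for n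
    unfolding wnorm_def[of W "s - _"]
    by (rule enn2real_leI[OF _ V]) (auto intro!: suminf_nonneg summable_ignore_initial_segment sum)
  ultimately show ?thesis by blast
qed

section \<open>Dirac measures\<close>

definition dirac :: "'a::topological_space \<Rightarrow> 'a signed_measure" where
  "dirac x = Abs_signed_measure (\<lambda>A. if A \<in> sets borel then indicator A x else 0)"

lemma smeasure_dirac: "smeasure (dirac x) A = measure (return borel x) A"
proof -
  interpret prob_space "return borel x" by (rule prob_space_return) simp
  have "(\<lambda>A. if A \<in> sets borel then indicator A x else 0) = measure (return borel x)"
    by (auto simp: fun_eq_iff measure_return measure_notin_sets)
  moreover have "(\<lambda>i. measure (return borel x) (A i)) sums measure (return borel x) (\<Union>i. A i)"
    if "range A \<subseteq> sets borel" "disjoint_family A" for A :: "nat \<Rightarrow> 'a set"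
    using that by (intro finite_measure_UNION) auto
  ultimately show ?thesis
    unfolding dirac_def by (simp add: Abs_signed_measure_inverse measure_notin_sets)
qed

lemma sintegral_dirac:
  assumes "g \<in> borel_measurable borel" "\<And>x. 0 \<le> g x" "\<And>x. g x \<le> 1"
  shows "sintegral (dirac x) g = g x"
proof -
  have "sintegral (dirac x) g = (\<integral>y. g y \<partial>return borel x) - (\<integral>y. g y \<partial>null_measure borel)"
    by (rule sintegral_eq)
      (simp_all add: assms smeasure_dirac prob_space.finite_measure[OF prob_space_return]
        finite_measureI)
  also have "\<dots> = g x"
    using assms by (simp add: integral_return integral_null_measure)
  finally show ?thesis .
qed

text \<open>A weight may be unbounded but is finite at each point, and \<open>W x\<close> bounds the
  norm. Dirac measures thus lie in all the spaces at once, which makes them starting points for the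
  invariant measure and for the iterates.\<close>

lemma dirac_in_MV:
  assumes W: "weight W"
  shows "dirac x \<in> MV W"
proof -
  have pos: "emeasure (pos_part (dirac x)) A \<le> indicator A x" if A: "A \<in> sets borel" for A
    unfolding emeasure_pos_part[OF A]
    by (rule SUP_least) (auto simp: smeasure_dirac measure_return indicator_def)
  have neg: "emeasure (neg_part (dirac x)) A = 0" if A: "A \<in> sets borel" for A
    unfolding neg_part_def emeasure_pos_part[OF A]
    by (simp add: smeasure_dirac ennreal_neg SUP_zero)
  have "V_norm W (dirac x) \<le> (\<integral>\<^sup>+y. W y \<partial>return borel x) + (\<integral>\<^sup>+y. W y \<partial>null_measure borel)"
    unfolding V_norm_def
    by (rule nn_integral_le_add) (use W pos neg in \<open>auto simp: weight_def emeasure_variation\<close>)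
  also have "\<dots> = W x"
    using W by (subst nn_integral_return) (auto simp: weight_def)
  also have "\<dots> < \<infinity>" by simp
  finally show ?thesis by (simp add: MV_def)
qed

section \<open>Strongly differentiable families on a scale of spaces\<close>

lemma lin_onD:
  assumes "lin_on S f" "subspace S" "x \<in> S" "y \<in> S"
  shows "f (x + y) = f x + f y" "f (c *\<^sub>R x) = c *\<^sub>R f x" "f (x - y) = f x - f y"
proof -
  have s: "f (c *\<^sub>R x) = c *\<^sub>R f x" if "x \<in> S" for c x
    using assms that by (auto simp: lin_on_def)
  show "f (x + y) = f x + f y" using assms by (auto simp: lin_on_def)
  have "f (x + (-1) *\<^sub>R y) = f x + f ((-1) *\<^sub>R y)"
    using assms subspace_scale[OF assms(2,4), of "-1"] unfolding lin_on_def by blast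
  then show "f (x - y) = f x - f y" using s[of y "-1"] assms(4) by simp
  show "f (c *\<^sub>R x) = c *\<^sub>R f x" using s assms(3) .
qed

lemma lin_on_0: "lin_on S f \<Longrightarrow> subspace S \<Longrightarrow> f 0 = 0"
  using lin_onD(2)[of S f 0 0 0] subspace_0[of S] by simp

lemma lin_on_sum:
  assumes "lin_on S f" "subspace S" "\<And>i. i \<in> A \<Longrightarrow> x i \<in> S"
  shows "f (\<Sum>i\<in>A. c i *\<^sub>R x i) = (\<Sum>i\<in>A. c i *\<^sub>R f (x i))"
  using assms(3)
proof (induction A rule: infinite_finite_induct)
  case (insert j A)
  then have "(\<Sum>i\<in>A. c i *\<^sub>R x i) \<in> S" "c j *\<^sub>R x j \<in> S"
    using assms(2) by (auto intro!: subspace_sum subspace_scale)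
  then show ?case using insert lin_onD[OF assms(1,2)] by simp
qed (simp_all add: lin_on_0[OF assms(1,2)])

lemma lin_on_subset: "lin_on S f \<Longrightarrow> S' \<subseteq> S \<Longrightarrow> lin_on S' f"
  unfolding lin_on_def by blast

text \<open>The intended instance is \<open>F l = MV (V l)\<close>, with \<open>mass\<close> the
  value on the whole space and \<open>d\<close> a Dirac measure. \<open>T s\<close> is the s-th
  derivative and spends s weights, from \<open>F (l + s)\<close> to \<open>F l\<close>. Derivatives
  are limits as \<open>v\<close> tends to \<open>u\<close> rather than in an increment, which makes
  curves composable. \<open>N l\<close> is the norm on \<open>F l\<close> but carries no information
  outside it, hence the many membership premises.\<close>

locale graded_family =
  fixes F :: "nat \<Rightarrow> 'b::real_vector set" and N :: "nat \<Rightarrow> 'b \<Rightarrow> real" and k :: nat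
    and mass :: "'b \<Rightarrow> real" and T :: "nat \<Rightarrow> real \<Rightarrow> 'b \<Rightarrow> 'b" and d :: 'b
  assumes subspace_F: "l \<le> k \<Longrightarrow> subspace (F l)"
    and F_antimono: "i \<le> j \<Longrightarrow> j \<le> k \<Longrightarrow> F j \<subseteq> F i"
    and N_mono: "i \<le> j \<Longrightarrow> j \<le> k \<Longrightarrow> x \<in> F j \<Longrightarrow> N i x \<le> N j x"
    and N_nonneg [simp]: "0 \<le> N l x"
    and N_scaleR: "l \<le> k \<Longrightarrow> N l (c *\<^sub>R x) = \<bar>c\<bar> * N l x"
    and N_triangle: "l \<le> k \<Longrightarrow> x \<in> F l \<Longrightarrow> y \<in> F l \<Longrightarrow> N l (x + y) \<le> N l x + N l y"
    and N_eq_0: "l \<le> k \<Longrightarrow> x \<in> F l \<Longrightarrow> N l x = 0 \<Longrightarrow> x = 0"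
    and complete: "l \<le> k \<Longrightarrow> (\<And>i. X i \<in> F l) \<Longrightarrow> summable (\<lambda>i. N l (X i)) \<Longrightarrow>
      \<exists>s\<in>F l. \<forall>n. N l (s - (\<Sum>i<n. X i)) \<le> (\<Sum>i. N l (X (i + n)))"
    and linear_mass: "linear mass"
    and mass_bound: "x \<in> F 0 \<Longrightarrow> \<bar>mass x\<bar> \<le> N 0 x"
    and lin_T: "s \<le> k \<Longrightarrow> u \<in> {0..1} \<Longrightarrow> lin_on (F s) (T s u)"
    and T_maps: "s + l \<le> k \<Longrightarrow> u \<in> {0..1} \<Longrightarrow> x \<in> F (l + s) \<Longrightarrow> T s u x \<in> F l"
    and T_bound: "s + l \<le> k \<Longrightarrow> \<exists>C. \<forall>u\<in>{0..1}. \<forall>x\<in>F (l + s). N l (T s u x) \<le> C * N (l + s) x"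
    and T_cont: "s + l \<le> k \<Longrightarrow> u \<in> {0..1} \<Longrightarrow> x \<in> F (l + s) \<Longrightarrow>
      ((\<lambda>v. N l (T s v x - T s u x)) \<longlongrightarrow> 0) (at u within {0..1})"
    and T_deriv: "Suc s + l \<le> k \<Longrightarrow> u \<in> {0..1} \<Longrightarrow> x \<in> F (l + Suc s) \<Longrightarrow>
      ((\<lambda>v. N l ((T s v x - T s u x) /\<^sub>R (v - u) - T (Suc s) u x)) \<longlongrightarrow> 0) (at u within {0..1})"
    and mass_T0: "u \<in> {0..1} \<Longrightarrow> x \<in> F 0 \<Longrightarrow> mass (T 0 u x) = mass x"
    and contraction: "l \<le> k \<Longrightarrow> \<exists>m \<kappa>. m \<ge> 1 \<and> 0 < \<kappa> \<and> \<kappa> < 1 \<and>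
      (\<forall>u\<in>{0..1}. \<forall>x\<in>F l. mass x = 0 \<longrightarrow> N l ((T 0 u ^^ m) x) \<le> \<kappa> * N l x)"
    and d: "d \<in> F k" "mass d = 1"
begin

definition "F0 l = {x \<in> F l. mass x = 0}"

lemma subspace_F0: "l \<le> k \<Longrightarrow> subspace (F0 l)"
  using subspace_F[of l] linear_mass
  by (auto simp: F0_def subspace_def linear_0 linear_add linear_scale)

lemma F0_subset: "F0 l \<subseteq> F l"
  by (auto simp: F0_def)

lemma F0_antimono: "i \<le> j \<Longrightarrow> j \<le> k \<Longrightarrow> F0 j \<subseteq> F0 i"
  using F_antimono by (auto simp: F0_def)

lemma F_0: "l \<le> k \<Longrightarrow> x \<in> F l \<Longrightarrow> x \<in> F 0"
  using F_antimono[of 0 l] by auto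

lemma N_0: "l \<le> k \<Longrightarrow> N l 0 = 0"
  using N_scaleR[of l 0 0] by simp

lemma N_minus: "l \<le> k \<Longrightarrow> N l (- x) = N l x"
  using N_scaleR[of l "- 1" x] by simp

lemma N_triangle_diff:
  assumes "l \<le> k" "x \<in> F l" "y \<in> F l"
  shows "N l (x - y) \<le> N l x + N l y"
  using N_triangle[OF assms(1,2), of "- y"] assms subspace_neg[OF subspace_F]
  by (simp add: N_minus)

lemma T_F0: "l \<le> k \<Longrightarrow> u \<in> {0..1} \<Longrightarrow> x \<in> F0 l \<Longrightarrow> T 0 u x \<in> F0 l"
  using T_maps[of 0 l u x] mass_T0[of u x] F_0[of l x] by (auto simp: F0_def)

lemma T_pow_F: "l \<le> k \<Longrightarrow> u \<in> {0..1} \<Longrightarrow> x \<in> F l \<Longrightarrow> (T 0 u ^^ n) x \<in> F l"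
  by (induction n) (use T_maps[of 0 l u] in auto)

lemma T_pow_F0: "l \<le> k \<Longrightarrow> u \<in> {0..1} \<Longrightarrow> x \<in> F0 l \<Longrightarrow> (T 0 u ^^ n) x \<in> F0 l"
  by (induction n) (use T_F0 in auto)

lemma T_pow_diff:
  assumes u: "u \<in> {0..1}" and "x \<in> F 0" "y \<in> F 0"
  shows "(T 0 u ^^ n) (x - y) = (T 0 u ^^ n) x - (T 0 u ^^ n) y"
proof (induction n)
  case (Suc n)
  then show ?case
    using lin_onD(3)[OF lin_T[of 0 u] subspace_F] assms T_pow_F[of 0 u] by simp
qed simp

section \<open>Geometric decay on the mean-zero spaces and the Neumann series\<close>

text \<open>Write \<open>n = r + m * q\<close> with r < m. The q blocks of length m contribute
  \<kappa>^q and the r remaining steps at most C^m. With \<rho> the m-th root of \<kappa>, \<kappa>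
  = \<rho>^m \<le> \<rho>^r, so \<kappa>^q \<le> \<rho>^n / \<kappa>; this is the origin of the
  constant \<open>C ^ m / \<kappa>\<close>, which is independent of \<open>u\<close>.\<close>

lemma geometric:
  assumes l: "l \<le> k"
  obtains M \<rho> where "0 \<le> M" "0 < \<rho>" "\<rho> < 1"
    "\<And>u x n. u \<in> {0..1} \<Longrightarrow> x \<in> F0 l \<Longrightarrow> N l ((T 0 u ^^ n) x) \<le> M * \<rho> ^ n * N l x"
proof -
  obtain m \<kappa> where m: "m \<ge> 1" "0 < \<kappa>" "\<kappa> < 1"
    and contr: "\<And>u x. u \<in> {0..1} \<Longrightarrow> x \<in> F0 l \<Longrightarrow> N l ((T 0 u ^^ m) x) \<le> \<kappa> * N l x"
    using contraction[OF l] by (auto simp: F0_def)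
  obtain C0 where C0: "\<forall>u\<in>{0..1}. \<forall>x\<in>F l. N l (T 0 u x) \<le> C0 * N l x"
    using T_bound[of 0 l] l by auto
  \<comment> \<open>The maximum with 1 makes the powers of \<open>C\<close> increasing, so that
    \<open>C ^ r\<close> is at most \<open>C ^ m\<close>.\<close>
  define C where "C = max 1 C0"
  have C: "N l (T 0 u x) \<le> C * N l x" if "u \<in> {0..1}" "x \<in> F l" for u x
    using C0 that mult_right_mono[of C0 C "N l x"] unfolding C_def by fastforce
  have C1: "1 \<le> C" by (simp add: C_def)
  have pow: "N l ((T 0 u ^^ r) x) \<le> C ^ r * N l x" if u: "u \<in> {0..1}" "x \<in> F l" for u x r
  proof (induction r)
    case (Suc r)
    have "N l ((T 0 u ^^ Suc r) x) \<le> C * N l ((T 0 u ^^ r) x)"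
      using C[OF u(1) T_pow_F[OF l u]] by simp
    also have "\<dots> \<le> C * (C ^ r * N l x)" using Suc C1 by (intro mult_left_mono) auto
    finally show ?case by (simp add: mult.assoc)
  qed simp
  have blocks: "N l ((T 0 u ^^ (m * q)) x) \<le> \<kappa> ^ q * N l x" if u: "u \<in> {0..1}" "x \<in> F0 l" for u x q
  proof (induction q)
    case (Suc q)
    have "N l ((T 0 u ^^ (m * Suc q)) x) = N l ((T 0 u ^^ m) ((T 0 u ^^ (m * q)) x))"
      by (simp add: funpow_add)
    also have "\<dots> \<le> \<kappa> * N l ((T 0 u ^^ (m * q)) x)"
      by (rule contr) (use u T_pow_F0 l in auto)
    also have "\<dots> \<le> \<kappa> * (\<kappa> ^ q * N l x)" using Suc m by (intro mult_left_mono) auto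
    finally show ?case by (simp add: mult.assoc)
  qed simp
  define \<rho> where "\<rho> = root m \<kappa>"
  have \<rho>: "0 < \<rho>" "\<rho> < 1" "\<rho> ^ m = \<kappa>"
    using m by (auto simp: \<rho>_def)
  show ?thesis
  proof (rule that[of "C ^ m / \<kappa>" \<rho>])
    fix u :: real and x and n :: nat
    assume u: "u \<in> {0..1}" "x \<in> F0 l"
    define q r where "q = n div m" and "r = n mod m"
    have n: "n = r + m * q" by (simp add: q_def r_def)
    have r: "r \<le> m" using m by (simp add: r_def less_imp_le)
    have "\<kappa> ^ q * \<kappa> \<le> \<kappa> ^ q * \<rho> ^ r"
      using m \<rho> power_decreasing[OF r, of \<rho>] by (intro mult_left_mono) auto
    also have "\<dots> = \<rho> ^ n" by (simp add: n power_add power_mult \<rho>(3))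
    finally have q: "\<kappa> ^ q \<le> \<rho> ^ n / \<kappa>" using m by (simp add: field_simps)
    have "N l ((T 0 u ^^ n) x) = N l ((T 0 u ^^ r) ((T 0 u ^^ (m * q)) x))"
      by (simp add: n funpow_add)
    also have "\<dots> \<le> C ^ r * N l ((T 0 u ^^ (m * q)) x)"
      using u F0_subset by (intro pow T_pow_F l) auto
    also have "\<dots> \<le> C ^ m * (\<rho> ^ n / \<kappa> * N l x)"
      using C1 r m \<rho> q
      by (intro mult_mono order_trans[OF blocks[OF u]] mult_right_mono power_increasing) auto
    finally show "N l ((T 0 u ^^ n) x) \<le> C ^ m / \<kappa> * \<rho> ^ n * N l x" by simp
  qed (use C1 m \<rho> in auto)
qed

text \<open>The inverse is taken on the largest space, so one operator serves all levels: a preimage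
  found in a smaller \<open>F0 l\<close> is the same one by injectivity on
  \<open>F0 0\<close>.\<close>

definition "R u = inv_id_minus (F0 0) (T 0 u)"

text \<open>The difference of two vectors with the same image is mean-zero and fixed by
  \<open>T 0 u\<close>, hence by all powers, whose norms on it tend to 0.\<close>

lemma inj_on_id_minus_T:
  assumes u: "u \<in> {0..1}"
  shows "inj_on (\<lambda>x. x - T 0 u x) (F0 0)"
proof (rule inj_onI)
  fix x y assume xy: "x \<in> F0 0" "y \<in> F0 0" "x - T 0 u x = y - T 0 u y"
  define z where "z = x - y"
  have z: "z \<in> F0 0" using xy subspace_diff[OF subspace_F0] by (auto simp: z_def)
  have "x - y = T 0 u x - T 0 u y" using xy(3) by (simp add: algebra_simps)
  then have Tz: "T 0 u z = z"
    using xy lin_onD(3)[OF lin_T[of 0 u] subspace_F, of x y] u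
    by (auto simp: z_def F0_def)
  have pow_z: "(T 0 u ^^ n) z = z" for n by (induction n) (simp_all add: Tz)
  obtain M \<rho> where M: "0 \<le> M" "0 < \<rho>" "\<rho> < 1"
    "\<And>u x n. u \<in> {0..1} \<Longrightarrow> x \<in> F0 0 \<Longrightarrow> N 0 ((T 0 u ^^ n) x) \<le> M * \<rho> ^ n * N 0 x"
    using geometric[of 0] by blast
  have "(\<lambda>n. M * \<rho> ^ n * N 0 z) \<longlonglongrightarrow> M * 0 * N 0 z"
    using M by (intro tendsto_intros LIMSEQ_realpow_zero) auto
  then have "N 0 z \<le> M * 0 * N 0 z"
    using M(4)[OF u z] by (intro LIMSEQ_le_const) (auto simp: pow_z)
  then have "N 0 z = 0" using N_nonneg[of 0 z] by simp
  then show "x = y" using N_eq_0[of 0 z] z by (simp add: F0_def z_def)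
qed

lemma R_unique: "u \<in> {0..1} \<Longrightarrow> y \<in> F0 0 \<Longrightarrow> y - T 0 u y = x \<Longrightarrow> R u x = y"
  unfolding R_def inv_id_minus_def using inv_into_f_f[OF inj_on_id_minus_T] by auto

text \<open>Completeness gives a sum \<open>s\<close> in \<open>F l\<close> only. That
  \<open>s\<close> is mean-zero follows from continuity of \<open>mass\<close>, that it is a
  preimage of \<open>x\<close> from telescoping of the partial sums, and \<open>R_unique\<close> at
  level 0 then identifies it with \<open>R u x\<close>. The constant is the one of
  \<open>geometric\<close> divided by 1 - \<rho>.\<close>

lemma resolvent:
  assumes l: "l \<le> k"
  obtains M \<rho> where "0 \<le> M" "0 < \<rho>" "\<rho> < 1"
    "\<And>u x n. u \<in> {0..1} \<Longrightarrow> x \<in> F0 l \<Longrightarrow> N l (R u x - (\<Sum>i<n. (T 0 u ^^ i) x)) \<le> M * \<rho> ^ n * N l x"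
    "\<And>u x. u \<in> {0..1} \<Longrightarrow> x \<in> F0 l \<Longrightarrow> R u x \<in> F0 l \<and> R u x - T 0 u (R u x) = x"
proof -
  obtain M \<rho> where M: "0 \<le> M" "0 < \<rho>" "\<rho> < 1"
    "\<And>u x n. u \<in> {0..1} \<Longrightarrow> x \<in> F0 l \<Longrightarrow> N l ((T 0 u ^^ n) x) \<le> M * \<rho> ^ n * N l x"
    using geometric[OF l] by blast
  have "R u x \<in> F0 l \<and> R u x - T 0 u (R u x) = x \<and>
      (\<forall>n. N l (R u x - (\<Sum>i<n. (T 0 u ^^ i) x)) \<le> M / (1 - \<rho>) * \<rho> ^ n * N l x)"
    if u: "u \<in> {0..1}" and x: "x \<in> F0 l" for u x
  proof -
    have Tx: "(T 0 u ^^ i) x \<in> F0 l" for i by (rule T_pow_F0[OF l u x])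
    have geo: "(\<lambda>i. M * \<rho> ^ (i + n) * N l x) sums (M / (1 - \<rho>) * \<rho> ^ n * N l x)" for n
      using sums_mult[OF geometric_sums[of \<rho>], of "M * \<rho> ^ n * N l x"] M
      by (simp add: power_add mult_ac)
    have sum: "summable (\<lambda>i. N l ((T 0 u ^^ (i + n)) x))" for n
      by (rule summable_comparison_test'[OF sums_summable[OF geo[of n]], of 0])
        (use M(4)[OF u x] in auto)
    obtain s where s: "s \<in> F l"
      "\<And>n. N l (s - (\<Sum>i<n. (T 0 u ^^ i) x)) \<le> (\<Sum>i. N l ((T 0 u ^^ (i + n)) x))"
      using complete[OF l, of "\<lambda>i. (T 0 u ^^ i) x"] Tx F0_subset sum[of 0] by auto
    have bound: "N l (s - (\<Sum>i<n. (T 0 u ^^ i) x)) \<le> M / (1 - \<rho>) * \<rho> ^ n * N l x" for n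
    proof -
      have "(\<Sum>i. N l ((T 0 u ^^ (i + n)) x)) \<le> (\<Sum>i. M * \<rho> ^ (i + n) * N l x)"
        using M(4)[OF u x] geo by (intro suminf_le sum) (auto simp: sums_iff)
      then show ?thesis using s(2)[of n] geo[of n] by (simp add: sums_iff)
    qed
    define p where "p n = (\<Sum>i<n. (T 0 u ^^ i) x)" for n
    have p: "p n \<in> F0 l" for n
      using Tx unfolding p_def by (intro subspace_sum subspace_F0 l)
    have pow0: "(\<lambda>n. M / (1 - \<rho>) * \<rho> ^ n * N l x) \<longlonglongrightarrow> M / (1 - \<rho>) * 0 * N l x"
      using M by (intro tendsto_intros LIMSEQ_realpow_zero) auto
    have lim: "(\<lambda>n. N l (s - p n)) \<longlonglongrightarrow> 0"
      by (rule tendsto_sandwich[OF _ _ tendsto_const pow0[simplified]])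
        (use bound in \<open>auto simp: p_def\<close>)
    have sp: "s - p n \<in> F l" for n
      using s p F0_subset subspace_diff[OF subspace_F[OF l]] by blast
    \<comment> \<open>The partial sums have mass 0, so subtracting one does not change the mass, and
      the remainder tends to 0 in norm.\<close>
    have "\<bar>mass s\<bar> \<le> N l (s - p n)" for n
    proof -
      have "\<bar>mass s\<bar> = \<bar>mass (s - p n)\<bar>"
        using p[of n] linear_mass by (simp add: F0_def linear_diff)
      also have "\<dots> \<le> N 0 (s - p n)" using F_0[OF l sp] by (rule mass_bound)
      also have "\<dots> \<le> N l (s - p n)" using sp l by (intro N_mono) auto
      finally show ?thesis .
    qed
    then have "\<bar>mass s\<bar> \<le> 0" by (intro LIMSEQ_le_const[OF lim]) auto
    then have s0: "s \<in> F0 l" using s by (simp add: F0_def)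
    obtain C where C: "\<forall>u\<in>{0..1}. \<forall>x\<in>F l. N l (T 0 u x) \<le> C * N l x"
      using T_bound[of 0 l] l by auto
    have linT: "lin_on (F l) (T 0 u)"
      using lin_on_subset[OF lin_T[of 0 u]] F_0[OF l] u by auto
    have Tp: "p n - T 0 u (p n) = x - (T 0 u ^^ n) x" for n
    proof -
      have "T 0 u (p n) = (\<Sum>i<n. (T 0 u ^^ Suc i) x)"
        using lin_on_sum[OF linT subspace_F[OF l], of "{..<n}" "\<lambda>i. (T 0 u ^^ i) x" "\<lambda>_. 1"] Tx F0_subset
        by (auto simp: p_def)
      then have "p n - T 0 u (p n) = (\<Sum>i<n. (T 0 u ^^ i) x - (T 0 u ^^ Suc i) x)"
        by (simp add: p_def sum_subtractf)
      also have "\<dots> = x - (T 0 u ^^ n) x"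
        using sum_lessThan_telescope'[of "\<lambda>i. (T 0 u ^^ i) x" n] by simp
      finally show ?thesis .
    qed
    \<comment> \<open>Substituting \<open>x = p n - T 0 u (p n) + (T 0 u ^^ n) x\<close> expresses
      the defect of \<open>s\<close> through \<open>s - p n\<close> and the n-th power at
      \<open>x\<close>, both of which tend to 0.\<close>
    have "N l (s - T 0 u s - x) \<le> (1 + C) * N l (s - p n) + M * \<rho> ^ n * N l x" for n
    proof -
      note d = subspace_diff[OF subspace_F[OF l]]
      have T: "T 0 u (s - p n) \<in> F l" using T_maps[of 0 l u] sp u l by auto
      have "x = p n - T 0 u (p n) + (T 0 u ^^ n) x" using Tp[of n] by simp
      then have e: "s - T 0 u s - x = s - T 0 u s - (p n - T 0 u (p n) + (T 0 u ^^ n) x)"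
        by (fact arg_cong[where f="\<lambda>y. s - T 0 u s - y"])
      also have "\<dots> = (s - p n) - T 0 u (s - p n) - (T 0 u ^^ n) x"
        using lin_onD(3)[OF linT subspace_F[OF l], of s "p n"] s(1) subsetD[OF F0_subset p[of n]]
        by (simp add: algebra_simps)
      also have "N l \<dots> \<le> N l (s - p n) + N l (T 0 u (s - p n)) + N l ((T 0 u ^^ n) x)"
        using N_triangle_diff[OF l d[OF sp T] subsetD[OF F0_subset Tx]] N_triangle_diff[OF l sp T]
        by (rule order_trans[OF _ add_right_mono])
      also have "\<dots> \<le> N l (s - p n) + C * N l (s - p n) + M * \<rho> ^ n * N l x"
        using C u sp M(4)[OF u x] by (intro add_mono) auto
      finally show ?thesis by (simp add: algebra_simps)
    qed
    moreover have "(\<lambda>n. (1 + C) * N l (s - p n) + M * \<rho> ^ n * N l x)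
        \<longlonglongrightarrow> (1 + C) * 0 + M * 0 * N l x"
      using M by (intro tendsto_intros lim LIMSEQ_realpow_zero) auto
    ultimately have "N l (s - T 0 u s - x) \<le> (1 + C) * 0 + M * 0 * N l x"
      by (intro LIMSEQ_le_const) auto
    then have "N l (s - T 0 u s - x) = 0" by (simp add: order_antisym)
    moreover have "s - T 0 u s - x \<in> F l"
      using s(1) subsetD[OF F0_subset x] T_maps[of 0 l u s] u l subspace_diff[OF subspace_F[OF l]]
      by simp
    ultimately have "s - T 0 u s = x" using N_eq_0[OF l] by fastforce
    moreover have "R u x = s"
      by (rule R_unique) (use u s0 calculation F0_antimono[of 0 l] l in auto)
    ultimately show ?thesis using s0 bound by simp
  qed
  then show ?thesis using M by (intro that[of "M / (1 - \<rho>)" \<rho>]) auto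
qed

lemma R_F0: "l \<le> k \<Longrightarrow> u \<in> {0..1} \<Longrightarrow> x \<in> F0 l \<Longrightarrow> R u x \<in> F0 l"
  using resolvent[of l] by metis

lemma R_eq: "u \<in> {0..1} \<Longrightarrow> x \<in> F0 0 \<Longrightarrow> R u x - T 0 u (R u x) = x"
  using resolvent[of 0] by (metis le0)

lemma R_bound:
  assumes "l \<le> k"
  shows "\<exists>K\<ge>0. \<forall>u\<in>{0..1}. \<forall>x\<in>F0 l. N l (R u x) \<le> K * N l x"
proof -
  obtain M \<rho> where "0 \<le> M" "\<And>u x n. u \<in> {0..1} \<Longrightarrow> x \<in> F0 l \<Longrightarrow>
      N l (R u x - (\<Sum>i<n. (T 0 u ^^ i) x)) \<le> M * \<rho> ^ n * N l x"
    using resolvent[OF assms] by metis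
  \<comment> \<open>With no term subtracted, the error bound of the Neumann series is a norm bound
    for \<open>R u\<close>.\<close>
  from this(1) this(2)[of _ _ 0] show ?thesis by (intro exI[of _ M]) auto
qed

lemma lin_on_id_minus_T:
  assumes "l \<le> k" "u \<in> {0..1}"
  shows "lin_on (F l) (\<lambda>x. x - T 0 u x)"
  using lin_T[of 0 u] assms F_0[OF assms(1)]
  by (auto simp: lin_on_def algebra_simps scaleR_diff_right)

lemma lin_on_R:
  assumes l: "l \<le> k" and u: "u \<in> {0..1}"
  shows "lin_on (F0 l) (R u)"
proof -
  have "lin_on (F0 0) (R u)"
    unfolding lin_on_def
  proof (intro conjI ballI allI)
    note L = lin_onD[OF lin_on_subset[OF lin_on_id_minus_T[OF _ u] F0_subset] subspace_F0, of 0]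
    fix x assume x: "x \<in> F0 0"
    note Rx = R_F0[OF _ u x, simplified]
    show "R u (c *\<^sub>R x) = c *\<^sub>R R u x" for c
      using L(2)[OF _ _ Rx Rx] R_eq[OF u x] subspace_scale[OF subspace_F0 Rx]
      by (intro R_unique[OF u]) auto
    fix y assume y: "y \<in> F0 0"
    note Ry = R_F0[OF _ u y, simplified]
    show "R u (x + y) = R u x + R u y"
      using L(1)[OF _ _ Rx Ry] R_eq[OF u x] R_eq[OF u y] subspace_add[OF subspace_F0 Rx Ry]
      by (intro R_unique[OF u]) auto
  qed
  then show ?thesis using lin_on_subset F0_antimono[of 0 l] l by blast
qed


section \<open>Limits and derivatives of curves on the scale\<close>

text \<open>Membership is built in because \<open>N l\<close> is informative on \<open>F l\<close>
  only. It is required at \<open>v = u\<close> as well, although the limit ignores that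
  point.\<close>

definition conv :: "nat \<Rightarrow> (real \<Rightarrow> 'b) \<Rightarrow> 'b \<Rightarrow> real \<Rightarrow> bool" where
  "conv l g x u \<longleftrightarrow> x \<in> F l \<and> (\<forall>v\<in>{0..1}. g v \<in> F l) \<and>
    ((\<lambda>v. N l (g v - x)) \<longlongrightarrow> 0) (at u within {0..1})"

text \<open>At \<open>v = u\<close> the quotient is 0, a member of every \<open>F l\<close>, so the
  demand of \<open>conv\<close> at that point is harmless.\<close>

definition deriv :: "nat \<Rightarrow> (real \<Rightarrow> 'b) \<Rightarrow> 'b \<Rightarrow> real \<Rightarrow> bool" where
  "deriv l g D u \<longleftrightarrow> conv l (\<lambda>v. (g v - g u) /\<^sub>R (v - u)) D u"

lemma convD: "conv l g x u \<Longrightarrow> x \<in> F l" "conv l g x u \<Longrightarrow> v \<in> {0..1} \<Longrightarrow> g v \<in> F l"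
  "conv l g x u \<Longrightarrow> ((\<lambda>v. N l (g v - x)) \<longlongrightarrow> 0) (at u within {0..1})"
  by (auto simp: conv_def)

lemma convI:
  assumes "x \<in> F l" "\<And>v. v \<in> {0..1} \<Longrightarrow> g v \<in> F l"
    and le: "\<And>v. v \<in> {0..1} \<Longrightarrow> v \<noteq> u \<Longrightarrow> N l (g v - x) \<le> h v"
    and h: "(h \<longlongrightarrow> 0) (at u within {0..1})"
  shows "conv l g x u"
proof -
  have "((\<lambda>v. N l (g v - x)) \<longlongrightarrow> 0) (at u within {0..1})"
    by (rule tendsto_sandwich[OF _ _ tendsto_const h])
      (use le in \<open>auto simp: eventually_at_filter\<close>)
  then show ?thesis using assms by (simp add: conv_def)
qed

text \<open>Difference quotients are usually rewritten by cancelling \<open>v - u\<close>, which is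
  possible off \<open>u\<close> only; the membership at \<open>u\<close> is the price.\<close>

lemma conv_cong:
  assumes "\<And>v. v \<in> {0..1} \<Longrightarrow> v \<noteq> u \<Longrightarrow> g v = g' v" "g' u \<in> F l"
    and "conv l g x u"
  shows "conv l g' x u"
proof (rule convI[where h="\<lambda>v. N l (g v - x)"])
  show "g' v \<in> F l" if "v \<in> {0..1}" for v
    using assms(1)[OF that] assms(2) convD(2)[OF assms(3) that] by (cases "v = u") auto
qed (use assms in \<open>auto simp: conv_def\<close>)

lemma conv_const: "l \<le> k \<Longrightarrow> x \<in> F l \<Longrightarrow> conv l (\<lambda>_. x) x u"
  by (simp add: conv_def N_0)

lemma conv_add:
  assumes l: "l \<le> k" and g: "conv l g x u" and h: "conv l h y u"
  shows "conv l (\<lambda>v. g v + h v) (x + y) u"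
proof (rule convI)
  fix v :: real assume v: "v \<in> {0..1}"
  have "N l (g v + h v - (x + y)) = N l ((g v - x) + (h v - y))" by (simp add: algebra_simps)
  also have "\<dots> \<le> N l (g v - x) + N l (h v - y)"
    using convD[OF g] convD[OF h] v by (intro N_triangle l subspace_diff[OF subspace_F[OF l]])
  finally show "N l (g v + h v - (x + y)) \<le> N l (g v - x) + N l (h v - y)" .
  show "g v + h v \<in> F l"
    using convD[OF g] convD[OF h] v by (intro subspace_add[OF subspace_F[OF l]])
next
  show "((\<lambda>v. N l (g v - x) + N l (h v - y)) \<longlongrightarrow> 0) (at u within {0..1})"
    using tendsto_add[OF convD(3)[OF g] convD(3)[OF h]] by simp
  show "x + y \<in> F l"
    using convD[OF g] convD[OF h] by (intro subspace_add[OF subspace_F[OF l]])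
qed

lemma conv_scaleR:
  assumes l: "l \<le> k" and g: "conv l g x u"
  shows "conv l (\<lambda>v. c *\<^sub>R g v) (c *\<^sub>R x) u"
proof (rule convI)
  show "N l (c *\<^sub>R g v - c *\<^sub>R x) \<le> \<bar>c\<bar> * N l (g v - x)" for v
    using N_scaleR[OF l, of c "g v - x"] by (simp add: scaleR_diff_right)
  show "((\<lambda>v. \<bar>c\<bar> * N l (g v - x)) \<longlongrightarrow> 0) (at u within {0..1})"
    using tendsto_mult_left[OF convD(3)[OF g], of "\<bar>c\<bar>"] by simp
qed (use convD[OF g] in \<open>auto intro: subspace_scale[OF subspace_F[OF l]]\<close>)

lemma conv_sum:
  assumes l: "l \<le> k" and g: "\<And>s. s \<in> A \<Longrightarrow> conv l (g s) (x s) u"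
  shows "conv l (\<lambda>v. \<Sum>s\<in>A. c s *\<^sub>R g s v) (\<Sum>s\<in>A. c s *\<^sub>R x s) u"
  using g
proof (induction A rule: infinite_finite_induct)
  case (insert s A)
  then show ?case by (simp add: conv_add[OF l] conv_scaleR[OF l])
qed (simp_all add: conv_const[OF l] subspace_0[OF subspace_F[OF l]])

lemma deriv_sum:
  assumes l: "l \<le> k" and g: "\<And>s. s \<in> A \<Longrightarrow> deriv l (g s) (x s) u"
  shows "deriv l (\<lambda>v. \<Sum>s\<in>A. c s *\<^sub>R g s v) (\<Sum>s\<in>A. c s *\<^sub>R x s) u"
  using conv_sum[OF l g[unfolded deriv_def], where c=c]
  by (simp add: deriv_def sum_subtractf[symmetric] scaleR_sum_right scaleR_diff_right mult.commute)

text \<open>The domain \<open>Y\<close> is kept apart from \<open>F i\<close> so that the same rule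
  for composite limits covers \<open>T s\<close>, defined on all of \<open>F (j + s)\<close>, and
  \<open>R\<close>, which is under control on the mean-zero part only.\<close>

definition bounded_family :: "'b set \<Rightarrow> nat \<Rightarrow> nat \<Rightarrow> (real \<Rightarrow> 'b \<Rightarrow> 'b) \<Rightarrow> bool" where
  "bounded_family Y i j A \<longleftrightarrow> subspace Y \<and> Y \<subseteq> F i \<and>
    (\<forall>v\<in>{0..1}. lin_on Y (A v) \<and> A v ` Y \<subseteq> F j) \<and>
    (\<exists>C. \<forall>v\<in>{0..1}. \<forall>y\<in>Y. N j (A v y) \<le> C * N i y)"

lemma bounded_family_T:
  assumes "s + j \<le> k"
  shows "bounded_family (F (j + s)) (j + s) j (T s)"
  using assms subspace_F[of "j + s"] T_bound[OF assms] T_maps[OF assms]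
    lin_on_subset[OF lin_T[of s] F_antimono[of s "j + s"]]
  by (auto simp: bounded_family_def add.commute)

lemma bounded_family_R:
  assumes l: "l \<le> k"
  shows "bounded_family (F0 l) l l R"
proof -
  obtain K where K: "\<And>u x. u \<in> {0..1} \<Longrightarrow> x \<in> F0 l \<Longrightarrow> N l (R u x) \<le> K * N l x"
    using R_bound[OF l] by blast
  have "R v ` F0 l \<subseteq> F l" if "v \<in> {0..1}" for v
    using R_F0[OF l that] F0_subset by blast
  then show ?thesis
    using subspace_F0[OF l] F0_subset[of l] lin_on_R[OF l] K unfolding bounded_family_def by blast
qed

text \<open>Split \<open>A v (g v) - A u x\<close> as
  \<open>A v (g v - x) + (A v x - A u x)\<close>. The uniform bound handles the first term although
  its operator moves; the second involves the fixed vector \<open>x\<close> only.\<close>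

lemma conv_apply:
  assumes j: "j \<le> k" "i \<le> k" and A: "bounded_family Y i j A" and u: "u \<in> {0..1}"
    and g: "conv i g x u" "\<And>v. v \<in> {0..1} \<Longrightarrow> g v \<in> Y" "x \<in> Y"
    and Ax: "conv j (\<lambda>v. A v x) (A u x) u"
  shows "conv j (\<lambda>v. A v (g v)) (A u x) u"
proof -
  obtain C where C: "\<And>v y. v \<in> {0..1} \<Longrightarrow> y \<in> Y \<Longrightarrow> N j (A v y) \<le> C * N i y"
    and Y: "subspace Y" and lin: "\<And>v. v \<in> {0..1} \<Longrightarrow> lin_on Y (A v)"
    and maps: "\<And>v y. v \<in> {0..1} \<Longrightarrow> y \<in> Y \<Longrightarrow> A v y \<in> F j"
    using A unfolding bounded_family_def by blast
  show ?thesis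
  proof (rule convI)
    fix v :: real assume v: "v \<in> {0..1}"
    show "A v (g v) \<in> F j" using maps v g(2) by blast
    have gx: "g v - x \<in> Y" using g v Y by (intro subspace_diff)
    have "A v (g v) - A u x = A v (g v - x) + (A v x - A u x)"
      using lin_onD(3)[OF lin[OF v] Y g(2)[OF v] g(3)] by simp
    also have "N j \<dots> \<le> N j (A v (g v - x)) + N j (A v x - A u x)"
      using maps u v g gx by (intro N_triangle subspace_diff[OF subspace_F] j) auto
    also have "N j (A v (g v - x)) \<le> C * N i (g v - x)" by (rule C[OF v gx])
    finally show "N j (A v (g v) - A u x) \<le> C * N i (g v - x) + N j (A v x - A u x)" by simp
  next
    show "((\<lambda>v. C * N i (g v - x) + N j (A v x - A u x)) \<longlongrightarrow> 0) (at u within {0..1})"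
      using tendsto_add[OF tendsto_mult_left[OF convD(3)[OF g(1)], of C] convD(3)[OF Ax]] by simp
  qed (use maps u g in auto)
qed

text \<open>The difference quotient of \<open>v \<mapsto> A v (g v)\<close> is split as
  \<open>A v ((g v - g u) / (v - u)) + (A v (g u) - A u (g u)) / (v - u)\<close>; only the second summand
  needs the space on which \<open>A\<close> is differentiable.\<close>

lemma deriv_apply:
  assumes j: "j \<le> k" "i \<le> k" and A: "bounded_family Y i j A" and u: "u \<in> {0..1}"
    and g: "deriv i g g' u" "\<And>v. v \<in> {0..1} \<Longrightarrow> g v \<in> Y" "g' \<in> Y"
    and Ag': "conv j (\<lambda>v. A v g') (A u g') u"
    and D: "deriv j (\<lambda>v. A v (g u)) D u"
  shows "deriv j (\<lambda>v. A v (g v)) (D + A u g') u"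
proof -
  have Y: "subspace Y" and lin: "\<And>v. v \<in> {0..1} \<Longrightarrow> lin_on Y (A v)"
    and maps: "\<And>v y. v \<in> {0..1} \<Longrightarrow> y \<in> Y \<Longrightarrow> A v y \<in> F j"
    using A unfolding bounded_family_def by blast+
  let ?q = "\<lambda>v. (g v - g u) /\<^sub>R (v - u)"
  have q: "?q v \<in> Y" if "v \<in> {0..1}" for v
    using that g u Y by (intro subspace_scale subspace_diff) auto
  have "conv j (\<lambda>v. A v (?q v)) (A u g') u"
    by (rule conv_apply[OF j A u g(1)[unfolded deriv_def] q g(3) Ag'])
  from conv_add[OF j(1) D[unfolded deriv_def] this]
  show ?thesis
    unfolding deriv_def
  proof (rule conv_cong[rotated 2])
    show "(A u (g u) - A u (g u)) /\<^sub>R (u - u) \<in> F j"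
      using subspace_0[OF subspace_F[OF j(1)]] by simp
    fix v :: real assume v: "v \<in> {0..1}"
    have "A v (?q v) = (A v (g v) - A v (g u)) /\<^sub>R (v - u)"
      using lin_onD(2)[OF lin[OF v] Y] lin_onD(3)[OF lin[OF v] Y] g(2)[OF v] g(2)[OF u]
        subspace_diff[OF Y] by metis
    then show "(A v (g u) - A u (g u)) /\<^sub>R (v - u) + A v (?q v) = (A v (g v) - A u (g u)) /\<^sub>R (v - u)"
      by (simp add: scaleR_add_right[symmetric])
  qed
qed

lemma conv_T: "s + l \<le> k \<Longrightarrow> u \<in> {0..1} \<Longrightarrow> x \<in> F (l + s) \<Longrightarrow> conv l (\<lambda>v. T s v x) (T s u x) u"
  using T_maps[of s l] T_cont[of s l u x] by (simp add: conv_def)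

lemma deriv_T:
  assumes "Suc s + l \<le> k" "u \<in> {0..1}" "x \<in> F (l + Suc s)"
  shows "deriv l (\<lambda>v. T s v x) (T (Suc s) u x) u"
proof -
  have "T s v x \<in> F l" if "v \<in> {0..1}" for v
    using T_maps[of s "Suc l" v x] assms that F_antimono[of l "Suc l"] by auto
  then show ?thesis
    using T_maps[of "Suc s" l u x] T_deriv[OF assms] assms
    by (auto simp: deriv_def conv_def intro!: subspace_scale subspace_diff subspace_F)
qed

lemma at_unit_interval_neq_bot: "u \<in> {0..1::real} \<Longrightarrow> at u within {0..1} \<noteq> bot"
  by (simp add: trivial_limit_within islimpt_Icc)

text \<open>\<open>mass\<close> is dominated by \<open>N 0\<close>, hence by every
  \<open>N l\<close>, and so passes to limits. Every point of the interval, the endpoints included,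
  is a limit of others, which makes the limit informative.\<close>

lemma mass_conv:
  assumes u: "u \<in> {0..1}" and l: "l \<le> k" and g: "conv l g x u"
    and m: "\<And>v. v \<in> {0..1} \<Longrightarrow> v \<noteq> u \<Longrightarrow> mass (g v) = 0"
  shows "mass x = 0"
proof -
  have "\<forall>\<^sub>F v in at u within {0..1}. \<bar>mass x\<bar> \<le> N l (g v - x)"
    unfolding eventually_at_filter
  proof (intro always_eventually allI impI)
    fix v assume v: "v \<noteq> u" "v \<in> {0..1}"
    have *: "g v - x \<in> F l" using convD[OF g] v by (intro subspace_diff[OF subspace_F[OF l]]) auto
    have "\<bar>mass x\<bar> = \<bar>mass (g v - x)\<bar>" using m v linear_mass by (simp add: linear_diff)
    also have "\<dots> \<le> N 0 (g v - x)" using F_0[OF l *] by (rule mass_bound)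
    also have "\<dots> \<le> N l (g v - x)" using * l by (intro N_mono) auto
    finally show "\<bar>mass x\<bar> \<le> N l (g v - x)" .
  qed
  then have "\<bar>mass x\<bar> \<le> 0"
    by (rule tendsto_lowerbound[OF convD(3)[OF g] _ at_unit_interval_neq_bot[OF u]])
  then show ?thesis by simp
qed

text \<open>For \<open>s = 0\<close> the mass of \<open>T 0 v x\<close> is constant in
  \<open>v\<close>, so difference quotients have mass 0 and so does their limit. For larger orders
  the quotients have mass 0 by induction, used one level higher. This is what makes
  \<open>R u (T (Suc s) u x)\<close> meaningful.\<close>

lemma mass_T: "Suc s + l \<le> k \<Longrightarrow> u \<in> {0..1} \<Longrightarrow> x \<in> F (l + Suc s) \<Longrightarrow> mass (T (Suc s) u x) = 0"
proof (induction s arbitrary: l u)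
  case (0 l u)
  have "x \<in> F 0" using 0 F_0[of "l + Suc 0" x] by auto
  then have "mass ((T 0 v x - T 0 u x) /\<^sub>R (v - u)) = 0" if "v \<in> {0..1}" for v
    using mass_T0 that 0 linear_mass by (simp add: linear_diff linear_scale)
  then show ?case
    using mass_conv[OF 0(2) _ deriv_T[OF 0, unfolded deriv_def]] 0 by auto
next
  case (Suc s l u)
  have "mass (T (Suc s) v x) = 0" if "v \<in> {0..1}" for v
    using Suc.IH[of "Suc l" v] Suc.prems that by simp
  then have "mass ((T (Suc s) v x - T (Suc s) u x) /\<^sub>R (v - u)) = 0" if "v \<in> {0..1}" for v
    using that Suc.prems linear_mass by (simp add: linear_diff linear_scale)
  then show ?case
    using mass_conv[OF Suc.prems(2) _ deriv_T[OF Suc.prems, unfolded deriv_def]] Suc.prems by auto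
qed

lemma T_Suc_F0: "Suc s + l \<le> k \<Longrightarrow> u \<in> {0..1} \<Longrightarrow> x \<in> F (l + Suc s) \<Longrightarrow> T (Suc s) u x \<in> F0 l"
  using mass_T T_maps[of "Suc s" l u x] by (simp add: F0_def)

section \<open>Continuity and differentiability of the resolvent\<close>

text \<open>In the resolvent identity the difference of the \<open>T\<close> acts on the fixed
  vector \<open>z = R u x\<close>, so strong continuity at level \<open>l\<close> suffices and no
  weight is lost.\<close>

lemma conv_R:
  assumes l: "l \<le> k" and u: "u \<in> {0..1}" and x: "x \<in> F0 l"
  shows "conv l (\<lambda>v. R v x) (R u x) u"
proof -
  obtain K where K: "\<And>u x. u \<in> {0..1} \<Longrightarrow> x \<in> F0 l \<Longrightarrow> N l (R u x) \<le> K * N l x"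
    using R_bound[OF l] by blast
  define z where "z = R u x"
  have z: "z \<in> F0 l" using R_F0[OF l u x] by (simp add: z_def)
  have z0: "z \<in> F0 0" and x0: "x \<in> F0 0" using F0_antimono[of 0 l] l z x by auto
  show ?thesis
  proof (rule convI[where h="\<lambda>v. K * N l (T 0 v z - T 0 u z)"])
    fix v :: real assume v: "v \<in> {0..1}"
    show "R v x \<in> F l" using R_F0[OF l v x] F0_subset by blast
    note L = lin_on_subset[OF lin_on_id_minus_T[OF _ v] F0_subset, of 0]
    have "R v (T 0 v z - T 0 u z) = R v x - R u x"
    proof (rule R_unique[OF v])
      have Rx: "R v x \<in> F0 0" using R_F0[OF _ v x0] by simp
      then show "R v x - R u x \<in> F0 0" using z0 by (auto simp: z_def intro: subspace_diff[OF subspace_F0])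
      have e: "R v x - T 0 v (R v x) = z - T 0 u z"
        using R_eq[OF v x0] R_eq[OF u x0] by (simp add: z_def)
      have "R v x - R u x - T 0 v (R v x - R u x) = (R v x - T 0 v (R v x)) - (R u x - T 0 v (R u x))"
        using lin_onD(3)[OF L subspace_F0 Rx z0] by (simp add: z_def)
      also have "\<dots> = T 0 v z - T 0 u z"
        unfolding e z_def[symmetric] by simp
      finally show "R v x - R u x - T 0 v (R v x - R u x) = T 0 v z - T 0 u z" .
    qed
    moreover have "T 0 v z - T 0 u z \<in> F0 l"
      using T_F0[OF l v z] T_F0[OF l u z] by (intro subspace_diff[OF subspace_F0[OF l]])
    ultimately show "N l (R v x - R u x) \<le> K * N l (T 0 v z - T 0 u z)"
      using K[OF v] by metis
  next
    show "R u x \<in> F l" using z F0_subset by (auto simp: z_def)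
    show "((\<lambda>v. K * N l (T 0 v z - T 0 u z)) \<longlongrightarrow> 0) (at u within {0..1})"
      using tendsto_mult_left[OF T_cont[of 0 l u z], of K] z F0_subset u l by auto
  qed
qed

text \<open>A curve \<open>f\<close> is differentiated through the curve \<open>v \<mapsto> f v - T 0 v (f v)\<close>, because
  \<open>f v - f u\<close> is the image under \<open>R v\<close> of the increment of the latter plus \<open>(T 0 v - T 0 u) (f u)\<close>.\<close>

lemma deriv_resolvent:
  assumes l: "Suc l \<le> k" and u: "u \<in> {0..1}"
    and f: "\<And>v. v \<in> {0..1} \<Longrightarrow> f v \<in> F (Suc l)" "\<And>v. v \<in> {0..1} \<Longrightarrow> mass (f v) = mass (f u)"
    and g: "\<And>v. v \<in> {0..1} \<Longrightarrow> f v - T 0 v (f v) = g v"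
    and g': "deriv l g g' u" "g' \<in> F0 l"
  shows "deriv l f (R u (g' + T 1 u (f u))) u"
proof -
  have l': "l \<le> k" using l by simp
  have fl: "f v \<in> F l" if "v \<in> {0..1}" for v
    using f(1)[OF that] F_antimono[of l "Suc l"] l by auto
  have fu: "f u \<in> F 0" using F_0[OF l' fl[OF u]] .
  have T1: "T 1 u (f u) \<in> F0 l" using T_Suc_F0[of 0 l u "f u"] l u f(1)[OF u] by simp
  define q where "q v = (if v = u then 0 else (g v - g u) /\<^sub>R (v - u) + (T 0 v (f u) - T 0 u (f u)) /\<^sub>R (v - u))" for v
  have "conv l (\<lambda>v. (g v - g u) /\<^sub>R (v - u) + (T 0 v (f u) - T 0 u (f u)) /\<^sub>R (v - u)) (g' + T 1 u (f u)) u"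
    using deriv_T[of 0 l u "f u"] g'(1) l u f(1)[OF u]
    by (intro conv_add l') (auto simp: deriv_def)
  then have q: "conv l q (g' + T 1 u (f u)) u"
    by (rule conv_cong[rotated 2]) (use subspace_0[OF subspace_F[OF l']] in \<open>auto simp: q_def\<close>)
  have mg: "mass (g v) = 0" if "v \<in> {0..1}" for v
    using g[OF that, symmetric] mass_T0[OF that F_0[OF l' fl[OF that]]] linear_mass
    by (simp add: linear_diff)
  have qF0: "q v \<in> F0 l" if v: "v \<in> {0..1}" for v
  proof -
    have "mass (q v) = 0"
      using mg[OF v] mg[OF u] mass_T0[OF v fu] mass_T0[OF u fu] linear_mass
      by (simp add: q_def linear_0 linear_add linear_diff linear_scale)
    then show ?thesis using convD(2)[OF q v] by (simp add: F0_def)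
  qed
  have g'T1: "g' + T 1 u (f u) \<in> F0 l"
    using g'(2) T1 by (intro subspace_add[OF subspace_F0[OF l']])
  have "conv l (\<lambda>v. R v (q v)) (R u (g' + T 1 u (f u))) u"
    by (rule conv_apply[OF l' l' bounded_family_R[OF l'] u q qF0 g'T1 conv_R[OF l' u g'T1]])
  then show ?thesis
    unfolding deriv_def
  proof (rule conv_cong[rotated 2])
    show "(f u - f u) /\<^sub>R (u - u) \<in> F l" using subspace_0[OF subspace_F[OF l']] by simp
    fix v :: real assume v: "v \<in> {0..1}" "v \<noteq> u"
    let ?w = "(f v - f u) /\<^sub>R (v - u)"
    note S = subspace_F[of 0, simplified]
    have fv: "f v \<in> F 0" using F_0[OF l' fl[OF v(1)]] .
    have w: "?w \<in> F0 0"
      using subspace_scale[OF S subspace_diff[OF S fv fu]] f(2)[OF v(1)] linear_mass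
      by (simp add: F0_def linear_diff linear_scale)
    show "R v (q v) = ?w"
    proof (rule R_unique[OF v(1) w])
      note L = lin_T[of 0 v, OF _ v(1)]
      have "T 0 v ?w = (T 0 v (f v) - T 0 v (f u)) /\<^sub>R (v - u)"
        using lin_onD(2)[OF L S subspace_diff[OF S fv fu]] lin_onD(3)[OF L S fv fu] fu by simp
      then have "?w - T 0 v ?w = ((f v - T 0 v (f v)) - (f u - T 0 v (f u))) /\<^sub>R (v - u)"
        by (simp add: algebra_simps scaleR_diff_right)
      also have "f v - T 0 v (f v) = g v" by (rule g[OF v(1)])
      also have "f u - T 0 v (f u) = g u - (T 0 v (f u) - T 0 u (f u))"
        using g[OF u] by (simp add: algebra_simps)
      finally show "?w - T 0 v ?w = q v"
        using v(2) by (simp add: q_def algebra_simps scaleR_diff_right scaleR_add_right)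
    qed
  qed
qed

text \<open>Along \<open>v \<mapsto> R v x\<close> the image under I - T_v is constantly
  \<open>x\<close>, so \<open>deriv_resolvent\<close> applies with derivative 0 of the image
  curve.\<close>

lemma deriv_R:
  assumes l: "Suc l \<le> k" and u: "u \<in> {0..1}" and x: "x \<in> F0 (Suc l)"
  shows "deriv l (\<lambda>v. R v x) (R u (T 1 u (R u x))) u"
proof -
  have l': "l \<le> k" using l by simp
  have "deriv l (\<lambda>_. x) 0 u"
    using conv_const[OF l', of 0 u] subspace_0[OF subspace_F[OF l']] by (simp add: deriv_def)
  moreover have "x \<in> F0 0" using x F0_antimono[of 0 "Suc l"] l by auto
  ultimately have "deriv l (\<lambda>v. R v x) (R u (0 + T 1 u (R u x))) u"
    using R_F0[OF l _ x] R_eq u subspace_0[OF subspace_F0[OF l']]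
    by (intro deriv_resolvent[where g="\<lambda>_. x"] l) (auto simp: F0_def)
  then show ?thesis by simp
qed

section \<open>The invariant vector\<close>

definition "invariant u = d + R u (T 0 u d - d)"

lemma d_diff_F0:
  assumes "u \<in> {0..1}"
  shows "T 0 u d - d \<in> F0 k"
  using assms d T_maps[of 0 k u d] mass_T0[of u d] F_0[of k d] linear_mass
    subspace_diff[OF subspace_F[of k]]
  by (simp add: F0_def linear_diff)

lemma invariant:
  assumes u: "u \<in> {0..1}"
  shows "invariant u \<in> F k" "mass (invariant u) = 1" "T 0 u (invariant u) = invariant u"
proof -
  note R = R_F0[OF _ u d_diff_F0[OF u], simplified]
  show I: "invariant u \<in> F k"
    using R d F0_subset[of k] subspace_add[OF subspace_F[of k]] by (auto simp: invariant_def)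
  show "mass (invariant u) = 1"
    using R d linear_mass by (simp add: invariant_def linear_add F0_def)
  have 0: "T 0 u d - d \<in> F0 0" using d_diff_F0[OF u] F0_antimono[of 0 k] by auto
  have "R u (T 0 u d - d) \<in> F 0" "d \<in> F 0"
    using R F0_subset[of k] F_0[of k] d by auto
  then have "T 0 u (invariant u) = T 0 u d + T 0 u (R u (T 0 u d - d))"
    using lin_onD(1)[OF lin_T[of 0 u] subspace_F] u by (simp add: invariant_def)
  also have "\<dots> = invariant u" using R_eq[OF u 0] by (simp add: invariant_def algebra_simps)
  finally show "T 0 u (invariant u) = invariant u" .
qed

lemma T_pow_invariant: "u \<in> {0..1} \<Longrightarrow> (T 0 u ^^ n) (invariant u) = invariant u"
  by (induction n) (simp_all add: invariant)

text \<open>\<open>x - invariant u\<close> is mean-zero, so the powers contract it, while they leave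
  \<open>invariant u\<close> fixed.\<close>

lemma T_pow_tendsto_invariant:
  assumes u: "u \<in> {0..1}" and x: "x \<in> F 0" "mass x = 1"
  shows "(\<lambda>n. N 0 ((T 0 u ^^ n) x - invariant u)) \<longlonglongrightarrow> 0"
proof -
  obtain M \<rho> where M: "0 \<le> M" "0 < \<rho>" "\<rho> < 1"
    "\<And>u x n. u \<in> {0..1} \<Longrightarrow> x \<in> F0 0 \<Longrightarrow> N 0 ((T 0 u ^^ n) x) \<le> M * \<rho> ^ n * N 0 x"
    using geometric[of 0] by blast
  define z where "z = x - invariant u"
  have inv: "invariant u \<in> F 0" using F_0[of k] invariant(1)[OF u] by simp
  then have z: "z \<in> F0 0"
    using x invariant(2)[OF u] linear_mass subspace_diff[OF subspace_F[of 0]]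
    by (simp add: z_def F0_def linear_diff)
  have lim: "(\<lambda>n. M * \<rho> ^ n * N 0 z) \<longlonglongrightarrow> 0"
    using tendsto_mult_left[OF tendsto_mult_right[OF LIMSEQ_realpow_zero[of \<rho>], of "N 0 z"], of M] M
    by (simp add: mult_ac)
  have "(T 0 u ^^ n) z = (T 0 u ^^ n) x - invariant u" for n
    using T_pow_diff[OF u x(1) inv] T_pow_invariant[OF u] by (simp add: z_def)
  then have "N 0 ((T 0 u ^^ n) x - invariant u) \<le> M * \<rho> ^ n * N 0 z" for n
    using M(4)[OF u z, of n] by simp
  then show ?thesis
    by (intro tendsto_sandwich[OF _ _ tendsto_const lim]) auto
qed

section \<open>Higher derivatives of the invariant vector\<close>

text \<open>The formula claimed for the derivatives serves as their definition, with the summation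
  index lowered by one so that the recursive calls visibly decrease. What has to be proved is that
  each function is the derivative of its predecessor.\<close>

fun f_deriv :: "nat \<Rightarrow> real \<Rightarrow> 'b" where
  "f_deriv 0 u = invariant u"
| "f_deriv (Suc l) u = (\<Sum>s\<le>l. real (Suc l choose Suc s) *\<^sub>R R u (T (Suc s) u (f_deriv (l - s) u)))"

declare f_deriv.simps(2) [simp del]

lemma conv_invariant:
  assumes u: "u \<in> {0..1}"
  shows "conv k invariant (invariant u) u"
proof -
  have "conv k (\<lambda>v. T 0 v d + (-1) *\<^sub>R d) (T 0 u d + (-1) *\<^sub>R d) u"
    using conv_T[of 0 k u d] d u by (intro conv_add conv_scaleR conv_const) auto
  then have "conv k (\<lambda>v. T 0 v d - d) (T 0 u d - d) u" by simp
  then have "conv k (\<lambda>v. R v (T 0 v d - d)) (R u (T 0 u d - d)) u"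
    using conv_apply[OF order_refl order_refl bounded_family_R[OF order_refl] u]
      d_diff_F0 conv_R[OF order_refl u] u by blast
  from conv_add[OF order_refl conv_const[OF order_refl d(1)] this]
  show ?thesis by (simp add: invariant_def[abs_def])
qed

text \<open>The terms of Leibniz's formula for the \<open>l\<close>-th derivative of T_v f_v in
  which at least one derivative falls on \<open>T\<close>. Differentiating f = T f predicts that
  this is f^(l) - T f^(l), see \<open>f_deriv_minus_T\<close>.\<close>

definition g_deriv :: "nat \<Rightarrow> real \<Rightarrow> 'b" where
  "g_deriv l u = (\<Sum>s<l. real (l choose Suc s) *\<^sub>R T (Suc s) u (f_deriv (l - Suc s) u))"

text \<open>The levels fit exactly: for \<open>l = Suc n\<close>, \<open>f_deriv (n - s)\<close>
  lives at level \<open>k - (n - s) = k - l + Suc s\<close>, \<open>T (Suc s)\<close> spends the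
  \<open>Suc s\<close> extra weights, and \<open>R\<close> spends none. Membership, mass and
  continuity share one induction because the continuity step relies on all of them at lower
  orders.\<close>

lemma f_deriv_props:
  assumes "l \<le> k"
  shows "(\<forall>u\<in>{0..1}. f_deriv l u \<in> F (k - l) \<and> mass (f_deriv l u) = (if l = 0 then 1 else 0)) \<and>
    (\<forall>u\<in>{0..1}. conv (k - l) (f_deriv l) (f_deriv l u) u)"
  using assms
proof (induction l rule: less_induct)
  case (less l)
  show ?case
  proof (cases l)
    case 0
    then show ?thesis using invariant conv_invariant by simp
  next
    case (Suc n)
    have j: "k - l \<le> k" by simp
    have fs: "f_deriv (n - s) u \<in> F (k - l + Suc s)" "T (Suc s) u (f_deriv (n - s) u) \<in> F0 (k - l)"
      "conv (k - l) (\<lambda>v. R v (T (Suc s) v (f_deriv (n - s) v))) (R u (T (Suc s) u (f_deriv (n - s) u))) u"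
      if s: "s \<le> n" and u: "u \<in> {0..1}" for s u
    proof -
      have eq: "k - (n - s) = k - l + Suc s" and le: "Suc s + (k - l) \<le> k" using s Suc less.prems by auto
      have f: "f_deriv (n - s) v \<in> F (k - l + Suc s)" if "v \<in> {0..1}" for v
        using less.IH[of "n - s"] Suc less.prems that unfolding eq by simp
      then show "f_deriv (n - s) u \<in> F (k - l + Suc s)" using u by blast
      show Tf: "T (Suc s) u (f_deriv (n - s) u) \<in> F0 (k - l)" by (rule T_Suc_F0[OF le u f[OF u]])
      have Tfv: "T (Suc s) v (f_deriv (n - s) v) \<in> F0 (k - l)" if "v \<in> {0..1}" for v
        by (rule T_Suc_F0[OF le that f[OF that]])
      have cf: "conv (k - l + Suc s) (f_deriv (n - s)) (f_deriv (n - s) u) u"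
        using less.IH[of "n - s"] Suc less.prems u unfolding eq by simp
      have "conv (k - l) (\<lambda>v. T (Suc s) v (f_deriv (n - s) v)) (T (Suc s) u (f_deriv (n - s) u)) u"
        by (rule conv_apply[OF j _ bounded_family_T[OF le] u cf f f[OF u] conv_T[OF le u f[OF u]]])
          (use le in simp_all)
      from conv_apply[OF j j bounded_family_R[OF j] u this Tfv Tf conv_R[OF j u Tf]]
      show "conv (k - l) (\<lambda>v. R v (T (Suc s) v (f_deriv (n - s) v))) (R u (T (Suc s) u (f_deriv (n - s) u))) u"
        by simp
    qed
    have "f_deriv l u \<in> F0 (k - l)" if u: "u \<in> {0..1}" for u
      unfolding Suc f_deriv.simps(2)
      using fs(2) u R_F0[OF j u] unfolding Suc
      by (intro subspace_sum subspace_scale subspace_F0) auto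
    moreover have "conv (k - l) (f_deriv l) (f_deriv l u) u" if u: "u \<in> {0..1}" for u
    proof -
      have "f_deriv l = (\<lambda>v. \<Sum>s\<le>n. real (Suc n choose Suc s) *\<^sub>R R v (T (Suc s) v (f_deriv (n - s) v)))"
        by (simp add: Suc fun_eq_iff f_deriv.simps(2))
      moreover have "conv (k - l) \<dots> (\<Sum>s\<le>n. real (Suc n choose Suc s) *\<^sub>R R u (T (Suc s) u (f_deriv (n - s) u))) u"
        using fs(3)[OF _ u] by (intro conv_sum j) auto
      ultimately show ?thesis by (simp add: Suc f_deriv.simps(2))
    qed
    ultimately show ?thesis using Suc by (auto simp: F0_def)
  qed
qed

lemma f_deriv_F: "l \<le> k \<Longrightarrow> u \<in> {0..1} \<Longrightarrow> f_deriv l u \<in> F (k - l)"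
  and mass_f_deriv: "l \<le> k \<Longrightarrow> u \<in> {0..1} \<Longrightarrow> mass (f_deriv l u) = (if l = 0 then 1 else 0)"
  and conv_f_deriv: "l \<le> k \<Longrightarrow> u \<in> {0..1} \<Longrightarrow> conv (k - l) (f_deriv l) (f_deriv l u) u"
  using f_deriv_props by blast+

lemma T_f_deriv_F0:
  assumes "s < l" "l \<le> k" "u \<in> {0..1}"
  shows "T (Suc s) u (f_deriv (l - Suc s) u) \<in> F0 (k - l)"
proof -
  have "k - (l - Suc s) = k - l + Suc s" using assms by simp
  then show ?thesis using assms f_deriv_F[of "l - Suc s" u] by (intro T_Suc_F0) auto
qed

lemma g_deriv_F0: "l \<le> k \<Longrightarrow> u \<in> {0..1} \<Longrightarrow> g_deriv l u \<in> F0 (k - l)"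
  unfolding g_deriv_def using T_f_deriv_F0
  by (intro subspace_sum subspace_scale subspace_F0) auto

lemma f_deriv_Suc_eq:
  assumes "Suc l \<le> k" "u \<in> {0..1}"
  shows "f_deriv (Suc l) u = R u (g_deriv (Suc l) u)"
  using lin_on_sum[OF lin_on_R[of "k - Suc l" u] subspace_F0, of "{..<Suc l}"
      "\<lambda>s. T (Suc s) u (f_deriv (l - s) u)" "\<lambda>s. real (Suc l choose Suc s)"]
    T_f_deriv_F0[of _ "Suc l" u] assms
  by (simp add: f_deriv.simps(2) g_deriv_def lessThan_Suc_atMost del: binomial_Suc_Suc)

lemma f_deriv_minus_T:
  assumes "l \<le> k" "u \<in> {0..1}"
  shows "f_deriv l u - T 0 u (f_deriv l u) = g_deriv l u"
proof (cases l)
  case 0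
  then show ?thesis using invariant(3) assms by (simp add: g_deriv_def)
next
  case (Suc n)
  have "g_deriv l u \<in> F0 0" using g_deriv_F0[OF assms] F0_antimono[of 0 "k - l"] by auto
  then show ?thesis using R_eq assms f_deriv_Suc_eq[of n u] Suc by simp
qed

text \<open>\<open>f_deriv l\<close> is never assumed differentiable: its image under I - T_v is
  \<open>g_deriv l\<close>, made of derivatives of order below \<open>l\<close>, which the induction
  hypothesis covers. \<open>deriv_resolvent\<close> then transfers differentiability to
  \<open>f_deriv l\<close>.\<close>

lemma deriv_f_deriv:
  assumes "Suc l \<le> k" "u \<in> {0..1}"
  shows "deriv (k - Suc l) (f_deriv l) (f_deriv (Suc l) u) u"
  using assms(1)
proof (induction l rule: less_induct)
  case (less l)
  note u = assms(2) and l = less.prems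
  define j where "j = k - Suc l"
  have j: "j \<le> k" "Suc j \<le> k" "k - l = Suc j" using l by (auto simp: j_def)
  \<comment> \<open>The product rule for one summand of \<open>g_deriv l\<close>: the derivative
    falls on the operator or on the curve.\<close>
  define D where "D s = T (Suc (Suc s)) u (f_deriv (l - Suc s) u) + T (Suc s) u (f_deriv (l - s) u)" for s
  have D: "deriv j (\<lambda>v. T (Suc s) v (f_deriv (l - Suc s) v)) (D s) u \<and> D s \<in> F0 j" if s: "s < l" for s
  proof -
    have le: "Suc s + j \<le> k" "Suc (Suc s) + j \<le> k" using s l by (auto simp: j_def)
    have eq: "k - (l - Suc s) = j + Suc (Suc s)" "k - (l - s) = j + Suc s" "Suc (l - Suc s) = l - s"
      using s l by (auto simp: j_def)
    have f2: "f_deriv (l - Suc s) v \<in> F (j + Suc (Suc s))" if "v \<in> {0..1}" for v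
      using f_deriv_F[of "l - Suc s" v] that l eq(1) by simp
    \<comment> \<open>The same curve is used at two levels: its increments are measured at
      \<open>j + Suc s\<close>, whereas differentiating \<open>T (Suc s)\<close> at a fixed vector
      needs \<open>j + Suc (Suc s)\<close>.\<close>
    have f2': "f_deriv (l - Suc s) v \<in> F (j + Suc s)" if "v \<in> {0..1}" for v
      using f2[OF that] F_antimono[of "j + Suc s" "j + Suc (Suc s)"] le by auto
    have f1: "f_deriv (l - s) u \<in> F (j + Suc s)"
      using f_deriv_F[of "l - s" u] u l unfolding eq by simp
    have IH: "deriv (j + Suc s) (f_deriv (l - Suc s)) (f_deriv (l - s) u) u"
      using less.IH[of "l - Suc s"] s l unfolding eq by simp
    have "j + Suc s \<le> k" using le by simp
    from deriv_apply[OF j(1) this bounded_family_T[OF le(1)] u IH f2' f1 conv_T[OF le(1) u f1]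
        deriv_T[OF le(2) u f2[OF u]]]
    have "deriv j (\<lambda>v. T (Suc s) v (f_deriv (l - Suc s) v)) (D s) u" by (simp add: D_def)
    moreover have "D s \<in> F0 j"
      unfolding D_def using T_Suc_F0[OF le(2) u f2[OF u]] T_Suc_F0[OF le(1) u f1]
      by (intro subspace_add[OF subspace_F0[OF j(1)]])
    ultimately show ?thesis ..
  qed
  define g' where "g' = (\<Sum>s<l. real (l choose Suc s) *\<^sub>R D s)"
  have g_eq: "g_deriv l = (\<lambda>v. \<Sum>s<l. real (l choose Suc s) *\<^sub>R T (Suc s) v (f_deriv (l - Suc s) v))"
    by (simp add: fun_eq_iff g_deriv_def)
  have g': "deriv j (g_deriv l) g' u"
    unfolding g'_def g_eq using D by (intro deriv_sum j) auto
  have g'F: "g' \<in> F0 j"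
    unfolding g'_def using D by (intro subspace_sum subspace_scale subspace_F0 j) auto
  have "l \<le> k" using l by simp
  then have "deriv j (f_deriv l) (R u (g' + T 1 u (f_deriv l u))) u"
    using f_deriv_F[of l] j mass_f_deriv[of l] f_deriv_minus_T[of l] u
    by (intro deriv_resolvent[OF j(2) u _ _ _ g' g'F]) auto
  moreover have "g' + T 1 u (f_deriv l u) = g_deriv (Suc l) u"
  proof -
    let ?a = "\<lambda>s. T (Suc s) u (f_deriv (l - s) u)"
    \<comment> \<open>Pascal's rule splits the binomials. The shifted first sum gives
      \<open>T 1 u (f_deriv l u)\<close> and the terms with the derivative on the operator; the
      second, whose last coefficient vanishes, gives those with the derivative on the curve.\<close>
    have "g_deriv (Suc l) u = (\<Sum>s\<le>l. real (l choose s) *\<^sub>R ?a s) + (\<Sum>s\<le>l. real (l choose Suc s) *\<^sub>R ?a s)"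
      by (simp add: g_deriv_def lessThan_Suc_atMost scaleR_add_left sum.distrib)
    also have "(\<Sum>s\<le>l. real (l choose s) *\<^sub>R ?a s) = ?a 0 + (\<Sum>s<l. real (l choose Suc s) *\<^sub>R ?a (Suc s))"
      by (simp add: sum.atMost_shift)
    also have "(\<Sum>s\<le>l. real (l choose Suc s) *\<^sub>R ?a s) = (\<Sum>s<l. real (l choose Suc s) *\<^sub>R ?a s)"
      by (simp add: lessThan_Suc_atMost[symmetric])
    finally show ?thesis
      by (simp add: g'_def D_def scaleR_add_right sum.distrib)
  qed
  ultimately show ?case using f_deriv_Suc_eq[OF l u] by (simp add: j_def)
qed

end

section \<open>Translation to signed measures\<close>

text \<open>The carrier of the metric is \<open>MV W\<close>, so continuity includes that the curve
  stays there; the remainder becomes the kind of limit used in the locale.\<close>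

lemma continuous_map_V_topology:
  assumes W: "weight W"
  shows "continuous_map (top_of_set S) (V_topology W) g \<longleftrightarrow> (\<forall>v\<in>S. g v \<in> MV W) \<and>
    (\<forall>u\<in>S. ((\<lambda>v. wnorm W (g v - g u)) \<longlongrightarrow> 0) (at u within S))"
proof -
  interpret M: Metric_space "MV W" "\<lambda>\<mu> \<nu>. enn2real (V_norm W (\<mu> - \<nu>))"
    using W by (intro Metric_space_MV) (auto simp: weight_def)
  have at: "atin (top_of_set S) u = at u within S" if "u \<in> S" for u
  proof (rule filter_eqI)
    show "eventually Q (atin (top_of_set S) u) = eventually Q (at u within S)" for Q
      unfolding atin_subtopology_within[OF that] eventually_atin_within eventually_at_topological
      by auto
  qed
  have ev: "\<forall>\<^sub>F v in at u within S. g v \<in> MV W" if "\<forall>v\<in>S. g v \<in> MV W" for u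
    using that by (auto simp: eventually_at_filter)
  have "continuous_map (top_of_set S) (V_topology W) g \<Longrightarrow> \<forall>v\<in>S. g v \<in> MV W"
    using continuous_map_image_subset_topspace[of "top_of_set S" M.mtopology g]
    by (auto simp: V_topology_def)
  then show ?thesis
    using ev unfolding continuous_map_atin V_topology_def
    by (auto simp: at M.limitin_metric_dist_null wnorm_def)
qed

text \<open>Passes from increments tending to 0 to points tending to \<open>u\<close>; the
  restriction to \<open>S\<close> takes care of one-sided limits.\<close>

lemma filtermap_shift_at_within:
  fixes u :: real
  shows "filtermap (\<lambda>h. u + h) (at 0 within {h. u + h \<in> S}) = at u within S"
proof (rule filter_eqI)
  fix Q
  have "(\<forall>h. u + h \<in> S \<longrightarrow> h \<noteq> 0 \<and> \<bar>h\<bar> < d \<longrightarrow> Q (u + h)) \<longleftrightarrow>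
      (\<forall>v\<in>S. v \<noteq> u \<and> \<bar>v - u\<bar> < d \<longrightarrow> Q v)" for d
  proof safe
    fix v assume "\<forall>h. u + h \<in> S \<longrightarrow> h \<noteq> 0 \<and> \<bar>h\<bar> < d \<longrightarrow> Q (u + h)" "v \<in> S" "v \<noteq> u" "\<bar>v - u\<bar> < d"
    then show "Q v" by (auto dest!: spec[of _ "v - u"])
  qed auto
  then show "eventually Q (filtermap (\<lambda>h. u + h) (at 0 within {h. u + h \<in> S})) = eventually Q (at u within S)"
    by (simp add: eventually_filtermap eventually_at dist_real_def Ball_def)
qed

text \<open>The membership premises make every norm finite, so nothing is lost between
  \<open>ennreal\<close> and \<open>real\<close>.\<close>

lemma has_V_derivative_iff:
  assumes W: "weight W" and u: "u \<in> {0..1}" and g: "\<And>v. v \<in> {0..1} \<Longrightarrow> g v \<in> MV W" and D: "D \<in> MV W"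
  shows "has_V_derivative W g D u \<longleftrightarrow>
    ((\<lambda>v. wnorm W ((g v - g u) /\<^sub>R (v - u) - D)) \<longlongrightarrow> 0) (at u within {0..1})"
proof -
  let ?F = "\<lambda>v. V_norm W ((g v - g u) /\<^sub>R (v - u) - D)"
  have "has_V_derivative W g D u \<longleftrightarrow> (?F \<longlongrightarrow> 0) (filtermap (\<lambda>h. u + h) (at 0 within {h. u + h \<in> {0..1}}))"
    unfolding has_V_derivative_def by (simp add: filterlim_filtermap)
  also have "\<dots> \<longleftrightarrow> (?F \<longlongrightarrow> ennreal 0) (at u within {0..1})"
    by (simp only: filtermap_shift_at_within ennreal_0)
  also have "\<dots> \<longleftrightarrow> ((\<lambda>v. ennreal (wnorm W ((g v - g u) /\<^sub>R (v - u) - D))) \<longlongrightarrow> ennreal 0) (at u within {0..1})"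
  proof (rule tendsto_cong)
    have "?F v = ennreal (wnorm W ((g v - g u) /\<^sub>R (v - u) - D))" if "v \<in> {0..1}" for v
      using g[OF u] g[OF that] D subspace_MV[OF W]
      by (intro V_norm_eq_wnorm) (auto intro!: subspace_diff subspace_scale)
    then show "\<forall>\<^sub>F v in at u within {0..1}. ?F v = ennreal (wnorm W ((g v - g u) /\<^sub>R (v - u) - D))"
      by (auto simp: eventually_at_filter)
  qed
  also have "\<dots> \<longleftrightarrow> ((\<lambda>v. wnorm W ((g v - g u) /\<^sub>R (v - u) - D)) \<longlongrightarrow> 0) (at u within {0..1})"
    by (rule tendsto_ennreal_iff) auto
  finally show ?thesis .
qed

text \<open>Normalise \<open>x\<close> to norm 1. Keeping the subspace \<open>X\<close> as a
  parameter covers both \<open>op_norm\<close> and \<open>op_norm0\<close>.\<close>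

lemma wnorm_le_of_SUP_le:
  assumes W: "weight W" and W': "weight W'" and X: "subspace X" "X \<subseteq> MV W"
    and S: "\<And>c x. x \<in> X \<Longrightarrow> S (c *\<^sub>R x) = c *\<^sub>R S x"
    and C: "(SUP \<mu>\<in>{\<mu> \<in> X. V_norm W \<mu> \<le> 1}. V_norm W' (S \<mu>)) \<le> ennreal C" "0 \<le> C"
    and x: "x \<in> X"
  shows "wnorm W' (S x) \<le> C * wnorm W x"
proof (cases "x = 0")
  case True
  have "S x = 0" using S[OF x, of 0] True by simp
  then show ?thesis
    using C(2) wnorm_scaleR[OF W', of 0 0] by simp
next
  case False
  define n where "n = wnorm W x"
  have n: "n > 0" using wnorm_eq_0[OF W, of x] X x False unfolding n_def
    by (metis less_eq_real_def subsetD wnorm_nonneg)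
  have "V_norm W (x /\<^sub>R n) = ennreal (1 / n) * ennreal n"
    using n X x by (simp add: V_norm_scaleR[OF W] V_norm_eq_wnorm n_def subset_iff inverse_eq_divide)
  also have "\<dots> = 1" using n by (simp add: ennreal_mult[symmetric])
  finally have "V_norm W (x /\<^sub>R n) \<le> 1" by simp
  then have "V_norm W' (S (x /\<^sub>R n)) \<le> ennreal C"
    using X x subspace_scale[OF X(1) x] by (intro order_trans[OF SUP_upper C(1)]) auto
  then have "wnorm W' (S (x /\<^sub>R n)) \<le> C"
    unfolding wnorm_def by (intro enn2real_leI C)
  then show ?thesis
    using n by (simp add: S[OF x] wnorm_scaleR[OF W'] field_simps n_def[symmetric])
qed

text \<open>Membership of \<open>S x\<close> has to be supplied: \<open>wnorm\<close> reads an
  infinite norm as 0, so a bound for it alone does not bound \<open>V_norm\<close>.\<close>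

lemma SUP_V_norm_le:
  assumes "X \<subseteq> MV W" "\<And>x. x \<in> X \<Longrightarrow> S x \<in> MV W'"
    and "\<And>x. x \<in> X \<Longrightarrow> wnorm W' (S x) \<le> C * wnorm W x" "0 \<le> C"
  shows "(SUP \<mu>\<in>{\<mu> \<in> X. V_norm W \<mu> \<le> 1}. V_norm W' (S \<mu>)) \<le> ennreal C"
proof (rule SUP_least, clarsimp)
  fix x assume x: "x \<in> X" "V_norm W x \<le> 1"
  have "wnorm W x \<le> 1" using x(2) unfolding wnorm_def by (intro enn2real_leI) auto
  then have "wnorm W' (S x) \<le> C" using assms(3)[OF x(1)] assms(4) mult_left_mono[of "wnorm W x" 1 C] by linarith
  then show "V_norm W' (S x) \<le> ennreal C"
    using assms(2)[OF x(1)] by (simp add: V_norm_eq_wnorm ennreal_leI)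
qed

lemma continuous_map_V_topology_Lipschitz:
  assumes W: "weight W" and X: "X \<subseteq> MV W" and S: "\<And>x. x \<in> X \<Longrightarrow> S x \<in> X"
    and L: "\<And>x y. x \<in> X \<Longrightarrow> y \<in> X \<Longrightarrow> wnorm W (S x - S y) \<le> C * wnorm W (x - y)"
  shows "continuous_map (subtopology (V_topology W) X) (subtopology (V_topology W) X) S"
proof -
  interpret M: Metric_space "MV W" "\<lambda>\<mu> \<nu>. enn2real (V_norm W (\<mu> - \<nu>))"
    using W by (intro Metric_space_MV) (auto simp: weight_def)
  have "continuous_map (subtopology M.mtopology X) M.mtopology S"
    unfolding M.continuous_map_to_metric
  proof (intro ballI allI impI)
    fix x and e :: real assume x: "x \<in> topspace (subtopology M.mtopology X)" and e: "0 < e"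
    \<comment> \<open>\<open>C\<close> may be zero or negative; \<open>\<bar>C\<bar> + 1\<close> is
      a positive Lipschitz constant in any case.\<close>
    define r where "r = e / (\<bar>C\<bar> + 1)"
    have r: "0 < r" using e by (simp add: r_def)
    show "\<exists>U. openin (subtopology M.mtopology X) U \<and> x \<in> U \<and> (\<forall>y\<in>U. S y \<in> M.mball (S x) e)"
    proof (intro exI conjI ballI)
      show "openin (subtopology M.mtopology X) (M.mball x r \<inter> X)"
        by (auto simp: openin_subtopology)
      show "x \<in> M.mball x r \<inter> X" using x r by (metis IntI IntD1 IntD2 M.centre_in_mball_iff M.topspace_mtopology topspace_subtopology)
      fix y assume y: "y \<in> M.mball x r \<inter> X"
      have d: "wnorm W (x - y) < r" using y by (simp add: M.in_mball wnorm_def)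
      have "wnorm W (S x - S y) \<le> C * wnorm W (x - y)" using x y by (intro L) auto
      also have "\<dots> \<le> (\<bar>C\<bar> + 1) * wnorm W (x - y)" by (intro mult_right_mono) auto
      also have "\<dots> < (\<bar>C\<bar> + 1) * r" using d by (intro mult_strict_left_mono) auto
      also have "\<dots> = e" by (simp add: r_def)
      finally show "S y \<in> M.mball (S x) e"
        using x y S X by (auto simp: M.in_mball wnorm_def)
    qed
  qed
  then show ?thesis
    using S by (auto simp: continuous_map_in_subtopology V_topology_def)
qed

section \<open>Iterates of a kernel and uniqueness of the invariant probability\<close>

lemma kernel_op_pow_scaleR:
  assumes P: "P \<in> borel \<rightarrow>\<^sub>M prob_algebra borel"
  shows "(kernel_op P ^^ n) (c *\<^sub>R \<mu>) = c *\<^sub>R (kernel_op P ^^ n) \<mu>"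
  by (induction n) (simp_all add: kernel_op_scaleR[OF P])

text \<open>By duality this is the value at \<open>x\<close> of a function with values between 0 and
  1.\<close>

lemma smeasure_kernel_op_pow_dirac_nonneg:
  assumes P: "P \<in> borel \<rightarrow>\<^sub>M prob_algebra borel" and A: "A \<in> sets borel"
  shows "0 \<le> smeasure ((kernel_op P ^^ n) (dirac x)) A"
  using kernel_op_power_dual[OF P A, of n] by (metis sintegral_dirac)

text \<open>The functions \<open>g n\<close>, that is x \<mapsto> P^n (x, A), tend to
  \<open>c\<close> pointwise by evaluation at Dirac measures, yet all have the same integral against
  the invariant \<open>\<nu>\<close>. The Jordan parts are finite, so the constant 1
  dominates.\<close>

lemma smeasure_invariant_eq_limit:
  assumes P: "P \<in> borel \<rightarrow>\<^sub>M prob_algebra borel" and A: "A \<in> sets borel"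
    and \<nu>: "smeasure \<nu> UNIV = 1" "kernel_op P \<nu> = \<nu>"
    and lim: "\<And>x. (\<lambda>n. smeasure ((kernel_op P ^^ n) (dirac x)) A) \<longlonglongrightarrow> c"
  shows "smeasure \<nu> A = c"
proof -
  obtain g where g: "\<And>n. g n \<in> borel_measurable borel" "\<And>n x. 0 \<le> g n x" "\<And>n x. g n x \<le> 1"
    "\<And>n \<mu>. smeasure ((kernel_op P ^^ n) \<mu>) A = sintegral \<mu> (g n)"
    using kernel_op_power_dual[OF P A] by metis
  have g_lim: "(\<lambda>n. g n x) \<longlonglongrightarrow> c" for x
    using lim[of x] sintegral_dirac[OF g(1-3)] by (simp add: g(4))
  have int: "(\<lambda>n. \<integral>x. g n x \<partial>M) \<longlonglongrightarrow> (\<integral>x. c \<partial>M)"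
    if M: "finite_measure M" "sets M = sets borel" for M
  proof (rule integral_dominated_convergence[where w="\<lambda>_. 1"])
    show "g n \<in> borel_measurable M" for n
      using g(1) M(2) by (simp cong: measurable_cong_sets)
    show "integrable M (\<lambda>x. 1 :: real)"
      using M(1) by (rule finite_measure.integrable_const)
  qed (use g_lim g(2,3) in auto)
  have "(\<lambda>n. sintegral \<nu> (g n)) \<longlonglongrightarrow> (\<integral>x. c \<partial>pos_part \<nu>) - (\<integral>x. c \<partial>neg_part \<nu>)"
    unfolding sintegral_def
    by (intro tendsto_diff int finite_measure_pos_part finite_measure_neg_part) auto
  also have "(\<integral>x. c \<partial>pos_part \<nu>) - (\<integral>x. c \<partial>neg_part \<nu>) = c"
    using Jordan_decomposition[of UNIV \<nu>] \<nu>(1) by (simp add: left_diff_distrib[symmetric])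
  finally have "(\<lambda>n. sintegral \<nu> (g n)) \<longlonglongrightarrow> c" .
  moreover have "(kernel_op P ^^ n) \<nu> = \<nu>" for n
    by (induction n) (simp_all add: \<nu>)
  then have "sintegral \<nu> (g n) = smeasure \<nu> A" for n
    using g(4)[of n \<nu>] by simp
  ultimately show ?thesis by (simp add: LIMSEQ_const_iff)
qed

section \<open>From the abstract scale back to Markov kernels\<close>

theorem theorem1:
  fixes P :: "real \<Rightarrow> 'a::topological_space \<Rightarrow> 'a measure"
    and V :: "nat \<Rightarrow> 'a \<Rightarrow> real"
    and k :: nat
    and T :: "nat \<Rightarrow> real \<Rightarrow> 'a signed_measure \<Rightarrow> 'a signed_measure"
    and R :: "real \<Rightarrow> 'a signed_measure \<Rightarrow> 'a signed_measure"
  assumes kernel: "\<And>u. u \<in> {0..1} \<Longrightarrow> P u \<in> borel \<rightarrow>\<^sub>M prob_algebra borel"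
    and k: "k \<ge> 1"
    and V_meas: "\<And>l. l \<le> k \<Longrightarrow> V l \<in> borel_measurable borel"
    and V_ge_1: "\<And>l x. l \<le> k \<Longrightarrow> 1 \<le> V l x"
    and V_mono: "\<And>l x. l < k \<Longrightarrow> V l x \<le> V (Suc l) x"
    and T_0: "\<And>u. u \<in> {0..1} \<Longrightarrow> T 0 u = kernel_op (P u)"
    and R: "\<And>u. u \<in> {0..1} \<Longrightarrow> R u = inv_id_minus (MV0 (V 0)) (T 0 u)"
    and A1_maps: "\<And>l u. l \<le> k \<Longrightarrow> u \<in> {0..1} \<Longrightarrow> T 0 u ` MV (V l) \<subseteq> MV (V l)"
    and A1_contraction: "\<And>l. l \<le> k \<Longrightarrow> \<exists>m::nat. \<exists>\<kappa>::real. m \<ge> 1 \<and> 0 < \<kappa> \<and> \<kappa> < 1 \<and>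
          (SUP u\<in>{0..1}. op_norm0 (V l) (V l) (T 0 u ^^ m)) \<le> ennreal \<kappa>"
    and A1_bounded: "\<And>l. l \<le> k \<Longrightarrow> (SUP u\<in>{0..1}. op_norm (V l) (V l) (T 0 u)) < \<infinity>"
    and A1_continuous: "\<And>l \<mu>. l \<le> k \<Longrightarrow> \<mu> \<in> MV (V l) \<Longrightarrow>
          continuous_map (top_of_set {0..1}) (V_topology (V l)) (\<lambda>u. T 0 u \<mu>)"
    and A2_linear: "\<And>l u. 1 \<le> l \<Longrightarrow> l \<le> k \<Longrightarrow> u \<in> {0..1} \<Longrightarrow> lin_on (MV (V l)) (T l u)"
    and A2_operator_continuous: "\<And>l u. 1 \<le> l \<Longrightarrow> l \<le> k \<Longrightarrow> u \<in> {0..1} \<Longrightarrow>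
          continuous_map (V_topology (V l)) (V_topology (V 0)) (T l u)"
    and A2_maps: "\<And>l s u. 1 \<le> l \<Longrightarrow> s + l \<le> k \<Longrightarrow> u \<in> {0..1} \<Longrightarrow>
          T l u ` MV (V (s + l)) \<subseteq> MV (V s)"
    and A2_bounded: "\<And>l s. 1 \<le> l \<Longrightarrow> s + l \<le> k \<Longrightarrow>
          (SUP u\<in>{0..1}. op_norm (V (s + l)) (V s) (T l u)) < \<infinity>"
    and A2_derivative: "\<And>l s \<mu> u. 1 \<le> l \<Longrightarrow> s + l \<le> k \<Longrightarrow> \<mu> \<in> MV (V (s + l)) \<Longrightarrow> u \<in> {0..1} \<Longrightarrow>
          has_V_derivative (V s) (\<lambda>v. T (l - 1) v \<mu>) (T l u \<mu>) u"
    and A2_continuous: "\<And>l s \<mu>. 1 \<le> l \<Longrightarrow> s + l \<le> k \<Longrightarrow> \<mu> \<in> MV (V (s + l)) \<Longrightarrow>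
          continuous_map (top_of_set {0..1}) (V_topology (V s)) (\<lambda>u. T l u \<mu>)"
  shows
    "(\<forall>u\<in>{0..1}. \<forall>l\<le>k.
        lin_on (MV0 (V l)) (\<lambda>\<mu>. \<mu> - T 0 u \<mu>) \<and>
        homeomorphic_maps (subtopology (V_topology (V l)) (MV0 (V l)))
          (subtopology (V_topology (V l)) (MV0 (V l))) (\<lambda>\<mu>. \<mu> - T 0 u \<mu>) (R u) \<and>
        (\<lambda>n. op_norm0 (V l) (V l) (\<lambda>\<mu>. R u \<mu> - (\<Sum>i<n. (T 0 u ^^ i) \<mu>))) \<longlonglongrightarrow> 0)
     \<and> (MAX l\<in>{0..k}. SUP u\<in>{0..1}. op_norm0 (V l) (V l) (R u)) < \<infinity>
     \<and> (\<forall>l\<le>k. \<forall>\<mu>\<in>MV0 (V l). continuous_map (top_of_set {0..1}) (V_topology (V l)) (\<lambda>u. R u \<mu>))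
     \<and> (\<forall>u\<in>{0..1}. \<forall>l\<le>k - 1. \<forall>\<mu>\<in>MV0 (V (l + 1)).
          T 1 u (R u \<mu>) \<in> MV0 (V l) \<and>
          has_V_derivative (V l) (\<lambda>v. R v \<mu>) (R u (T 1 u (R u \<mu>))) u)
     \<and> (\<forall>u\<in>{0..1}. (\<exists>!\<mu>. prob_smeasure \<mu> \<and> T 0 u \<mu> = \<mu>) \<and> invariant_prob (T 0 u) \<in> MV (V k))
     \<and> (\<exists>f :: nat \<Rightarrow> real \<Rightarrow> 'a signed_measure.
       (\<forall>u\<in>{0..1}. f 0 u = invariant_prob (T 0 u)) \<and>
       continuous_map (top_of_set {0..1}) (V_topology (V k)) (f 0) \<and>
       (\<forall>l\<in>{1..k}.
          (\<forall>u\<in>{0..1}. f l u \<in> MV0 (V (k - l))) \<and>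
          continuous_map (top_of_set {0..1}) (V_topology (V (k - l))) (f l) \<and>
          (\<forall>u\<in>{0..1}.
             has_V_derivative (V (k - l)) (f (l - 1)) (f l u) u \<and>
             (\<forall>s\<in>{1..l}. T s u (f (l - s) u) \<in> MV0 (V (k - l))) \<and>
             f l u = (\<Sum>s=1..l. real (l choose s) *\<^sub>R R u (T s u (f (l - s) u))))))"
proof -
  note [simp del] = atLeastAtMost_iff
  have W: "weight (V l)" if "l \<le> k" for l
    using V_meas[OF that] V_ge_1[OF that] by (simp add: weight_def)
  have V_le: "V i x \<le> V j x" if "i \<le> j" "j \<le> k" for i j x
    using that by (induction rule: dec_induct) (auto intro: order_trans[OF _ V_mono])
  have MV_le: "V_norm (V i) \<mu> \<le> V_norm (V j) \<mu>" if "i \<le> j" "j \<le> k" for i j \<mu>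
    using V_le[OF that] by (rule V_norm_mono)
  have MV_anti: "MV (V j) \<subseteq> MV (V i)" if "i \<le> j" "j \<le> k" for i j
    using MV_le[OF that] by (auto simp: MV_def intro: le_less_trans)
  have sub: "subspace (MV (V l))" if "l \<le> k" for l
    using subspace_MV[OF W[OF that]] .
  have sub0: "subspace (MV0 (V l))" if "l \<le> k" for l
    using sub[OF that] by (auto simp: MV0_def subspace_def)
  have maps: "T s u \<mu> \<in> MV (V l)" if "s + l \<le> k" "u \<in> {0..1}" "\<mu> \<in> MV (V (l + s))" for s l u \<mu>
  proof (cases s)
    case 0
    then show ?thesis using A1_maps[of l u] that by auto
  next
    case (Suc n)
    then show ?thesis using A2_maps[of s l u] that by (auto simp: add.commute)
  qed
  have lin: "lin_on (MV (V s)) (T s u)" if "s \<le> k" "u \<in> {0..1}" for s u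
    using A2_linear[of s u] that
    by (cases s) (auto simp: lin_on_def T_0 kernel_op_add kernel_op_scaleR kernel)
  have cont: "continuous_map (top_of_set {0..1}) (V_topology (V l)) (\<lambda>u. T s u \<mu>)"
    if "s + l \<le> k" "\<mu> \<in> MV (V (l + s))" for s l \<mu>
    using A1_continuous[of l \<mu>] A2_continuous[of s l \<mu>] that by (cases s) (auto simp: add.commute)
  have SUP_real: "\<exists>C\<ge>0. \<forall>u\<in>{0..1}. f u \<le> ennreal C" if "(SUP u\<in>{0..1}. f u) < \<infinity>"
    for f :: "real \<Rightarrow> ennreal"
  proof (intro exI conjI ballI)
    fix u :: real assume "u \<in> {0..1}"
    then have "f u \<le> (SUP u\<in>{0..1}. f u)" by (rule SUP_upper)
    then show "f u \<le> ennreal (enn2real (SUP u\<in>{0..1}. f u))" using that by simp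
  qed simp
  have bound: "\<exists>C. \<forall>u\<in>{0..1}. \<forall>\<mu>\<in>MV (V (l + s)). wnorm (V l) (T s u \<mu>) \<le> C * wnorm (V (l + s)) \<mu>"
    if sl: "s + l \<le> k" for s l
  proof -
    have "(SUP u\<in>{0..1}. op_norm (V (l + s)) (V l) (T s u)) < \<infinity>"
      using A1_bounded[of l] A2_bounded[of s l] sl by (cases s) (auto simp: add.commute)
    then obtain C where C: "0 \<le> C" "\<forall>u\<in>{0..1}. op_norm (V (l + s)) (V l) (T s u) \<le> ennreal C"
      using SUP_real by blast
    have "wnorm (V l) (T s u \<mu>) \<le> C * wnorm (V (l + s)) \<mu>" if "u \<in> {0..1}" "\<mu> \<in> MV (V (l + s))" for u \<mu>
    proof (rule wnorm_le_of_SUP_le[OF W W sub order_refl _ _ C(1) that(2)])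
      show "(SUP \<mu>\<in>{\<mu> \<in> MV (V (l + s)). V_norm (V (l + s)) \<mu> \<le> 1}. V_norm (V l) (T s u \<mu>)) \<le> ennreal C"
        using C(2) that(1) unfolding op_norm_def by blast
      show "T s u (c *\<^sub>R x) = c *\<^sub>R T s u x" if "x \<in> MV (V (l + s))" for c x
        using lin[of s u] \<open>u \<in> {0..1}\<close> MV_anti[of s "l + s"] that sl by (auto simp: lin_on_def)
    qed (use sl in auto)
    then show ?thesis by blast
  qed

  \<comment> \<open>Any point can carry the Dirac measure, since all Dirac measures lie in
    \<open>MV (V k)\<close>; \<open>undefined\<close> is an arbitrary choice.\<close>
  interpret g: graded_family "\<lambda>l. MV (V l)" "\<lambda>l. wnorm (V l)" k "\<lambda>\<mu>. smeasure \<mu> UNIV" T "dirac undefined"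
  proof (rule graded_family.intro)
    fix i j l s :: nat and x y :: "'a signed_measure" and c u :: real
    show "l \<le> k \<Longrightarrow> subspace (MV (V l))" by (rule sub)
    show "i \<le> j \<Longrightarrow> j \<le> k \<Longrightarrow> MV (V j) \<subseteq> MV (V i)" by (rule MV_anti)
    show "wnorm (V i) x \<le> wnorm (V j) x" if "i \<le> j" "j \<le> k" "x \<in> MV (V j)"
      using MV_le[OF that(1,2), of x] that(3) unfolding wnorm_def by (intro enn2real_mono) (auto simp: MV_def)
    show "0 \<le> wnorm (V l) x" by simp
    show "l \<le> k \<Longrightarrow> wnorm (V l) (c *\<^sub>R x) = \<bar>c\<bar> * wnorm (V l) x" by (rule wnorm_scaleR[OF W])
    show "l \<le> k \<Longrightarrow> x \<in> MV (V l) \<Longrightarrow> y \<in> MV (V l) \<Longrightarrow> wnorm (V l) (x + y) \<le> wnorm (V l) x + wnorm (V l) y"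
      by (rule wnorm_triangle[OF W])
    show "l \<le> k \<Longrightarrow> x \<in> MV (V l) \<Longrightarrow> wnorm (V l) x = 0 \<Longrightarrow> x = 0" by (rule wnorm_eq_0[OF W])
    show "linear (\<lambda>\<mu>. smeasure \<mu> UNIV)" by (intro linearI) auto
    show "x \<in> MV (V 0) \<Longrightarrow> \<bar>smeasure x UNIV\<bar> \<le> wnorm (V 0) x"
      by (rule abs_smeasure_le_wnorm[OF W]) auto
    show "s \<le> k \<Longrightarrow> u \<in> {0..1} \<Longrightarrow> lin_on (MV (V s)) (T s u)" by (rule lin)
    show "s + l \<le> k \<Longrightarrow> u \<in> {0..1} \<Longrightarrow> x \<in> MV (V (l + s)) \<Longrightarrow> T s u x \<in> MV (V l)" by (rule maps)
    show "s + l \<le> k \<Longrightarrow>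
      \<exists>C. \<forall>u\<in>{0..1}. \<forall>x\<in>MV (V (l + s)). wnorm (V l) (T s u x) \<le> C * wnorm (V (l + s)) x" by (rule bound)
    show "((\<lambda>v. wnorm (V l) (T s v x - T s u x)) \<longlongrightarrow> 0) (at u within {0..1})"
      if "s + l \<le> k" "u \<in> {0..1}" "x \<in> MV (V (l + s))"
      using cont[OF that(1,3)] W[of l] that by (auto simp: continuous_map_V_topology)
    show "((\<lambda>v. wnorm (V l) ((T s v x - T s u x) /\<^sub>R (v - u) - T (Suc s) u x)) \<longlongrightarrow> 0) (at u within {0..1})"
      if *: "Suc s + l \<le> k" "u \<in> {0..1}" "x \<in> MV (V (l + Suc s))"
    proof -
      have "T s v x \<in> MV (V l)" if "v \<in> {0..1}" for v
        using maps[of s "Suc l" v x] * that MV_anti[of l "Suc l"] by auto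
      then show ?thesis
        using A2_derivative[of "Suc s" l x u] has_V_derivative_iff[OF W *(2), of l "\<lambda>v. T s v x" "T (Suc s) u x"]
          maps[OF *] * by auto
    qed
    show "u \<in> {0..1} \<Longrightarrow> smeasure (T 0 u x) UNIV = smeasure x UNIV"
      by (simp add: T_0 smeasure_kernel_op_UNIV kernel)
    show "\<exists>m \<kappa>. m \<ge> 1 \<and> 0 < \<kappa> \<and> \<kappa> < 1 \<and> (\<forall>u\<in>{0..1}. \<forall>x\<in>MV (V l). smeasure x UNIV = 0 \<longrightarrow>
        wnorm (V l) ((T 0 u ^^ m) x) \<le> \<kappa> * wnorm (V l) x)" if l: "l \<le> k"
    proof -
      obtain m :: nat and \<kappa> :: real where m: "m \<ge> 1" "0 < \<kappa>" "\<kappa> < 1"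
        "(SUP u\<in>{0..1}. op_norm0 (V l) (V l) (T 0 u ^^ m)) \<le> ennreal \<kappa>"
        using A1_contraction[OF l] by blast
      have "wnorm (V l) ((T 0 u ^^ m) x) \<le> \<kappa> * wnorm (V l) x"
        if u: "u \<in> {0..1}" and x: "x \<in> MV0 (V l)" for u x
      proof (rule wnorm_le_of_SUP_le[OF W[OF l] W[OF l] sub0[OF l] _ _ _ _ x])
        show "(T 0 u ^^ m) (c *\<^sub>R x) = c *\<^sub>R (T 0 u ^^ m) x" for c x
          by (simp add: T_0[OF u] kernel_op_pow_scaleR[OF kernel[OF u]])
        show "(SUP \<mu>\<in>{\<mu> \<in> MV0 (V l). V_norm (V l) \<mu> \<le> 1}. V_norm (V l) ((T 0 u ^^ m) \<mu>)) \<le> ennreal \<kappa>"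
          using order_trans[OF SUP_upper[OF u] m(4)] by (simp add: op_norm0_def)
      qed (use m in \<open>auto simp: MV0_def\<close>)
      then show ?thesis using m by (intro exI[of _ m] exI[of _ \<kappa>]) (auto simp: MV0_def)
    qed
    show "dirac undefined \<in> MV (V k)" by (rule dirac_in_MV[OF W]) simp
    show "smeasure (dirac undefined :: 'a signed_measure) UNIV = 1"
      by (simp add: smeasure_dirac measure_return)
    fix X :: "nat \<Rightarrow> 'a signed_measure"
    show "l \<le> k \<Longrightarrow> (\<And>i. X i \<in> MV (V l)) \<Longrightarrow> summable (\<lambda>i. wnorm (V l) (X i)) \<Longrightarrow>
      \<exists>s\<in>MV (V l). \<forall>n. wnorm (V l) (s - (\<Sum>i<n. X i)) \<le> (\<Sum>i. wnorm (V l) (X (i + n)))"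
      by (rule MV_complete[OF W])
  qed

  have F0: "g.F0 l = MV0 (V l)" for l by (simp add: g.F0_def MV0_def)
  have R_eq: "R u = g.R u" if "u \<in> {0..1}" for u
    using R[OF that] by (simp add: g.R_def F0)
  have contI: "continuous_map (top_of_set {0..1}) (V_topology (V l)) h"
    if "l \<le> k" "\<And>u. u \<in> {0..1} \<Longrightarrow> g.conv l h (h u) u" for l h
    using that by (auto simp: continuous_map_V_topology[OF W] g.conv_def)
  have derivI: "has_V_derivative (V l) h D u"
    if "l \<le> k" "u \<in> {0..1}" "\<And>v. v \<in> {0..1} \<Longrightarrow> h v \<in> MV (V l)" "g.deriv l h D u" for l h D u
    using that by (auto simp: has_V_derivative_iff[OF W] g.deriv_def g.conv_def)
  have MV0_MV: "MV0 (V l) \<subseteq> MV (V l)" for l by (auto simp: MV0_def)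

  have iso: "lin_on (MV0 (V l)) (\<lambda>\<mu>. \<mu> - T 0 u \<mu>) \<and>
        homeomorphic_maps (subtopology (V_topology (V l)) (MV0 (V l)))
          (subtopology (V_topology (V l)) (MV0 (V l))) (\<lambda>\<mu>. \<mu> - T 0 u \<mu>) (R u) \<and>
        (\<lambda>n. op_norm0 (V l) (V l) (\<lambda>\<mu>. R u \<mu> - (\<Sum>i<n. (T 0 u ^^ i) \<mu>))) \<longlonglongrightarrow> 0"
    if u: "u \<in> {0..1}" and l: "l \<le> k" for u l
  proof (intro conjI)
    let ?X = "MV0 (V l)"
    show linI: "lin_on ?X (\<lambda>\<mu>. \<mu> - T 0 u \<mu>)"
      by (rule lin_on_subset[OF g.lin_on_id_minus_T[OF l u] MV0_MV])
    have X0: "?X \<subseteq> MV0 (V 0)" using g.F0_antimono[of 0 l] l by (simp add: F0)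
    have topX: "topspace (subtopology (V_topology (V l)) ?X) = ?X"
    proof -
      interpret M: Metric_space "MV (V l)" "\<lambda>\<mu> \<nu>. enn2real (V_norm (V l) (\<mu> - \<nu>))"
        using W[OF l] by (intro Metric_space_MV) (auto simp: weight_def)
      show ?thesis using MV0_MV by (auto simp: V_topology_def)
    qed
    have TX: "T 0 u x \<in> ?X" if "x \<in> ?X" for x using g.T_F0[OF l u, of x] that by (simp add: F0)
    have ITX: "x - T 0 u x \<in> ?X" if "x \<in> ?X" for x
      using that TX by (intro subspace_diff[OF sub0[OF l]])
    have RX: "R u x \<in> ?X" if "x \<in> ?X" for x
      using g.R_F0[OF l u, of x] that by (simp add: F0 R_eq[OF u])
    obtain C where C: "\<forall>u\<in>{0..1}. \<forall>x\<in>MV (V l). wnorm (V l) (T 0 u x) \<le> C * wnorm (V l) x"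
      using g.T_bound[of 0 l] l by auto
    obtain K where K: "0 \<le> K" "\<forall>u\<in>{0..1}. \<forall>x\<in>g.F0 l. wnorm (V l) (g.R u x) \<le> K * wnorm (V l) x"
      using g.R_bound[OF l] by blast
    have "continuous_map (subtopology (V_topology (V l)) ?X) (subtopology (V_topology (V l)) ?X) (\<lambda>\<mu>. \<mu> - T 0 u \<mu>)"
    proof (rule continuous_map_V_topology_Lipschitz[OF W[OF l] MV0_MV ITX])
      fix x y assume xy: "x \<in> ?X" "y \<in> ?X"
      have d: "x - y \<in> ?X" using xy by (intro subspace_diff[OF sub0[OF l]])
      have "wnorm (V l) (x - T 0 u x - (y - T 0 u y)) = wnorm (V l) (x - y - T 0 u (x - y))"
        by (simp only: lin_onD(3)[OF linI sub0[OF l] xy])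
      also have "\<dots> \<le> wnorm (V l) (x - y) + wnorm (V l) (T 0 u (x - y))"
        using d TX MV0_MV by (intro g.N_triangle_diff l) auto
      also have "\<dots> \<le> wnorm (V l) (x - y) + C * wnorm (V l) (x - y)"
        using C u d MV0_MV by (intro add_left_mono) auto
      finally show "wnorm (V l) (x - T 0 u x - (y - T 0 u y)) \<le> (1 + C) * wnorm (V l) (x - y)"
        by (simp add: algebra_simps)
    qed
    moreover have "continuous_map (subtopology (V_topology (V l)) ?X) (subtopology (V_topology (V l)) ?X) (R u)"
    proof (rule continuous_map_V_topology_Lipschitz[OF W[OF l] MV0_MV RX])
      fix x y assume xy: "x \<in> ?X" "y \<in> ?X"
      have "x - y \<in> ?X" using xy by (intro subspace_diff[OF sub0[OF l]])
      then have "wnorm (V l) (g.R u (x - y)) \<le> K * wnorm (V l) (x - y)"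
        using K(2) u by (simp add: F0)
      then show "wnorm (V l) (R u x - R u y) \<le> K * wnorm (V l) (x - y)"
        using u xy lin_onD(3)[OF g.lin_on_R[OF l u] g.subspace_F0[OF l], of x y]
        by (simp add: F0 R_eq)
    qed
    moreover have "R u (x - T 0 u x) = x" if "x \<in> ?X" for x
      using g.R_unique[OF u, of x] that X0 by (auto simp: R_eq[OF u] F0)
    moreover have "R u x - T 0 u (R u x) = x" if "x \<in> ?X" for x
      using g.R_eq[OF u, of x] that X0 by (auto simp: R_eq[OF u] F0)
    ultimately show "homeomorphic_maps (subtopology (V_topology (V l)) ?X)
          (subtopology (V_topology (V l)) ?X) (\<lambda>\<mu>. \<mu> - T 0 u \<mu>) (R u)"
      unfolding homeomorphic_maps_def topX by blast
    \<comment> \<open>The error after n terms is at most M \<rho>^n on the whole unit ball, so the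
      Neumann series converges in operator norm and not only at each vector.\<close>
    obtain M \<rho> where M: "0 \<le> M" "0 < \<rho>" "\<rho> < 1"
      "\<And>u x n. u \<in> {0..1} \<Longrightarrow> x \<in> g.F0 l \<Longrightarrow>
        wnorm (V l) (g.R u x - (\<Sum>i<n. (T 0 u ^^ i) x)) \<le> M * \<rho> ^ n * wnorm (V l) x"
      using g.resolvent[OF l] by metis
    have "op_norm0 (V l) (V l) (\<lambda>\<mu>. R u \<mu> - (\<Sum>i<n. (T 0 u ^^ i) \<mu>)) \<le> ennreal (M * \<rho> ^ n)" for n
      unfolding op_norm0_def
    proof (rule SUP_V_norm_le[OF MV0_MV])
      fix x assume x: "x \<in> ?X"
      show "wnorm (V l) (R u x - (\<Sum>i<n. (T 0 u ^^ i) x)) \<le> M * \<rho> ^ n * wnorm (V l) x"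
        using M(4)[OF u, of x n] x by (simp add: F0 R_eq[OF u])
      have "(T 0 u ^^ i) x \<in> ?X" for i using g.T_pow_F0[OF l u, of x i] x by (simp add: F0)
      then show "R u x - (\<Sum>i<n. (T 0 u ^^ i) x) \<in> MV (V l)"
        using RX[OF x] MV0_MV by (intro subspace_diff subspace_sum sub l) auto
    qed (use M in auto)
    note le = this
    have lim: "(\<lambda>n. ennreal (M * \<rho> ^ n)) \<longlonglongrightarrow> ennreal (M * 0)"
      using M by (intro tendsto_ennrealI tendsto_mult_left LIMSEQ_realpow_zero) auto
    show "(\<lambda>n. op_norm0 (V l) (V l) (\<lambda>\<mu>. R u \<mu> - (\<Sum>i<n. (T 0 u ^^ i) \<mu>))) \<longlonglongrightarrow> 0"
      by (rule tendsto_sandwich[OF always_eventually always_eventually tendsto_const lim[simplified]])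
        (use le in simp_all)
  qed

  have "(SUP u\<in>{0..1}. op_norm0 (V l) (V l) (R u)) < \<infinity>" if l: "l \<le> k" for l
  proof -
    obtain K where K: "0 \<le> K" "\<forall>u\<in>{0..1}. \<forall>x\<in>g.F0 l. wnorm (V l) (g.R u x) \<le> K * wnorm (V l) x"
      using g.R_bound[OF l] by blast
    have "op_norm0 (V l) (V l) (R u) \<le> ennreal K" if u: "u \<in> {0..1}" for u
      unfolding op_norm0_def
    proof (rule SUP_V_norm_le[OF MV0_MV _ _ K(1)])
      fix x assume x: "x \<in> MV0 (V l)"
      show "R u x \<in> MV (V l)" using g.R_F0[OF l u, of x] x MV0_MV by (auto simp: F0 R_eq[OF u])
      show "wnorm (V l) (R u x) \<le> K * wnorm (V l) x" using K(2) u x by (simp add: F0 R_eq[OF u])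
    qed
    then have "(SUP u\<in>{0..1}. op_norm0 (V l) (V l) (R u)) \<le> ennreal K" by (rule SUP_least)
    then show ?thesis by (auto intro: le_less_trans)
  qed
  then have max: "(MAX l\<in>{0..k}. SUP u\<in>{0..1}. op_norm0 (V l) (V l) (R u)) < \<infinity>"
    by (subst Max_less_iff) (auto simp: atLeastAtMost_iff)

  \<comment> \<open>\<open>R\<close> and \<open>g.R\<close> agree for parameters in the unit
    interval, the only ones that \<open>conv\<close> inspects.\<close>
  have R_conv: "g.conv l (\<lambda>v. R v \<mu>) (R u \<mu>) u" if "l \<le> k" "u \<in> {0..1}" "\<mu> \<in> MV0 (V l)" for l u \<mu>
    using g.conv_R[OF that(1,2), of \<mu>] that g.R_F0[OF that(1,2), of \<mu>] MV0_MV[of l]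
    by (auto simp: R_eq F0 intro!: g.conv_cong[of u "\<lambda>v. g.R v \<mu>" "\<lambda>v. R v \<mu>"])
  have R_cont: "continuous_map (top_of_set {0..1}) (V_topology (V l)) (\<lambda>u. R u \<mu>)"
    if "l \<le> k" "\<mu> \<in> MV0 (V l)" for l \<mu>
    using R_conv that by (intro contI)

  have R_deriv: "T 1 u (R u \<mu>) \<in> MV0 (V l) \<and> has_V_derivative (V l) (\<lambda>v. R v \<mu>) (R u (T 1 u (R u \<mu>))) u"
    if u: "u \<in> {0..1}" and l: "l \<le> k - 1" and \<mu>: "\<mu> \<in> MV0 (V (l + 1))" for u l \<mu>
  proof
    have l': "Suc l \<le> k" "l \<le> k" using l k by auto
    have RF: "g.R v \<mu> \<in> MV0 (V (Suc l))" if "v \<in> {0..1}" for v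
      using g.R_F0[OF l'(1) that, of \<mu>] \<mu> by (simp add: F0)
    show "T 1 u (R u \<mu>) \<in> MV0 (V l)"
      using g.T_Suc_F0[of 0 l u "g.R u \<mu>"] l' u RF[OF u] MV0_MV by (auto simp: F0 R_eq[OF u])
    have RF': "R v \<mu> \<in> MV (V l)" if "v \<in> {0..1}" for v
      using RF[OF that] MV0_MV MV_anti[of l "Suc l"] l' by (auto simp: R_eq[OF that])
    have "g.deriv l (\<lambda>v. g.R v \<mu>) (g.R u (T 1 u (g.R u \<mu>))) u"
      using g.deriv_R[OF l'(1) u] \<mu> by (simp add: F0)
    then have "g.deriv l (\<lambda>v. R v \<mu>) (R u (T 1 u (R u \<mu>))) u"
      unfolding g.deriv_def R_eq[OF u]
      by (rule g.conv_cong[rotated 2]) (use R_eq u subspace_0[OF sub[OF l'(2)]] in auto)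
    then show "has_V_derivative (V l) (\<lambda>v. R v \<mu>) (R u (T 1 u (R u \<mu>))) u"
      using RF' by (intro derivI l' u)
  qed

  \<comment> \<open>Evaluation at a set is bounded by the norm at level 0, so convergence of the
    iterates in norm is setwise convergence, with a limit independent of \<open>x\<close>.\<close>
  have inv_lim: "(\<lambda>n. smeasure ((kernel_op (P u) ^^ n) (dirac x)) A) \<longlonglongrightarrow> smeasure (g.invariant u) A"
    if u: "u \<in> {0..1}" for u x A
  proof -
    have dx: "dirac x \<in> MV (V 0)" by (rule dirac_in_MV[OF W]) simp
    have lim: "(\<lambda>n. wnorm (V 0) ((T 0 u ^^ n) (dirac x) - g.invariant u)) \<longlonglongrightarrow> 0"
      using g.T_pow_tendsto_invariant[OF u dx] by (simp add: smeasure_dirac measure_return)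
    have le: "\<bar>smeasure ((T 0 u ^^ n) (dirac x)) A - smeasure (g.invariant u) A\<bar>
        \<le> wnorm (V 0) ((T 0 u ^^ n) (dirac x) - g.invariant u)" for n
    proof -
      have "(T 0 u ^^ n) (dirac x) - g.invariant u \<in> MV (V 0)"
        using g.T_pow_F[OF _ u dx, of n] g.F_0[of k "g.invariant u"] g.invariant(1)[OF u]
        by (intro subspace_diff[OF sub]) auto
      from abs_smeasure_le_wnorm[OF W this, of A] show ?thesis by simp
    qed
    have "(\<lambda>n. smeasure ((T 0 u ^^ n) (dirac x)) A - smeasure (g.invariant u) A) \<longlonglongrightarrow> 0"
      by (rule Lim_null_comparison[OF always_eventually lim]) (use le in simp)
    then show ?thesis by (simp add: T_0[OF u] LIM_zero_iff)
  qed
  have inv_prob: "prob_smeasure (g.invariant u)" "T 0 u (g.invariant u) = g.invariant u"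
    if u: "u \<in> {0..1}" for u
  proof -
    show "prob_smeasure (g.invariant u)"
      unfolding prob_smeasure_def
    proof
      \<comment> \<open>Positivity is invisible in the formula for \<open>g.invariant u\<close>; it
        is inherited from the iterates of a Dirac measure.\<close>
      show "\<forall>A\<in>sets borel. 0 \<le> smeasure (g.invariant u) A"
      proof
        fix A :: "'a set" assume A: "A \<in> sets borel"
        show "0 \<le> smeasure (g.invariant u) A"
          by (rule LIMSEQ_le_const[OF inv_lim[OF u, of undefined A]])
            (use smeasure_kernel_op_pow_dirac_nonneg[OF kernel[OF u] A] in simp)
      qed
      show "smeasure (g.invariant u) UNIV = 1" by (rule g.invariant(2)[OF u])
    qed
    show "T 0 u (g.invariant u) = g.invariant u" by (rule g.invariant(3)[OF u])
  qed
  have inv_unique: "\<nu> = g.invariant u" if u: "u \<in> {0..1}" and \<nu>: "prob_smeasure \<nu>" "T 0 u \<nu> = \<nu>" for u \<nu>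
    using smeasure_invariant_eq_limit[OF kernel[OF u] _ _ _ inv_lim[OF u], of _ \<nu>] \<nu>
    by (intro signed_measure_eqI) (auto simp: prob_smeasure_def T_0[OF u])
  have inv_eq: "invariant_prob (T 0 u) = g.invariant u" if u: "u \<in> {0..1}" for u
    unfolding invariant_prob_def
    by (rule the_equality) (use inv_prob[OF u] inv_unique[OF u] in blast)+
  have inv: "(\<exists>!\<mu>. prob_smeasure \<mu> \<and> T 0 u \<mu> = \<mu>) \<and> invariant_prob (T 0 u) \<in> MV (V k)"
    if u: "u \<in> {0..1}" for u
    unfolding inv_eq[OF u] using inv_prob[OF u] inv_unique[OF u] g.invariant(1)[OF u] by blast

  have fd: "g.f_deriv l u \<in> MV0 (V (k - l)) \<and> has_V_derivative (V (k - l)) (g.f_deriv (l - 1)) (g.f_deriv l u) u \<and>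
      (\<forall>s\<in>{1..l}. T s u (g.f_deriv (l - s) u) \<in> MV0 (V (k - l))) \<and>
      g.f_deriv l u = (\<Sum>s=1..l. real (l choose s) *\<^sub>R R u (T s u (g.f_deriv (l - s) u)))"
    if u: "u \<in> {0..1}" and l: "l \<in> {1..k}" for u l
  proof (intro conjI ballI)
    obtain n where n: "l = Suc n" using l by (cases l) (auto simp: atLeastAtMost_iff)
    have lk: "l \<le> k" using l by (simp add: atLeastAtMost_iff)
    show "g.f_deriv l u \<in> MV0 (V (k - l))"
      using g.f_deriv_F[OF lk u] g.mass_f_deriv[OF lk u] n by (simp add: MV0_def)
    have "g.f_deriv n v \<in> MV (V (k - l))" if "v \<in> {0..1}" for v
      using g.f_deriv_F[of n v] that n lk subsetD[OF MV_anti[of "k - l" "k - n"]]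
      by (simp add: diff_le_mono2)
    then show "has_V_derivative (V (k - l)) (g.f_deriv (l - 1)) (g.f_deriv l u) u"
      using g.deriv_f_deriv[of n u] u lk n by (intro derivI) auto
    show "T s u (g.f_deriv (l - s) u) \<in> MV0 (V (k - l))" if "s \<in> {1..l}" for s
      using g.T_f_deriv_F0[of "s - 1" l u] that lk u by (auto simp: F0 atLeastAtMost_iff)
    \<comment> \<open>Only the index shift separates this from the defining recursion.\<close>
    show "g.f_deriv l u = (\<Sum>s=1..l. real (l choose s) *\<^sub>R R u (T s u (g.f_deriv (l - s) u)))"
      unfolding One_nat_def sum.atLeast1_atMost_eq n g.f_deriv.simps(2) R_eq[OF u]
      by (simp add: lessThan_Suc_atMost)
  qed
  have fc: "continuous_map (top_of_set {0..1}) (V_topology (V (k - l))) (g.f_deriv l)" if "l \<le> k" for l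
    using g.conv_f_deriv[OF that] by (intro contI) auto
  have ex: "\<exists>f :: nat \<Rightarrow> real \<Rightarrow> 'a signed_measure.
       (\<forall>u\<in>{0..1}. f 0 u = invariant_prob (T 0 u)) \<and>
       continuous_map (top_of_set {0..1}) (V_topology (V k)) (f 0) \<and>
       (\<forall>l\<in>{1..k}.
          (\<forall>u\<in>{0..1}. f l u \<in> MV0 (V (k - l))) \<and>
          continuous_map (top_of_set {0..1}) (V_topology (V (k - l))) (f l) \<and>
          (\<forall>u\<in>{0..1}.
             has_V_derivative (V (k - l)) (f (l - 1)) (f l u) u \<and>
             (\<forall>s\<in>{1..l}. T s u (f (l - s) u) \<in> MV0 (V (k - l))) \<and>
             f l u = (\<Sum>s=1..l. real (l choose s) *\<^sub>R R u (T s u (f (l - s) u)))))"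
  proof (intro exI[of _ g.f_deriv] conjI ballI)
    show "g.f_deriv 0 u = invariant_prob (T 0 u)" if "u \<in> {0..1}" for u
      using inv_eq[OF that] by simp
    show "continuous_map (top_of_set {0..1}) (V_topology (V k)) (g.f_deriv 0)"
      using fc[of 0] by simp
    fix l assume l: "l \<in> {1..k}"
    show "continuous_map (top_of_set {0..1}) (V_topology (V (k - l))) (g.f_deriv l)"
      using fc[of l] l by (simp add: atLeastAtMost_iff)
    fix u :: real assume u: "u \<in> {0..1}"
    note fd = fd[OF u l]
    show "g.f_deriv l u \<in> MV0 (V (k - l))"
      and "has_V_derivative (V (k - l)) (g.f_deriv (l - 1)) (g.f_deriv l u) u"
      and "g.f_deriv l u = (\<Sum>s=1..l. real (l choose s) *\<^sub>R R u (T s u (g.f_deriv (l - s) u)))"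
      using fd by blast+
    show "T s u (g.f_deriv (l - s) u) \<in> MV0 (V (k - l))" if "s \<in> {1..l}" for s
      using fd that by blast
  qed
  show ?thesis
    by (rule conjI[OF _ conjI[OF max conjI[OF _ conjI[OF _ conjI[OF _ ex]]]]];
        intro ballI allI impI; rule iso R_cont R_deriv inv; assumption)
qed

end
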